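(* Suppose there are constants $C_M>0$ and $\alpha_M>0$ such that $|M_{ij}|\le C_M\,[1+|i-j|]^{-(2d+\alpha_M)}$ for all $i,j\in\mathbb{Z}^d$. Suppose that the finite volume Gibbs measures satisfy a uniform Poincaré inequality: there is a constant $\varrho>0$ such that for every finite $\Lambda\subset\mathbb{Z}^d$, every boundary condition $\omega$ and every $f\in H^1(\mu_\Lambda^\omega)$, $$\operatorname{var}_{\mu_\Lambda^\omega}(f)\le \frac1\varrho\int\sum_{x\in\Lambda}|\nabla_x f|^2\,d\mu_\Lambda^\omega .$$ Then there is a constant $C>0$, independent of $\Lambda$, $\omega$, $f$ and $g$, such that for every finite $\Lambda\subset\mathbb{Z}^d$, every boundary condition $\omega$ and all $f,g\in H^1(\mu_\Lambda^\omega)$ with $\operatorname{supp} f,\operatorname{supp} g\subset\Lambda$, $$|\operatorname{cov}_{\mu_\Lambda^\omega}(f,g)|\le C\,\frac{|\operatorname{supp} f|^{1/2}\,|\operatorname{supp} g|^{1/2}}{[1+\operatorname{dist}(\operatorname{supp} f,\operatorname{supp} g)]^{d+\alpha_M/2}}\left(\int|\nabla f|^2d\mu_\Lambda^\omega\right)^{1/2}\left(\int|\nabla g|^2d\mu_\Lambda^\omega\right)^{1/2}.$$ In particular, the decay of correlations condition (DC) and the Dobrushin–Shlosman mixing condition (DS) are both satisfied.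
   Context: Setting. Fix $d\ge1$, functions $\psi_i:\mathbb{R}\to\mathbb{R}$ (single-site potentials), numbers $s_i\in\mathbb{R}$ (external field), for $i\in\mathbb{Z}^d$, and a symmetric real matrix $(M_{ij})_{i,j\in\mathbb{Z}^d}$. Write $|i|=\max_k|i_k|$ for $i\in\mathbb{Z}^d$. Standing assumptions: (diagonal dominance) there is $\delta>0$ with $\delta+\sum_{j\ne i}|M_{ij}|\le M_{ii}$ for all $i$; (bounded perturbation of convex) $\psi_i=\psi_{i,b}+\psi_{i,c}$ and there is a constant $C_\psi$, independent of $i$, with $\psi_{i,c}''(r)\ge0$ and $|\psi_{i,b}(r)|+|\psi_{i,b}'(r)|\le C_\psi$ for all $r\in\mathbb{R}$. For finite $\Lambda\subset\mathbb{Z}^d$ and $\omega=(\omega_j)_{j\notin\Lambda}$, the finite volume Gibbs measure is the probability measure on $\mathbb{R}^\Lambda$ $$d\mu_\Lambda^\omega=\frac1{Z_\Lambda^\omega}\exp\Big\{-\sum_{i\in\Lambda}(\psi_i(x_i)+s_ix_i)-\sum_{i,j\in\Lambda}M_{ij}x_ix_j-2\sum_{i\in\Lambda,j\notin\Lambda}M_{ij}x_i\omega_j\Big\}dx .$$ Only well-tempered boundary conditions are considered: $\max_{i\in\Lambda}\sum_{j\notin\Lambda}|M_{ij}||\omega_j|<\infty$. $\nabla_i$ is the partial derivative with respect to $x_i$, $\nabla f=(\nabla_if)_{i\in\Lambda}$, and $H^1(\mu_\Lambda^\omega)$ is the space of functions $f$ of $(x_i)_{i\in\Lambda}$ with $f,\nabla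 f\in L^2(\mu_\Lambda^\omega)$. $\operatorname{supp}f$ is the set of sites on whose spin values $f$ depends, $|\operatorname{supp} f|$ its cardinality, and $\operatorname{dist}$ is the distance for $|\cdot|$. $|\nabla f|_{L^\infty}$ is the supremum of $|\nabla f|$. (DC): there are finite constants $C,\alpha,\beta>0$ such that for every finite $\Lambda$, every boundary condition $\omega$ and all functions $f,g$ (smooth with bounded derivatives) with supports in $\Lambda$, $$|\operatorname{cov}_{\mu_\Lambda^\omega}(f,g)|\le C\frac{|\operatorname{supp} f|^\beta|\operatorname{supp} g|^\beta}{[1+\operatorname{dist}(\operatorname{supp} f,\operatorname{supp} g)]^{d+\alpha}}|\nabla f|_{L^\infty}|\nabla g|_{L^\infty}.$$ (DS): there are finite constants $C,\alpha,\beta>0$ such that for every finite $\Lambda$, every function $f$ (smooth with bounded derivatives) with support in $\Lambda$, every site $i\notin\Lambda$ and all boundary conditions $\omega,\tilde\omega$ with $\tilde\omega_k=\omega_k$ for all $k\ne i$, $$\Big|\int f\,d\mu_\Lambda^\omega-\int f\,d\mu_\Lambda^{\tilde\omega}\Big|\le C\frac{|\operatorname{supp} f|^\beta}{[1+\operatorname{dist}(\operatorname{supp} f,i)]^{d+\alpha}}|\tilde\omega_i-\omega_i|\,|\nabla f|_{L^\infty}.$$ *)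

theory Defs
  imports "HOL-Analysis.Analysis"
begin

section \<open>The lattice\<close>

text \<open>Sites are elements of \<open>int ^ 'd\<close>, so the dimension is \<open>CARD('d)\<close>.\<close>

definition site_norm :: "int ^ 'd \<Rightarrow> real"
  where "site_norm i = real_of_int (Max (range (\<lambda>k. \<bar>i $ k\<bar>)))"

text \<open>For an empty argument the value is an unspecified real number.\<close>

definition site_dist :: "(int ^ 'd) set \<Rightarrow> (int ^ 'd) set \<Rightarrow> real"
  where "site_dist A B = (INF p\<in>A \<times> B. site_norm (fst p - snd p))"

section \<open>Functions on the configuration space over a set of sites\<close>

text \<open>A point of \<open>\<real>\<close> to the power \<open>\<Lambda>\<close> is a function on all sites that is \<open>undefined\<close> off
  \<open>\<Lambda>\<close>. Functions of the spins in \<open>\<Lambda>\<close> are total functions of which only the values on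
  \<open>configs \<Lambda>\<close> matter.\<close>

definition configs :: "'i set \<Rightarrow> ('i \<Rightarrow> real) set"
  where "configs \<Lambda> = (\<Pi>\<^sub>E i\<in>\<Lambda>. UNIV)"

definition lebesgue_configs :: "'i set \<Rightarrow> ('i \<Rightarrow> real) measure"
  where "lebesgue_configs \<Lambda> = (\<Pi>\<^sub>M i\<in>\<Lambda>. lborel)"

text \<open>By construction the support is a subset of \<open>\<Lambda>\<close>. For finite \<open>\<Lambda>\<close> it is the smallest set of
  sites such that \<open>f\<close> is a function of the spins in that set.\<close>

definition support :: "'i set \<Rightarrow> (('i \<Rightarrow> real) \<Rightarrow> real) \<Rightarrow> 'i set"
  where "support \<Lambda> f = {i\<in>\<Lambda>. \<exists>x\<in>configs \<Lambda>. \<exists>t. f (x(i := t)) \<noteq> f x}"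

definition partial_deriv :: "'i \<Rightarrow> (('i \<Rightarrow> real) \<Rightarrow> real) \<Rightarrow> ('i \<Rightarrow> real) \<Rightarrow> real"
  where "partial_deriv i f x = deriv (\<lambda>t. f (x(i := t))) (x i)"

definition smooth :: "'i set \<Rightarrow> (('i \<Rightarrow> real) \<Rightarrow> real) \<Rightarrow> bool"
  where "smooth \<Lambda> f \<longleftrightarrow>
    (\<forall>is. set is \<subseteq> \<Lambda> \<longrightarrow>
      continuous_on (configs \<Lambda>) (foldr partial_deriv is f) \<and>
      (\<forall>i\<in>\<Lambda>. \<forall>x\<in>configs \<Lambda>.
        (\<lambda>t. foldr partial_deriv is f (x(i := t))) differentiable at (x i)))"

definition test_function :: "'i set \<Rightarrow> (('i \<Rightarrow> real) \<Rightarrow> real) \<Rightarrow> bool"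
  where "test_function \<Lambda> \<phi> \<longleftrightarrow>
    smooth \<Lambda> \<phi> \<and> (\<exists>r. \<forall>x\<in>configs \<Lambda>. \<phi> x \<noteq> 0 \<longrightarrow> (\<forall>i\<in>\<Lambda>. \<bar>x i\<bar> \<le> r))"

definition locally_integrable :: "'i set \<Rightarrow> (('i \<Rightarrow> real) \<Rightarrow> real) \<Rightarrow> bool"
  where "locally_integrable \<Lambda> f \<longleftrightarrow>
    f \<in> borel_measurable (lebesgue_configs \<Lambda>) \<and>
    (\<forall>r. set_integrable (lebesgue_configs \<Lambda>) (\<Pi>\<^sub>E i\<in>\<Lambda>. {-r..r}) f)"

definition has_weak_partial_deriv ::
    "'i set \<Rightarrow> 'i \<Rightarrow> (('i \<Rightarrow> real) \<Rightarrow> real) \<Rightarrow> (('i \<Rightarrow> real) \<Rightarrow> real) \<Rightarrow> bool"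
  where "has_weak_partial_deriv \<Lambda> i f g \<longleftrightarrow>
    locally_integrable \<Lambda> f \<and> locally_integrable \<Lambda> g \<and>
    (\<forall>\<phi>. test_function \<Lambda> \<phi> \<longrightarrow>
      (\<integral>x. f x * partial_deriv i \<phi> x \<partial>lebesgue_configs \<Lambda>) =
      - (\<integral>x. g x * \<phi> x \<partial>lebesgue_configs \<Lambda>))"

definition L2 :: "'a measure \<Rightarrow> ('a \<Rightarrow> real) \<Rightarrow> bool"
  where "L2 \<mu> f \<longleftrightarrow> f \<in> borel_measurable \<mu> \<and> integrable \<mu> (\<lambda>x. (f x)\<^sup>2)"

text \<open>\<open>H1_with_gradient \<Lambda> \<mu> f F\<close> says that \<open>f\<close> belongs to the Sobolev space of \<open>\<mu>\<close> and that
  \<open>(F i)\<close>, for \<open>i \<in> \<Lambda>\<close>, is (a version of) its gradient. The gradient is weak with respect to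
  Lebesgue measure and unique up to null sets.\<close>

definition H1_with_gradient ::
    "'i set \<Rightarrow> ('i \<Rightarrow> real) measure \<Rightarrow> (('i \<Rightarrow> real) \<Rightarrow> real) \<Rightarrow> ('i \<Rightarrow> ('i \<Rightarrow> real) \<Rightarrow> real) \<Rightarrow> bool"
  where "H1_with_gradient \<Lambda> \<mu> f F \<longleftrightarrow>
    L2 \<mu> f \<and> (\<forall>i\<in>\<Lambda>. L2 \<mu> (F i) \<and> has_weak_partial_deriv \<Lambda> i f (F i))"

definition smooth_bounded_derivs :: "'i set \<Rightarrow> (('i \<Rightarrow> real) \<Rightarrow> real) \<Rightarrow> bool"
  where "smooth_bounded_derivs \<Lambda> f \<longleftrightarrow>
    smooth \<Lambda> f \<and> (\<forall>i\<in>\<Lambda>. bounded (partial_deriv i f ` configs \<Lambda>))"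

definition grad_sup :: "'i set \<Rightarrow> (('i \<Rightarrow> real) \<Rightarrow> real) \<Rightarrow> real"
  where "grad_sup \<Lambda> f = (SUP x\<in>configs \<Lambda>. sqrt (\<Sum>i\<in>\<Lambda>. (partial_deriv i f x)\<^sup>2))"

section \<open>Covariance and variance\<close>

definition covariance :: "'a measure \<Rightarrow> ('a \<Rightarrow> real) \<Rightarrow> ('a \<Rightarrow> real) \<Rightarrow> real"
  where "covariance \<mu> f g = (\<integral>x. (f x - (\<integral>y. f y \<partial>\<mu>)) * (g x - (\<integral>y. g y \<partial>\<mu>)) \<partial>\<mu>)"

definition var :: "'a measure \<Rightarrow> ('a \<Rightarrow> real) \<Rightarrow> real"
  where "var \<mu> f = (\<integral>x. (f x - (\<integral>y. f y \<partial>\<mu>))\<^sup>2 \<partial>\<mu>)"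

section \<open>Finite volume Gibbs measures\<close>

text \<open>A boundary condition \<open>\<omega>\<close> is a function on all sites of which only the values off \<open>\<Lambda>\<close> are
  used.\<close>

definition well_tempered ::
    "('i \<Rightarrow> 'i \<Rightarrow> real) \<Rightarrow> 'i set \<Rightarrow> ('i \<Rightarrow> real) \<Rightarrow> bool"
  where "well_tempered M \<Lambda> \<omega> \<longleftrightarrow> (\<forall>i\<in>\<Lambda>. (\<lambda>j. \<bar>M i j\<bar> * \<bar>\<omega> j\<bar>) summable_on (- \<Lambda>))"

definition hamiltonian ::
    "('i \<Rightarrow> 'i \<Rightarrow> real) \<Rightarrow> ('i \<Rightarrow> real \<Rightarrow> real) \<Rightarrow> ('i \<Rightarrow> real) \<Rightarrow>
      'i set \<Rightarrow> ('i \<Rightarrow> real) \<Rightarrow> ('i \<Rightarrow> real) \<Rightarrow> real"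
  where "hamiltonian M \<psi> s \<Lambda> \<omega> x =
    (\<Sum>i\<in>\<Lambda>. \<psi> i (x i) + s i * x i) + (\<Sum>i\<in>\<Lambda>. \<Sum>j\<in>\<Lambda>. M i j * x i * x j)
    + 2 * (\<Sum>i\<in>\<Lambda>. \<Sum>\<^sub>\<infinity>j\<in>- \<Lambda>. M i j * x i * \<omega> j)"

definition partition_function ::
    "('i \<Rightarrow> 'i \<Rightarrow> real) \<Rightarrow> ('i \<Rightarrow> real \<Rightarrow> real) \<Rightarrow> ('i \<Rightarrow> real) \<Rightarrow>
      'i set \<Rightarrow> ('i \<Rightarrow> real) \<Rightarrow> real"
  where "partition_function M \<psi> s \<Lambda> \<omega> =
    (\<integral>x. exp (- hamiltonian M \<psi> s \<Lambda> \<omega> x) \<partial>lebesgue_configs \<Lambda>)"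

definition gibbs ::
    "('i \<Rightarrow> 'i \<Rightarrow> real) \<Rightarrow> ('i \<Rightarrow> real \<Rightarrow> real) \<Rightarrow> ('i \<Rightarrow> real) \<Rightarrow>
      'i set \<Rightarrow> ('i \<Rightarrow> real) \<Rightarrow> ('i \<Rightarrow> real) measure"
  where "gibbs M \<psi> s \<Lambda> \<omega> = density (lebesgue_configs \<Lambda>)
    (\<lambda>x. ennreal (exp (- hamiltonian M \<psi> s \<Lambda> \<omega> x) / partition_function M \<psi> s \<Lambda> \<omega>))"

section \<open>Mixing conditions\<close>

text \<open>If one of the supports is empty, the unspecified distance is harmless in the following
  bounds: the factor \<open>0 powr \<beta> = 0\<close> makes the right-hand side vanish, as does the left-hand side.\<close>

definition decay_of_correlations ::
    "(int ^ 'd \<Rightarrow> int ^ 'd \<Rightarrow> real) \<Rightarrow> (int ^ 'd \<Rightarrow> real \<Rightarrow> real) \<Rightarrow> (int ^ 'd \<Rightarrow> real) \<Rightarrow> bool"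
  where "decay_of_correlations M \<psi> s \<longleftrightarrow>
    (\<exists>C \<alpha> \<beta>. C > 0 \<and> \<alpha> > 0 \<and> \<beta> > 0 \<and>
      (\<forall>\<Lambda> \<omega> f g. finite \<Lambda> \<longrightarrow> well_tempered M \<Lambda> \<omega> \<longrightarrow>
        smooth_bounded_derivs \<Lambda> f \<longrightarrow> smooth_bounded_derivs \<Lambda> g \<longrightarrow>
        \<bar>covariance (gibbs M \<psi> s \<Lambda> \<omega>) f g\<bar> \<le>
          C * (real (card (support \<Lambda> f)) powr \<beta> * real (card (support \<Lambda> g)) powr \<beta>)
            / (1 + site_dist (support \<Lambda> f) (support \<Lambda> g)) powr (real CARD('d) + \<alpha>)
            * grad_sup \<Lambda> f * grad_sup \<Lambda> g))"

definition dobrushin_shlosman ::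
    "(int ^ 'd \<Rightarrow> int ^ 'd \<Rightarrow> real) \<Rightarrow> (int ^ 'd \<Rightarrow> real \<Rightarrow> real) \<Rightarrow> (int ^ 'd \<Rightarrow> real) \<Rightarrow> bool"
  where "dobrushin_shlosman M \<psi> s \<longleftrightarrow>
    (\<exists>C \<alpha> \<beta>. C > 0 \<and> \<alpha> > 0 \<and> \<beta> > 0 \<and>
      (\<forall>\<Lambda> f i \<omega> \<omega>'. finite \<Lambda> \<longrightarrow> smooth_bounded_derivs \<Lambda> f \<longrightarrow> i \<notin> \<Lambda> \<longrightarrow>
        well_tempered M \<Lambda> \<omega> \<longrightarrow> well_tempered M \<Lambda> \<omega>' \<longrightarrow>
        (\<forall>k. k \<notin> \<Lambda> \<longrightarrow> k \<noteq> i \<longrightarrow> \<omega>' k = \<omega> k) \<longrightarrow>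
        \<bar>(\<integral>x. f x \<partial>gibbs M \<psi> s \<Lambda> \<omega>) - (\<integral>x. f x \<partial>gibbs M \<psi> s \<Lambda> \<omega>')\<bar> \<le>
          C * real (card (support \<Lambda> f)) powr \<beta>
            / (1 + site_dist (support \<Lambda> f) {i}) powr (real CARD('d) + \<alpha>)
            * \<bar>\<omega>' i - \<omega> i\<bar> * grad_sup \<Lambda> f))"

end

theory Submission
  imports Defs "HOL-Probability.Probability"
begin

text \<open>Fix a finite volume and let \<open>f\<close> depend on the spins in \<open>A\<close>. Averaging \<open>f\<close> over the spins in a
  neighbourhood \<open>P\<close> of \<open>A\<close> gives \<open>E P f\<close>, a function of the spins off \<open>P\<close> whose derivative at a site
  \<open>j\<close> is a conditional covariance of \<open>f\<close> with the linear function \<open>\<Sum>i\<in>P. M i j * x i\<close>. For a larger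
  neighbourhood \<open>Q\<close>, split \<open>f - E Q f = (f - E P f) + (E P f - E Q f)\<close>. The covariances of the second
  part are controlled by the variance lost in passing from \<open>P\<close> to \<open>Q\<close>, those of the first part only
  see the interaction between \<open>P\<close> and the complement of \<open>Q\<close>. With the Poincare inequality this gives
  \<open>Var (E Q f) \<le> C (Var (E P f) - Var (E Q f)) + \<epsilon> Var f\<close>, that is, contraction up to a small error
  (hole filling). Iterating over many layers between the supports of \<open>f\<close> and \<open>g\<close> makes
  \<open>Var (E P f)\<close> small, and it bounds the covariance because \<open>cov f g = cov (E P f) g\<close> as long as \<open>g\<close>
  does not depend on the spins in \<open>P\<close>.

  No Poincare inequality is needed for slices of \<open>f\<close>: in conditional measures it is only applied to
  linear functions, by duality. As the resulting bound involves only variances, \<open>f\<close> and \<open>g\<close> may be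
  truncated to bounded functions.\<close>

section \<open>Configuration spaces and weak derivatives\<close>

text \<open>The constant of one hole-filling step is the square of a bound for the row sums of
  \<open>M\<close>, divided by \<open>\<rho>\<^sup>2\<close> up to a factor. It may be large, but
  every \<open>c\<close> gives a ratio \<open>c / (1 + c) < 1\<close>. A geometric factor beats any
  power of the distance after a small power of the distance many steps, so the layers can be nearly
  as wide as the distance itself. The error of a layer is the squared norm of the interaction across
  it. Of the exponent \<open>2 * d + \<alpha>\<close>, slightly more than \<open>d\<close> is spent
  on summing over a row, and a rate slightly below \<open>d + \<alpha>\<close> is left for the norm;
  this leaves room for the layers. Errors are compared with variances, that is with squares, and the
  root is taken last, so the rate of the norm is the rate of the covariance.

  For (DS), moving a boundary spin produces the covariance of \<open>f\<close> with a linear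
  function of the spins of the whole volume. Its support may meet that of \<open>f\<close>, so the
  covariance bound does not apply to it directly; the linear function has to be cut according to the
  distance from the boundary site.\<close>

abbreviation leb :: "'i set \<Rightarrow> ('i \<Rightarrow> real) measure"
  where "leb \<equiv> lebesgue_configs"

abbreviation meas :: "'i set \<Rightarrow> (('i \<Rightarrow> real) \<Rightarrow> real) set"
  where "meas P \<equiv> borel_measurable (leb P)"

abbreviation l1 :: "'i set \<Rightarrow> ('i \<Rightarrow> real) \<Rightarrow> real"
  where "l1 P x \<equiv> \<Sum>i\<in>P. \<bar>x i\<bar>"

lemma space_leb [simp]: "space (leb V) = configs V"
  by (simp add: lebesgue_configs_def configs_def space_PiM)

lemma configs_upd: "x \<in> configs V \<Longrightarrow> i \<in> V \<Longrightarrow> x(i := t) \<in> configs V"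
  by (auto simp: configs_def PiE_def extensional_def)

lemma measurable_leb_component:
  "i \<in> V \<Longrightarrow> (\<lambda>x. x i) \<in> meas V"
proof -
  assume "i \<in> V"
  then have "(\<lambda>x. x i) \<in> measurable (leb V) lborel"
    unfolding lebesgue_configs_def by (rule measurable_component_singleton)
  then show ?thesis by simp
qed

lemma measurable_into_leb:
  assumes "\<And>i. i \<in> V \<Longrightarrow> (\<lambda>z. g z i) \<in> borel_measurable N"
    and "\<And>z. z \<in> space N \<Longrightarrow> g z \<in> configs V"
  shows "g \<in> measurable N (leb V)"
proof -
  have "(\<lambda>z i. g z i) \<in> measurable N (Pi\<^sub>M V (\<lambda>_. lborel))"
    by (rule measurable_PiM_single') (use assms in \<open>auto simp: configs_def\<close>)
  then show ?thesis by (simp add: lebesgue_configs_def)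
qed

text \<open>The map \<open>\<lambda>x. restrict x V\<close> is a continuous retraction of the space
  of all functions onto \<open>configs V\<close>, so \<open>f\<close> extends continuously to that
  space. Countability of the index type lets coordinatewise measurability imply Borel measurability
  for the product topology.\<close>

lemma borel_measurable_continuous_on_configs:
  fixes f :: "('i::countable \<Rightarrow> real) \<Rightarrow> real"
  assumes "continuous_on (configs V) f"
  shows "f \<in> meas V"
proof -
  have "restrict x V \<in> configs V" for x :: "'i \<Rightarrow> real"
    by (auto simp: configs_def)
  moreover have "continuous_on UNIV (\<lambda>x::'i\<Rightarrow>real. restrict x V)"
  proof (rule continuous_on_coordinatewise_then_product)
    fix i show "continuous_on UNIV (\<lambda>x::'i\<Rightarrow>real. restrict x V i)"
      by (cases "i \<in> V") (auto intro!: continuous_on_product_coordinates)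
  qed
  ultimately have "continuous_on UNIV (\<lambda>x. f (restrict x V))"
    by (intro continuous_on_compose2[OF assms]) auto
  then have 1: "(\<lambda>x. f (restrict x V)) \<in> borel_measurable borel"
    by (rule borel_measurable_continuous_onI)
  have "(\<lambda>x. x) \<in> borel_measurable (leb V)"
  proof (rule measurable_coordinatewise_then_product)
    fix i show "(\<lambda>x. x i) \<in> meas V"
    proof (cases "i \<in> V")
      case False
      then have "x i = undefined" if "x \<in> space (leb V)" for x
        using that by (auto simp: configs_def PiE_def extensional_def)
      then show ?thesis using measurable_cong[of "leb V" "\<lambda>x. x i" "\<lambda>_. undefined"] by auto
    qed (rule measurable_leb_component)
  qed
  from measurable_compose[OF this 1]
  have "(\<lambda>x. f (restrict x V)) \<in> meas V" .
  moreover have "f (restrict x V) = f x" if "x \<in> space (leb V)" for x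
    using that by (auto simp: configs_def intro!: arg_cong[of _ _ f])
  ultimately show ?thesis by (subst measurable_cong[symmetric]) auto
qed

section \<open>Boxes, local integrability and integration by parts\<close>

lemma compact_PiE_Icc: "compact (PiE V (\<lambda>_. {-r..r}) :: ('i \<Rightarrow> real) set)"
proof -
  \<comment> \<open>Off \<open>V\<close> the only admissible value is \<open>undefined\<close>, so
    the box is a full product of compact factors and Tychonoff's theorem applies.\<close>
  have eq: "PiE V (\<lambda>_. {-r..r}) = PiE UNIV (\<lambda>i. if i \<in> V then {-r..r} else {undefined::real})"
    by (auto simp: PiE_def Pi_def extensional_def split: if_splits)
  have "compactin (product_topology (\<lambda>i. euclidean) UNIV)
      (PiE UNIV (\<lambda>i. if i \<in> V then {-r..r} else {undefined::real}))"
    by (subst compactin_PiE) auto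
  then show ?thesis unfolding eq euclidean_product_topology by simp
qed

lemma PiE_Icc_subset_configs: "PiE V (\<lambda>_. {-r..r}) \<subseteq> configs V"
  by (auto simp: configs_def)

lemma sets_PiE_Icc [measurable]:
  "finite V \<Longrightarrow> PiE V (\<lambda>_. {-r..r::real}) \<in> sets (leb V)"
  unfolding lebesgue_configs_def by (intro sets_PiM_I_finite) auto

lemma emeasure_PiE_Icc:
  assumes "finite V" "r \<ge> 0"
  shows "emeasure (leb V) (PiE V (\<lambda>_. {-r..r::real})) = ennreal ((2 * r) ^ card V)"
proof -
  interpret product_sigma_finite "\<lambda>_. lborel :: real measure" ..
  show ?thesis unfolding lebesgue_configs_def
    using assms by (subst emeasure_PiM) (auto simp: ennreal_power)
qed

lemma set_integrable_PiE_Icc: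
  assumes "finite V" "v \<in> meas V"
    and bd: "\<And>x. x \<in> PiE V (\<lambda>_. {-r..r}) \<Longrightarrow> \<bar>v x\<bar> \<le> (B::real)"
  shows "set_integrable (leb V) (PiE V (\<lambda>_. {-r..r})) v"
proof (cases "r \<ge> 0")
  case True
  show ?thesis unfolding set_integrable_def
  proof (rule Bochner_Integration.integrable_bound)
    show "integrable (leb V) (\<lambda>x. indicator (PiE V (\<lambda>_. {-r..r})) x * B)"
      using emeasure_PiE_Icc[OF assms(1) True] assms(1)
      by (intro integrable_mult_left integrable_real_indicator) auto
    show "(\<lambda>x. indicat_real (PiE V (\<lambda>_. {-r..r})) x *\<^sub>R v x) \<in> meas V"
      using assms by measurable
    show "AE x in leb V. norm (indicat_real (PiE V (\<lambda>_. {-r..r})) x *\<^sub>R v x)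
          \<le> norm (indicator (PiE V (\<lambda>_. {-r..r})) x * B)"
      using bd by (auto simp: indicator_def intro!: AE_I2) (metis abs_ge_self order_trans)
  qed
next
  \<comment> \<open>For \<open>r < 0\<close> the box is empty, except that for empty
    \<open>V\<close> it is still the single point of \<open>configs {}\<close>, which has finite
    mass.\<close>
  case False
  then have "(PiE V (\<lambda>_. {-r..r})) = (if V = {} then {\<lambda>_. undefined} else {})"
    by (auto simp: PiE_eq_empty_iff)
  then show ?thesis
  proof (cases "V = {}")
    case True
    have "leb {} = count_space {\<lambda>_::'a. undefined::real}"
      by (simp add: lebesgue_configs_def PiM_empty)
    then show ?thesis unfolding set_integrable_def True by (simp add: integrable_count_space)
  qed (simp add: set_integrable_def)
qed

text \<open>On every line in direction \<open>j\<close> the product \<open>u * \<phi>\<close>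
  vanishes far out, so its derivative has integral zero there; Fubini turns this into integration by
  parts. The bounds on \<open>u\<close> and \<open>u'\<close> provide local integrability.\<close>

lemma weak_partial_deriv_of_classical:
  fixes u :: "('i::countable \<Rightarrow> real) \<Rightarrow> real"
  assumes fin: "finite V" and j: "j \<in> V"
    and um [measurable]: "u \<in> meas V"
    and u'm [measurable]: "u' \<in> meas V"
    and der: "\<And>x. x \<in> configs V \<Longrightarrow> ((\<lambda>t. u (x(j := t))) has_real_derivative u' x) (at (x j))"
    and ub: "\<And>x. x \<in> configs V \<Longrightarrow> \<bar>u x\<bar> \<le> C * (1 + (l1 V x))"
    and u'b: "\<And>x. x \<in> configs V \<Longrightarrow> \<bar>u' x\<bar> \<le> C"
  shows "has_weak_partial_deriv V j u u'"
proof -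
  let ?box = "\<lambda>r. PiE V (\<lambda>_. {-r..r::real})"
  have box_configs: "x \<in> ?box r \<Longrightarrow> x \<in> configs V" for x r
    using PiE_Icc_subset_configs by blast
  have C0: "C \<ge> 0"
    using u'b[of "restrict (\<lambda>_. 0) V"] by (auto simp: configs_def)
  have ubox: "\<bar>u x\<bar> \<le> C * (1 + (\<Sum>i\<in>V. r))" if "x \<in> ?box r" for x r
  proof -
    have "(l1 V x) \<le> (\<Sum>i\<in>V. r)" using that by (intro sum_mono) (auto simp: PiE_def Pi_def abs_le_iff minus_le_iff)
    then show ?thesis using ub[OF box_configs[OF that]] C0
      by (smt (verit) mult_left_mono)
  qed
  have li: "locally_integrable V u" "locally_integrable V u'"
    unfolding locally_integrable_def
    by (intro conjI allI um u'm set_integrable_PiE_Icc[OF fin um ubox]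
        set_integrable_PiE_Icc[OF fin u'm u'b[OF box_configs]], assumption+)+
  have "(\<integral>x. u x * partial_deriv j \<phi> x \<partial>leb V) =
      - (\<integral>x. u' x * \<phi> x \<partial>leb V)" if tf: "test_function V \<phi>" for \<phi>
  proof -
    obtain r0 where r0: "\<And>x. x \<in> configs V \<Longrightarrow> \<phi> x \<noteq> 0 \<Longrightarrow> \<forall>i\<in>V. \<bar>x i\<bar> \<le> r0"
      using tf unfolding test_function_def by blast
    define r where "r = max r0 0"
    have r: "\<phi> x = 0" if "x \<in> configs V" "i \<in> V" "\<bar>x i\<bar> > r" for x i
      using r0[OF that(1)] that by (force simp: r_def)
    have sm: "smooth V \<phi>" using tf by (simp add: test_function_def)
    have cont: "continuous_on (configs V) \<phi>"
      using sm[unfolded smooth_def, rule_format, of "[]"] by simp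
    have contd: "continuous_on (configs V) (partial_deriv j \<phi>)"
      using sm[unfolded smooth_def, rule_format, of "[j]"] j by simp
    have dif: "(\<lambda>t. \<phi> (x(j := t))) differentiable at (x j)" if "x \<in> configs V" for x
      using sm[unfolded smooth_def, rule_format, of "[]"] j that by simp
    have derphi: "((\<lambda>t. \<phi> (x(j := t))) has_real_derivative partial_deriv j \<phi> x) (at (x j))"
      if "x \<in> configs V" for x
      using dif[OF that] unfolding partial_deriv_def by (simp add: DERIV_deriv_iff_real_differentiable)
    have pm [measurable]: "\<phi> \<in> meas V"
      by (rule borel_measurable_continuous_on_configs[OF cont])
    have dm [measurable]: "partial_deriv j \<phi> \<in> meas V"
      by (rule borel_measurable_continuous_on_configs[OF contd])
    have d0: "partial_deriv j \<phi> x = 0" if x: "x \<in> configs V" and i: "i \<in> V" "\<bar>x i\<bar> > r" for x i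
    proof -
      \<comment> \<open>If \<open>i = j\<close>, moving along the line changes the large coordinate
        itself, which stays beyond \<open>r\<close> only near \<open>x j\<close>; otherwise it is
        beyond \<open>r\<close> on the whole line.\<close>
      define S where "S = (if i = j then {t. \<bar>t\<bar> > r} else UNIV)"
      have "open S" unfolding S_def by (auto intro!: open_Collect_less continuous_intros)
      moreover have "x j \<in> S" using i by (auto simp: S_def)
      moreover have "(\<lambda>t. \<phi> (x(j := t))) t = 0" if "t \<in> S" for t
        using r[OF configs_upd[OF x j], of i t] i that by (auto simp: S_def split: if_splits)
      ultimately have "((\<lambda>t. \<phi> (x(j := t))) has_real_derivative 0) (at (x j))"
        by (subst DERIV_cong_ev[OF refl _ refl, where g = "\<lambda>_. 0"]) (auto intro: eventually_nhds_in_open[THEN eventually_mono])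
      with derphi[OF x] show ?thesis by (rule DERIV_unique)
    qed
    have "compact (\<phi> ` ?box r)" "compact (partial_deriv j \<phi> ` ?box r)"
      using cont contd PiE_Icc_subset_configs compact_PiE_Icc by (blast intro: compact_continuous_image continuous_on_subset)+
    then have "bounded (\<phi> ` ?box r \<union> partial_deriv j \<phi> ` ?box r)" by (simp add: compact_imp_bounded)
    then obtain B where "\<forall>y\<in>\<phi> ` ?box r \<union> partial_deriv j \<phi> ` ?box r. norm y \<le> B" unfolding bounded_iff by blast
    then have B: "\<bar>\<phi> x\<bar> \<le> B" "\<bar>partial_deriv j \<phi> x\<bar> \<le> B" if "x \<in> ?box r" for x
      using that by auto
    define D where "D = C * (1 + (\<Sum>i\<in>V. r)) * B + C * B"
    have out: "\<exists>i\<in>V. \<bar>x i\<bar> > r" if "x \<in> configs V" "x \<notin> ?box r" for x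
      using that by (force simp: configs_def PiE_def Pi_def abs_le_iff not_less minus_le_iff)
    have int: "integrable (leb V) v"
      if vm: "v \<in> meas V" and vb: "\<And>x. x \<in> ?box r \<Longrightarrow> \<bar>v x\<bar> \<le> D"
        and v0: "\<And>x. x \<in> configs V \<Longrightarrow> x \<notin> ?box r \<Longrightarrow> v x = 0" for v and D :: real
    proof -
      have "integrable (leb V) (\<lambda>x. indicator (?box r) x *\<^sub>R v x)"
        using set_integrable_PiE_Icc[OF fin vm vb] unfolding set_integrable_def .
      then show ?thesis
        by (rule Bochner_Integration.integrable_cong[THEN iffD1, rotated 2]) (use v0 in \<open>auto simp: indicator_def\<close>)
    qed
    have i1: "integrable (leb V) (\<lambda>x. u x * partial_deriv j \<phi> x)"
    proof (rule int)
      show "\<bar>u x * partial_deriv j \<phi> x\<bar> \<le> C * (1 + (\<Sum>i\<in>V. r)) * B" if "x \<in> ?box r" for x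
        unfolding abs_mult
        by (rule mult_mono[OF ubox[OF that] B(2)[OF that] order_trans[OF abs_ge_zero ubox[OF that]]]) simp
      show "u x * partial_deriv j \<phi> x = 0" if x: "x \<in> configs V" "x \<notin> ?box r" for x
      proof -
        obtain i where "i \<in> V" "\<bar>x i\<bar> > r" using out[OF x] by blast
        then show ?thesis using d0[OF x(1)] by simp
      qed
    qed (rule borel_measurable_times[OF um dm])
    have i2: "integrable (leb V) (\<lambda>x. u' x * \<phi> x)"
    proof (rule int)
      show "\<bar>u' x * \<phi> x\<bar> \<le> C * B" if "x \<in> ?box r" for x
        unfolding abs_mult
        by (rule mult_mono[OF u'b[OF box_configs[OF that]] B(1)[OF that] C0]) simp
      show "u' x * \<phi> x = 0" if x: "x \<in> configs V" "x \<notin> ?box r" for x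
      proof -
        obtain i where "i \<in> V" "\<bar>x i\<bar> > r" using out[OF x] by blast
        then show ?thesis using r[OF x(1)] by simp
      qed
    qed (rule borel_measurable_times[OF u'm pm])
    define h where "h x = u x * partial_deriv j \<phi> x + u' x * \<phi> x" for x
    have hm [measurable]: "h \<in> meas V" unfolding h_def
      by (intro borel_measurable_add borel_measurable_times um u'm pm dm)
    have hint: "integrable (leb V) h"
      unfolding h_def using i1 i2 by simp
    interpret product_sigma_finite "\<lambda>_. lborel :: real measure" ..
    have ins: "insert j (V - {j}) = V" using j by auto
    have inner: "(\<integral>y. h (x(j := y)) \<partial>lborel) = 0" if x: "x \<in> configs (V - {j})" for x
    proof -
      have xc: "x(j := y) \<in> configs V" for y
        using x j by (auto simp: configs_def PiE_def extensional_def)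
      define w where "w y = u (x(j := y)) * \<phi> (x(j := y))" for y
      have dw: "(w has_real_derivative h (x(j := y))) (at y)" for y
        using DERIV_mult[OF der[OF xc[of y]] derphi[OF xc[of y]]]
        by (simp add: w_def[abs_def] h_def mult.commute add.commute)
      have w0: "w y = 0" if "\<bar>y\<bar> > r" for y
        using r[OF xc j, of y] that by (simp add: w_def)
      have h0: "h (x(j := y)) = 0" if "\<bar>y\<bar> > r" for y
        using r[OF xc j, of y] d0[OF xc j, of y] that by (simp add: h_def)
      \<comment> \<open>The derivative may be discontinuous along the line, so the fundamental
        theorem is applied to the gauge integral, which is identified with the Lebesgue integral
        afterwards. The endpoints lie beyond \<open>r\<close> because vanishing is known only for
        \<open>\<bar>y\<bar> > r\<close>.\<close>
      have hb: "((\<lambda>y. h (x(j := y))) has_integral (w (r + 1) - w (- r - 1))) {- r - 1..r + 1}"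
        using dw by (intro fundamental_theorem_of_calculus)
          (auto simp: r_def has_real_derivative_iff_has_vector_derivative[symmetric] intro: DERIV_subset)
      have "w (r + 1) = 0" "w (- r - 1) = 0" by (auto intro!: w0 simp: r_def)
      with hb have "((\<lambda>y. h (x(j := y))) has_integral 0) {- r - 1..r + 1}" by simp
      then have hi: "((\<lambda>y. h (x(j := y))) has_integral 0) UNIV"
        by (rule has_integral_on_superset) (use h0 in auto)
      have "(\<lambda>y. x(j := y)) \<in> measurable lborel (leb V)"
      proof (rule measurable_into_leb)
        show "(\<lambda>y. (x(j := y)) i) \<in> borel_measurable lborel" for i
          by (cases "i = j") auto
      qed (use xc in auto)
      then have ym [measurable]: "(\<lambda>y. h (x(j := y))) \<in> borel_measurable borel"
        using measurable_compose[OF _ hm] by simp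
      have hb2: "\<bar>h (x(j := y))\<bar> \<le> D" for y
      proof (cases "x(j := y) \<in> ?box r")
        case True
        have "\<bar>u (x(j:=y)) * partial_deriv j \<phi> (x(j:=y))\<bar> \<le> C * (1 + (\<Sum>i\<in>V. r)) * B"
        unfolding abs_mult
          by (rule mult_mono[OF ubox[OF True] B(2)[OF True] order_trans[OF abs_ge_zero ubox[OF True]]]) simp
        moreover have "\<bar>u' (x(j:=y)) * \<phi> (x(j:=y))\<bar> \<le> C * B"
        unfolding abs_mult
          by (rule mult_mono[OF u'b[OF xc] B(1)[OF True] C0]) simp
        ultimately show ?thesis unfolding h_def D_def by linarith
      next
        case False
        then obtain i where "i \<in> V" "\<bar>(x(j := y)) i\<bar> > r" using out[OF xc] by blast
        then have "h (x(j := y)) = 0" using r[OF xc] d0[OF xc] unfolding h_def by fastforce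
        moreover have "restrict (\<lambda>_. 0) V \<in> ?box r" by (auto simp: r_def)
        then have "B \<ge> 0" using B(1) abs_ge_zero order_trans by blast
        then have "0 \<le> D"
          unfolding D_def using C0 by (intro add_nonneg_nonneg mult_nonneg_nonneg sum_nonneg) (auto simp: r_def)
        ultimately show ?thesis by simp
      qed
      have "integrable lborel (\<lambda>y. indicator {-r..r} y * (D))"
        by (intro integrable_mult_left integrable_real_indicator) (auto simp: r_def)
      then have "integrable lborel (\<lambda>y. h (x(j := y)))"
      proof (rule Bochner_Integration.integrable_bound)
        show "AE y in lborel. norm (h (x(j := y))) \<le> norm (indicator {-r..r} y * (D))" (is "AE y in _. ?P y")
        proof (rule AE_I2)
          fix y show "?P y"
            using h0[of y] hb2[of y] by (cases "\<bar>y\<bar> > r") (auto simp: indicator_def)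
        qed
      qed (use ym in simp)
      from has_integral_integral_lborel[OF this] hi show ?thesis by (rule has_integral_unique)
    qed
    have "(\<integral>x. h x \<partial>leb V) = (\<integral>x. (\<integral>y. h (x(j := y)) \<partial>lborel) \<partial>leb (V - {j}))"
      using product_integral_insert[of "V - {j}" j h] fin hint ins by (simp add: lebesgue_configs_def)
    also have "\<dots> = (\<integral>x. 0 \<partial>leb (V - {j}))"
      using inner by (intro Bochner_Integration.integral_cong) auto
    finally have "(\<integral>x. h x \<partial>leb V) = 0" by simp
    then show ?thesis unfolding h_def using i1 i2 by simp
  qed
  with li show ?thesis unfolding has_weak_partial_deriv_def by blast
qed

section \<open>Gaussian integrability and exponential tilts\<close>

lemma integrable_exp_quadratic:
  assumes "\<delta> > 0"
  shows "integrable lborel (\<lambda>t::real. exp (- \<delta> * t\<^sup>2 + a * \<bar>t\<bar>))"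
proof -
  \<comment> \<open>Completing the square gives \<open>a * \<bar>t\<bar> \<le> \<delta> / 2 *
    t\<^sup>2 + a\<^sup>2 / (2 * \<delta>)\<close>; the other half of the quadratic term is a
    Gaussian of variance \<open>1 / \<delta>\<close>.\<close>
  define \<sigma> where "\<sigma> = sqrt (1 / \<delta>)"
  have \<sigma>: "\<sigma> > 0" "\<sigma>\<^sup>2 = 1 / \<delta>" using assms by (auto simp: \<sigma>_def)
  have "integrable lborel (\<lambda>t. exp (a\<^sup>2 / (2 * \<delta>)) * sqrt (2 * pi * \<sigma>\<^sup>2) * normal_density 0 \<sigma> t)"
    using integrable_normal_density[of \<sigma> 0] \<sigma> by (intro integrable_mult_right) auto
  then show ?thesis
  proof (rule Bochner_Integration.integrable_bound)
    show "AE t in lborel. norm (exp (- \<delta> * t\<^sup>2 + a * \<bar>t\<bar>)) \<le>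
      norm (exp (a\<^sup>2 / (2 * \<delta>)) * sqrt (2 * pi * \<sigma>\<^sup>2) * normal_density 0 \<sigma> t)" (is "AE t in _. ?P t")
    proof (rule AE_I2)
      fix t :: real
      have "0 \<le> (\<delta> * \<bar>t\<bar> - a)\<^sup>2 / (2 * \<delta>)" using assms by simp
      also have "(\<delta> * \<bar>t\<bar> - a)\<^sup>2 / (2 * \<delta>) = \<delta> / 2 * t\<^sup>2 - a * \<bar>t\<bar> + a\<^sup>2 / (2 * \<delta>)"
        using assms by (simp add: field_simps power2_eq_square)
      finally have "- \<delta> * t\<^sup>2 + a * \<bar>t\<bar> \<le> a\<^sup>2 / (2 * \<delta>) + - (t\<^sup>2) / (2 * \<sigma>\<^sup>2)"
        by (simp add: \<sigma> field_simps)
      then have "exp (- \<delta> * t\<^sup>2 + a * \<bar>t\<bar>) \<le> exp (a\<^sup>2 / (2 * \<delta>)) * exp (- (t\<^sup>2) / (2 * \<sigma>\<^sup>2))"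
        by (simp flip: exp_add)
      also have "\<dots> = exp (a\<^sup>2 / (2 * \<delta>)) * sqrt (2 * pi * \<sigma>\<^sup>2) * normal_density 0 \<sigma> t"
        using \<sigma>(1) by (simp add: normal_density_def)
      finally show "?P t"
        by (simp add: abs_of_nonneg)
    qed
  qed auto
qed

text \<open>Dominated convergence along sequences \<open>t \<rightarrow> 0\<close>. For
  \<open>\<bar>t\<bar> < 1\<close> the difference quotient is at most
  \<open>\<bar>l x\<bar> * exp \<bar>l x\<bar>\<close>, and
  \<open>\<bar>l x\<bar> \<le> exp \<bar>l x\<bar>\<close>; hence the factor 2 in the exponent of
  the integrability assumption.\<close>

lemma has_derivative_integral_exp_tilt:
  fixes f l :: "'a \<Rightarrow> real"
  assumes [measurable]: "f \<in> borel_measurable \<nu>" "l \<in> borel_measurable \<nu>"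
    and int: "integrable \<nu> (\<lambda>x. f x * exp (2 * \<bar>l x\<bar>))"
  shows "((\<lambda>t. \<integral>x. f x * exp (t * l x) \<partial>\<nu>) has_real_derivative (\<integral>x. f x * l x \<partial>\<nu>)) (at 0)"
proof -
  have le: "\<bar>exp (t * l x) - 1\<bar> \<le> \<bar>t\<bar> * exp (2 * \<bar>l x\<bar>)" if "\<bar>t\<bar> < 1" for t x
  proof -
    have e1: "\<bar>exp y - 1\<bar> \<le> \<bar>y\<bar> * exp \<bar>y\<bar>" for y :: real
    proof (cases "y \<ge> 0")
      case True
      have "1 - y \<le> exp (- y)" using exp_ge_add_one_self[of "-y"] by simp
      then have "exp y * (1 - y) \<le> exp y * exp (- y)" by (intro mult_left_mono) auto
      then have "exp y - 1 \<le> y * exp y" by (simp add: exp_minus algebra_simps)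
      then show ?thesis using True by simp
    next
      case False
      have "1 - exp y \<le> - y" using exp_ge_add_one_self[of y] by linarith
      also have "\<dots> \<le> \<bar>y\<bar> * exp \<bar>y\<bar>" using False mult_left_mono[of 1 "exp \<bar>y\<bar>" "\<bar>y\<bar>"] by simp
      finally show ?thesis using False by simp
    qed
    have "\<bar>exp (t * l x) - 1\<bar> \<le> \<bar>t * l x\<bar> * exp \<bar>t * l x\<bar>" by (rule e1)
    also have "\<dots> \<le> \<bar>t\<bar> * \<bar>l x\<bar> * exp \<bar>l x\<bar>"
      using that mult_right_mono[of "\<bar>t\<bar>" 1 "\<bar>l x\<bar>"] by (auto simp: abs_mult intro!: mult_mono)
    also have "\<dots> \<le> \<bar>t\<bar> * exp \<bar>l x\<bar> * exp \<bar>l x\<bar>"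
    proof -
      have "\<bar>l x\<bar> \<le> exp \<bar>l x\<bar>" using exp_ge_add_one_self[of "\<bar>l x\<bar>"] by linarith
      then show ?thesis by (intro mult_mono) auto
    qed
    also have "\<dots> = \<bar>t\<bar> * exp (2 * \<bar>l x\<bar>)" by (simp add: mult_exp_exp)
    finally show ?thesis .
  qed
  have le1: "\<bar>exp (t * l x)\<bar> \<le> exp (2 * \<bar>l x\<bar>)" if "\<bar>t\<bar> < 1" for t x
  proof -
    have "\<bar>t\<bar> * \<bar>l x\<bar> \<le> 1 * \<bar>l x\<bar>" using that by (intro mult_right_mono) auto
    then have "t * l x \<le> 2 * \<bar>l x\<bar>" by (simp flip: abs_mult)
    then show ?thesis by simp
  qed
  have i: "integrable \<nu> (\<lambda>x. f x * exp (t * l x))" if "\<bar>t\<bar> < 1" for t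
    by (rule Bochner_Integration.integrable_bound[OF int])
      (use le1[OF that] in \<open>auto simp: abs_mult intro!: mult_left_mono\<close>)
  have "((\<lambda>t. ((\<integral>x. f x * exp (t * l x) \<partial>\<nu>) - (\<integral>x. f x * exp (0 * l x) \<partial>\<nu>)) / (t - 0)) \<longlongrightarrow> (\<integral>x. f x * l x \<partial>\<nu>))
      (at 0 within {-1<..<1})"
    unfolding tendsto_at_iff_sequentially comp_def
  proof (intro allI impI)
    fix X :: "nat \<Rightarrow> real" assume X: "\<forall>n. X n \<in> {-1<..<1} - {0}" "X \<longlonglongrightarrow> 0"
    have Xa: "\<bar>X n\<bar> < 1" "X n \<noteq> 0" for n using X(1)[rule_format, of n] by auto
    have "(\<lambda>n. \<integral>x. f x * ((exp (X n * l x) - 1) / X n) \<partial>\<nu>) \<longlonglongrightarrow> (\<integral>x. f x * l x \<partial>\<nu>)"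
    proof (rule integral_dominated_convergence)
      show "integrable \<nu> (\<lambda>x. norm (f x * exp (2 * \<bar>l x\<bar>)))" using int by (rule integrable_norm)
      show "AE x in \<nu>. (\<lambda>n. f x * ((exp (X n * l x) - 1) / X n)) \<longlonglongrightarrow> f x * l x" (is "AE x in _. ?P x")
      proof (rule AE_I2)
        fix x
        have "((\<lambda>t. exp (t * l x)) has_real_derivative l x) (at 0)"
          by (auto intro!: derivative_eq_intros)
        then have "((\<lambda>t. (exp (t * l x) - 1) / t) \<longlongrightarrow> l x) (at 0)"
          by (simp add: has_field_derivative_iff)
        then have "(\<lambda>n. (exp (X n * l x) - 1) / X n) \<longlonglongrightarrow> l x"
          unfolding tendsto_at_iff_sequentially comp_def using X by auto
        then show "?P x" by (intro tendsto_intros)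
      qed
      show "AE x in \<nu>. norm (f x * ((exp (X n * l x) - 1) / X n)) \<le> norm (f x * exp (2 * \<bar>l x\<bar>))" (is "AE x in _. ?P x") for n
      proof (rule AE_I2)
        fix x
        have "\<bar>(exp (X n * l x) - 1) / X n\<bar> \<le> exp (2 * \<bar>l x\<bar>)"
          using le[OF Xa(1)[of n], of x] Xa(2)[of n] by (simp add: abs_divide pos_divide_le_eq mult.commute)
        then show "?P x"
          by (simp only: real_norm_def abs_mult abs_exp_cancel mult_left_mono abs_ge_zero)
      qed
    qed measurable
    moreover have "(\<integral>x. f x * ((exp (X n * l x) - 1) / X n) \<partial>\<nu>) =
        ((\<integral>x. f x * exp (X n * l x) \<partial>\<nu>) - (\<integral>x. f x * exp (0 * l x) \<partial>\<nu>)) / (X n - 0)" for n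
    proof -
      have "(\<integral>x. f x * ((exp (X n * l x) - 1) / X n) \<partial>\<nu>) = (\<integral>x. (f x * exp (X n * l x) - f x * exp (0 * l x)) / X n \<partial>\<nu>)"
        by (intro Bochner_Integration.integral_cong) (auto simp: field_simps)
      also have "\<dots> = ((\<integral>x. f x * exp (X n * l x) \<partial>\<nu>) - (\<integral>x. f x * exp (0 * l x) \<partial>\<nu>)) / X n"
        using i[OF Xa(1)[of n]] i[of 0] by (subst integral_divide_zero, subst Bochner_Integration.integral_diff) auto
      finally show ?thesis by simp
    qed
    ultimately show "(\<lambda>n. ((\<integral>x. f x * exp (X n * l x) \<partial>\<nu>) - (\<integral>x. f x * exp (0 * l x) \<partial>\<nu>)) / (X n - 0))
        \<longlonglongrightarrow> (\<integral>x. f x * l x \<partial>\<nu>)" by (simp only:)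
  qed
  then show ?thesis
    unfolding has_field_derivative_iff by (subst (asm) at_within_open) auto
qed

text \<open>The quotient is the expectation under the normalised tilted measure. At
  \<open>t = 0\<close> the normalisation is 1, so the quotient rule leaves a covariance.\<close>

lemma (in prob_space) has_derivative_exp_tilt_expectation:
  assumes [measurable]: "f \<in> borel_measurable M" "l \<in> borel_measurable M"
    and int: "integrable M (\<lambda>x. f x * exp (2 * \<bar>l x\<bar>))" "integrable M (\<lambda>x. exp (2 * \<bar>l x\<bar>))"
  shows "((\<lambda>t. (\<integral>x. f x * exp (t * l x) \<partial>M) / (\<integral>x. exp (t * l x) \<partial>M)) has_real_derivative
    expectation (\<lambda>x. f x * l x) - expectation f * expectation l) (at 0)"
proof -
  have 1: "((\<lambda>t. \<integral>x. f x * exp (t * l x) \<partial>M) has_real_derivative (\<integral>x. f x * l x \<partial>M)) (at 0)"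
    using int by (intro has_derivative_integral_exp_tilt) auto
  have 2: "((\<lambda>t. \<integral>x. 1 * exp (t * l x) \<partial>M) has_real_derivative (\<integral>x. 1 * l x \<partial>M)) (at 0)"
    using int by (intro has_derivative_integral_exp_tilt) auto
  from DERIV_divide[OF 1 2] show ?thesis by (simp add: prob_space)
qed

section \<open>Finite volume Gibbs measures\<close>

text \<open>Plays the role of \<open>merge\<close>, but \<open>y\<close> is a total configuration
  whose values off \<open>P\<close>, the boundary condition included, are kept. One operation thus
  serves for conditioning in nested volumes.\<close>

definition override :: "'i set \<Rightarrow> ('i \<Rightarrow> real) \<Rightarrow> ('i \<Rightarrow> real) \<Rightarrow> 'i \<Rightarrow> real"
  where "override P z y = (\<lambda>i. if i \<in> P then z i else y i)"

lemma override_override: "P \<subseteq> Q \<Longrightarrow> override Q (override P z w) y = override P z (override Q w y)"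
  by (auto simp: override_def fun_eq_iff)

lemma override_absorb: "Q \<subseteq> P \<Longrightarrow> override P z (override Q w y) = override P z y"
  by (auto simp: override_def fun_eq_iff)

lemma override_configs: "P \<subseteq> Q \<Longrightarrow> z \<in> configs P \<Longrightarrow> w \<in> configs Q \<Longrightarrow> override P z w \<in> configs Q"
  by (auto simp: override_def configs_def PiE_def extensional_def)

lemma measurable_override:
  assumes "P \<subseteq> Q"
  shows "(\<lambda>(w, z). override P z w) \<in> measurable (leb Q \<Otimes>\<^sub>M leb P) (leb Q)"
proof (rule measurable_into_leb)
  fix i assume i: "i \<in> Q"
  show "(\<lambda>p. (case p of (w, z) \<Rightarrow> override P z w) i) \<in> borel_measurable (leb Q \<Otimes>\<^sub>M leb P)"
  proof (cases "i \<in> P")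
    case True
    have "(\<lambda>p. snd p i) \<in> borel_measurable (leb Q \<Otimes>\<^sub>M leb P)"
      by (rule measurable_compose[OF measurable_snd measurable_leb_component[OF True]])
    with True show ?thesis by (simp add: override_def case_prod_beta)
  next
    case False
    have "(\<lambda>p. fst p i) \<in> borel_measurable (leb Q \<Otimes>\<^sub>M leb P)"
      by (rule measurable_compose[OF measurable_fst measurable_leb_component[OF i]])
    with False show ?thesis by (simp add: override_def case_prod_beta)
  qed
qed (auto simp: space_pair_measure intro: override_configs[OF assms])

lemma measurable_override1:
  assumes "P \<subseteq> Q" "w \<in> configs Q"
  shows "(\<lambda>z. override P z w) \<in> measurable (leb P) (leb Q)"
  using measurable_compose[OF measurable_Pair1'[of w "leb Q" "leb P"] measurable_override[OF assms(1)]] assms(2)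
  by simp

text \<open>Fubini for the partition of \<open>Q\<close> into \<open>Q - P\<close> and
  \<open>P\<close>; for configurations over these two sets \<open>override\<close> and
  \<open>merge\<close> coincide.\<close>

lemma integral_leb_fold:
  fixes f :: "_ \<Rightarrow> real"
  assumes "finite Q" "P \<subseteq> Q" "integrable (leb Q) f"
  shows "integral\<^sup>L (leb Q) f =
    (\<integral>u. (\<integral>z. f (override P z u) \<partial>leb P) \<partial>leb (Q - P))"
proof -
  interpret product_sigma_finite "\<lambda>_. lborel :: real measure" ..
  have Q: "(Q - P) \<union> P = Q" using assms by auto
  have m: "merge (Q - P) P (u, z) = override P z u" if "u \<in> configs (Q - P)" "z \<in> configs P" for u z
    using that by (auto simp: merge_def override_def configs_def PiE_def extensional_def fun_eq_iff)
  have "integral\<^sup>L (leb Q) f =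
    (\<integral>u. (\<integral>z. f (merge (Q - P) P (u, z)) \<partial>leb P) \<partial>leb (Q - P))"
    using product_integral_fold[of "Q - P" P f] assms Q finite_subset[of P Q]
    by (auto simp: lebesgue_configs_def)
  also have "\<dots> = (\<integral>u. (\<integral>z. f (override P z u) \<partial>leb P) \<partial>leb (Q - P))"
    using m by (intro Bochner_Integration.integral_cong) auto
  finally show ?thesis .
qed

lemma sigma_finite_leb: "finite V \<Longrightarrow> sigma_finite_measure (leb V)"
proof -
  assume f: "finite V"
  interpret product_sigma_finite "\<lambda>_. lborel :: real measure" ..
  from f show ?thesis unfolding lebesgue_configs_def by (rule sigma_finite)
qed

lemma (in prob_space) Cauchy_Schwarz_expectation:
  fixes f g :: "'a \<Rightarrow> real"
  assumes [measurable]: "f \<in> borel_measurable M" "g \<in> borel_measurable M"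
    and int: "integrable M (\<lambda>x. (f x)\<^sup>2)" "integrable M (\<lambda>x. (g x)\<^sup>2)"
  shows "integrable M (\<lambda>x. f x * g x)"
    and "(expectation (\<lambda>x. f x * g x))\<^sup>2 \<le> expectation (\<lambda>x. (f x)\<^sup>2) * expectation (\<lambda>x. (g x)\<^sup>2)"
proof -
  have "integrable M (\<lambda>x. (f x)\<^sup>2 + (g x)\<^sup>2)" using int by simp
  then show fg: "integrable M (\<lambda>x. f x * g x)"
  proof (rule Bochner_Integration.integrable_bound)
    show "AE x in M. norm (f x * g x) \<le> norm ((f x)\<^sup>2 + (g x)\<^sup>2)" (is "AE x in _. ?P x")
    proof (rule AE_I2)
      fix x
      have "0 \<le> (\<bar>f x\<bar> - \<bar>g x\<bar>)\<^sup>2" by simp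
      then have "2 * (\<bar>f x\<bar> * \<bar>g x\<bar>) \<le> (f x)\<^sup>2 + (g x)\<^sup>2" by (simp add: power2_diff)
      moreover have "\<bar>f x\<bar> * \<bar>g x\<bar> \<ge> 0" by simp
      ultimately show "?P x" unfolding real_norm_def abs_mult by linarith
    qed
  qed measurable
  define a b c where "a = expectation (\<lambda>x. (f x)\<^sup>2)" and "b = expectation (\<lambda>x. f x * g x)"
    and "c = expectation (\<lambda>x. (g x)\<^sup>2)"
  have q: "0 \<le> s\<^sup>2 * a - 2 * s * t * b + t\<^sup>2 * c" for s t
  proof -
    have "0 \<le> expectation (\<lambda>x. (s * f x - t * g x)\<^sup>2)" by (rule integral_nonneg_AE) auto
    also have "(\<lambda>x. (s * f x - t * g x)\<^sup>2) = (\<lambda>x. s\<^sup>2 * (f x)\<^sup>2 - (2 * s * t) * (f x * g x) + t\<^sup>2 * (g x)\<^sup>2)"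
      by (auto simp: power2_eq_square algebra_simps)
    also have "expectation \<dots> = s\<^sup>2 * a - 2 * s * t * b + t\<^sup>2 * c"
      using int fg unfolding a_def b_def c_def by simp
    finally show ?thesis .
  qed
  have "a \<ge> 0" "c \<ge> 0" unfolding a_def c_def by (auto intro: integral_nonneg_AE)
  have "b\<^sup>2 \<le> a * c"
  proof (cases "c = 0")
    case True
    have "b = 0"
    proof (rule ccontr)
      assume "b \<noteq> 0"
      \<comment> \<open>With \<open>c = 0\<close> this choice gives the quadratic form the value
        \<open>a - (a + 1) = -1\<close>.\<close>
      then show False using q[of 1 "(a + 1) / (2 * b)"] True by (simp add: field_simps)
    qed
    then show ?thesis using \<open>a \<ge> 0\<close> \<open>c \<ge> 0\<close> by simp
  next
    case False
    then have "c > 0" using \<open>c \<ge> 0\<close> by simp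
    \<comment> \<open>The direction \<open>(c, b)\<close> minimises the form for fixed first entry,
      so its value there is \<open>c\<close> times the defect in the inequality.\<close>
    have "0 \<le> c * (a * c - b\<^sup>2)" using q[of c b] by (simp add: power2_eq_square algebra_simps)
    with \<open>c > 0\<close> show ?thesis by (simp add: zero_le_mult_iff)
  qed
  then show "(expectation (\<lambda>x. f x * g x))\<^sup>2 \<le> expectation (\<lambda>x. (f x)\<^sup>2) * expectation (\<lambda>x. (g x)\<^sup>2)"
    by (simp add: a_def b_def c_def)
qed

text \<open>The standing assumptions in the form in which they act: \<open>coercive\<close> is the
  content of diagonal dominance and \<open>\<psi>_lower\<close> that of a bounded perturbation of a
  convex potential. Together they give the Gibbs densities Gaussian tails. The index set is an
  arbitrary countable type; distances enter only with the lattice.\<close>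

locale spin_system =
  fixes M :: "'i::countable \<Rightarrow> 'i \<Rightarrow> real" and \<psi> :: "'i \<Rightarrow> real \<Rightarrow> real" and s :: "'i \<Rightarrow> real"
    and \<delta> \<rho> :: real
  assumes M_sym: "M i j = M j i"
    and \<delta>_pos: "\<delta> > 0"
    and coercive: "finite V \<Longrightarrow> \<delta> * (\<Sum>i\<in>V. (x i)\<^sup>2) \<le> (\<Sum>i\<in>V. \<Sum>j\<in>V. M i j * x i * x j)"
    and \<psi>_cont: "continuous_on UNIV (\<psi> i)"
    and \<psi>_lower: "\<exists>a b. \<forall>r. a - b * \<bar>r\<bar> \<le> \<psi> i r"
    and \<rho>_pos: "\<rho> > 0"
    and poincare: "finite V \<Longrightarrow> well_tempered M V \<omega> \<Longrightarrow>
        H1_with_gradient V (gibbs M \<psi> s V \<omega>) f F \<Longrightarrow>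
        var (gibbs M \<psi> s V \<omega>) f \<le>
          1 / \<rho> * (\<integral>x. (\<Sum>i\<in>V. (F i x)\<^sup>2) \<partial>gibbs M \<psi> s V \<omega>)"
begin

abbreviation "Ham \<equiv> hamiltonian M \<psi> s"
abbreviation "Z \<equiv> partition_function M \<psi> s"
abbreviation "G \<equiv> gibbs M \<psi> s"
abbreviation "cov V \<omega> \<equiv> covariance (G V \<omega>)"
abbreviation "sd V \<omega> f \<equiv> sqrt (var (G V \<omega>) f)"

section \<open>Energy bounds and exponential moments\<close>

definition field :: "'i set \<Rightarrow> ('i \<Rightarrow> real) \<Rightarrow> 'i \<Rightarrow> real"
  where "field P y i = (\<Sum>\<^sub>\<infinity>j\<in>- P. M i j * y j)"

lemma hamiltonian_eq: "Ham P y z = (\<Sum>i\<in>P. \<psi> i (z i) + (s i + 2 * field P y i) * z i)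
    + (\<Sum>i\<in>P. \<Sum>j\<in>P. M i j * z i * z j)"
proof -
  \<comment> \<open>The identity holds for divergent sums too: for \<open>z i = 0\<close> both sides
    vanish, and otherwise both infinite sums have the default value 0.\<close>
  have "(\<Sum>\<^sub>\<infinity>j\<in>- P. M i j * z i * y j) = field P y i * z i" for i
    unfolding field_def infsum_cmult_left'[symmetric] by (intro infsum_cong) simp
  then show ?thesis unfolding hamiltonian_def
    by (simp add: sum.distrib sum_distrib_left algebra_simps)
qed

lemma measurable_hamiltonian [measurable]:
  "(\<lambda>z. Ham P y z) \<in> meas P"
proof -
  have "(\<lambda>z. \<psi> i (z i)) \<in> meas P" if "i \<in> P" for i
    by (rule measurable_compose[OF measurable_leb_component[OF that]
        borel_measurable_continuous_onI[OF \<psi>_cont]])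
  then show ?thesis unfolding hamiltonian_eq
    by (intro borel_measurable_add borel_measurable_sum borel_measurable_times
        measurable_leb_component borel_measurable_const)
qed

lemma measurable_exp_hamiltonian: "(\<lambda>z. exp (- Ham P y z)) \<in> meas P"
  by (intro measurable_compose[OF _ borel_measurable_exp] borel_measurable_uminus measurable_hamiltonian)

lemma hamiltonian_lower:
  assumes "finite P"
  shows "\<exists>a b. \<forall>z. (\<Sum>i\<in>P. \<delta> * (z i)\<^sup>2 - b i * \<bar>z i\<bar> + a i) \<le> Ham P y z"
proof -
  obtain a b where ab: "\<And>i r. a i - b i * \<bar>r\<bar> \<le> \<psi> i r" using \<psi>_lower by metis
  define b' where "b' i = b i + \<bar>s i + 2 * field P y i\<bar>" for i
  have "(\<Sum>i\<in>P. \<delta> * (z i)\<^sup>2 - b' i * \<bar>z i\<bar> + a i) \<le> Ham P y z" for z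
  proof -
    have "- b' i * \<bar>z i\<bar> + a i \<le> \<psi> i (z i) + (s i + 2 * field P y i) * z i" for i
    proof -
      have "\<bar>(s i + 2 * field P y i) * z i\<bar> = \<bar>s i + 2 * field P y i\<bar> * \<bar>z i\<bar>" by (rule abs_mult)
      then show ?thesis using ab[of i "z i"] unfolding b'_def by (simp add: algebra_simps)
    qed
    then have "(\<Sum>i\<in>P. - b' i * \<bar>z i\<bar> + a i) \<le> (\<Sum>i\<in>P. \<psi> i (z i) + (s i + 2 * field P y i) * z i)"
      by (rule sum_mono)
    then have "(\<Sum>i\<in>P. - b' i * \<bar>z i\<bar> + a i) + \<delta> * (\<Sum>i\<in>P. (z i)\<^sup>2) \<le> Ham P y z"
      unfolding hamiltonian_eq using coercive[OF assms, of z] by linarith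
    also have "(\<Sum>i\<in>P. - b' i * \<bar>z i\<bar> + a i) + \<delta> * (\<Sum>i\<in>P. (z i)\<^sup>2) =
        (\<Sum>i\<in>P. \<delta> * (z i)\<^sup>2 - b' i * \<bar>z i\<bar> + a i)"
      by (simp add: sum.distrib sum_distrib_left sum_subtractf sum_negf)
    finally show ?thesis .
  qed
  then show ?thesis by blast
qed

text \<open>The lower bound on the energy is a sum over single sites, so the weight is dominated by
  a product of one-dimensional Gaussian-type functions. The factor with \<open>K\<close> is absorbed
  into their linear terms; hence Gibbs measures have exponential moments of every order.\<close>

lemma integrable_exp_hamiltonian:
  assumes "finite P"
  shows "integrable (leb P) (\<lambda>z. exp (K * (l1 P z)) * exp (- Ham P y z))"
proof -
  obtain a b where ab: "\<And>z. (\<Sum>i\<in>P. \<delta> * (z i)\<^sup>2 - b i * \<bar>z i\<bar> + a i) \<le> Ham P y z"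
    using hamiltonian_lower[OF assms] by blast
  interpret product_sigma_finite "\<lambda>_. lborel :: real measure" ..
  have "integrable (leb P)
      (\<lambda>z. \<Prod>i\<in>P. exp (- a i) * exp (- \<delta> * (z i)\<^sup>2 + (b i + K) * \<bar>z i\<bar>))"
    unfolding lebesgue_configs_def
    by (intro product_integrable_prod assms integrable_mult_right integrable_exp_quadratic \<delta>_pos)
  then show ?thesis
  proof (rule Bochner_Integration.integrable_bound)
    show "(\<lambda>z. exp (K * (l1 P z)) * exp (- Ham P y z)) \<in> meas P"
      by (intro borel_measurable_times measurable_exp_hamiltonian measurable_compose[OF _ borel_measurable_exp]
          borel_measurable_sum borel_measurable_abs measurable_leb_component borel_measurable_const)
    show "AE z in leb P. norm (exp (K * (l1 P z)) * exp (- Ham P y z)) \<le>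
      norm (\<Prod>i\<in>P. exp (- a i) * exp (- \<delta> * (z i)\<^sup>2 + (b i + K) * \<bar>z i\<bar>))" (is "AE z in _. ?P z")
    proof (rule AE_I2)
      fix z
      have "K * (l1 P z) - Ham P y z \<le> (\<Sum>i\<in>P. - a i + (- \<delta> * (z i)\<^sup>2 + (b i + K) * \<bar>z i\<bar>))"
        using ab[of z] by (simp add: sum.distrib sum_distrib_left sum_subtractf sum_negf algebra_simps)
      then have "exp (K * (l1 P z)) * exp (- Ham P y z) \<le>
          exp (\<Sum>i\<in>P. - a i + (- \<delta> * (z i)\<^sup>2 + (b i + K) * \<bar>z i\<bar>))"
        by (simp add: mult_exp_exp)
      also have "\<dots> = (\<Prod>i\<in>P. exp (- a i) * exp (- \<delta> * (z i)\<^sup>2 + (b i + K) * \<bar>z i\<bar>))"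
        using assms by (simp only: exp_sum mult_exp_exp)
      finally show "?P z"
        by (simp add: abs_mult)
    qed
  qed
qed

lemma integral_leb_pos:
  fixes h :: "_ \<Rightarrow> real"
  assumes "finite P" "integrable (leb P) h" "\<And>z. z \<in> configs P \<Longrightarrow> h z > 0"
  shows "(\<integral>z. h z \<partial>leb P) > 0"
proof -
  have ge: "(\<integral>z. h z \<partial>leb P) \<ge> 0"
    using assms(3) by (intro integral_nonneg_AE AE_I2) (auto intro: less_imp_le)
  have "(\<integral>z. h z \<partial>leb P) \<noteq> 0"
  proof
    assume "(\<integral>z. h z \<partial>leb P) = 0"
    then have "AE z in leb P. h z = 0"
      using assms by (subst (asm) integral_nonneg_eq_0_iff_AE) (auto intro!: AE_I2 less_imp_le)
    moreover have "AE z in leb P. h z > 0"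
      using assms(3) by (intro AE_I2) auto
    ultimately have "AE z in leb P. False" by eventually_elim auto
    then have "emeasure (leb P) (space (leb P)) = 0"
      by (simp only: eventually_False ae_filter_eq_bot_iff)
    moreover have "emeasure (leb P) (PiE P (\<lambda>_. {-1..1})) \<le> emeasure (leb P) (space (leb P))"
      by (rule emeasure_space)
    moreover have "emeasure (leb P) (PiE P (\<lambda>_. {-1..1})) > 0"
      using emeasure_PiE_Icc[OF assms(1), of 1] by simp
    ultimately show False by simp
  qed
  with ge show ?thesis by simp
qed

lemma integrable_exp_hamiltonian0:
  assumes "finite P" shows "integrable (leb P) (\<lambda>z. exp (- Ham P y z))"
  using integrable_exp_hamiltonian[OF assms, of 0 y] by simp

lemma Z_pos: assumes "finite P" shows "Z P y > 0"
  unfolding partition_function_def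
  by (intro integral_leb_pos assms integrable_exp_hamiltonian0) auto

lemma sets_gibbs [simp, measurable_cong]: "sets (G P y) = sets (leb P)"
  by (simp add: gibbs_def)

lemma space_gibbs [simp]: "space (G P y) = configs P"
  by (simp add: gibbs_def)

lemma measurable_gibbs [simp]: "borel_measurable (G P y) = meas P"
  by (rule measurable_cong_sets) auto

lemma
  fixes h :: "_ \<Rightarrow> real"
  assumes "finite P" "h \<in> meas P"
  shows integral_gibbs: "(\<integral>z. h z \<partial>G P y) = (\<integral>z. h z * exp (- Ham P y z) \<partial>leb P) / Z P y"
    and integrable_gibbs: "integrable (G P y) h \<longleftrightarrow> integrable (leb P) (\<lambda>z. h z * exp (- Ham P y z))"
proof -
  have m: "(\<lambda>z. exp (- Ham P y z) / Z P y) \<in> meas P"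
    by (intro borel_measurable_divide measurable_exp_hamiltonian borel_measurable_const)
  have nn: "AE z in leb P. 0 \<le> exp (- Ham P y z) / Z P y"
    using Z_pos[OF assms(1)] by (auto simp: less_imp_le)
  have "(\<integral>z. h z \<partial>G P y) = (\<integral>z. (exp (- Ham P y z) / Z P y) *\<^sub>R h z \<partial>leb P)"
    unfolding gibbs_def by (rule integral_density[OF assms(2) m nn])
  also have "\<dots> = (\<integral>z. (h z * exp (- Ham P y z)) / Z P y \<partial>leb P)"
    by (simp add: mult.commute)
  also have "\<dots> = (\<integral>z. h z * exp (- Ham P y z) \<partial>leb P) / Z P y"
    by (rule integral_divide_zero)
  finally show "(\<integral>z. h z \<partial>G P y) = (\<integral>z. h z * exp (- Ham P y z) \<partial>leb P) / Z P y" .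
  have "integrable (G P y) h \<longleftrightarrow> integrable (leb P) (\<lambda>z. (exp (- Ham P y z) / Z P y) *\<^sub>R h z)"
    unfolding gibbs_def by (rule integrable_density[OF assms(2) m nn])
  also have "(\<lambda>z. (exp (- Ham P y z) / Z P y) *\<^sub>R h z) = (\<lambda>z. (h z * exp (- Ham P y z)) / Z P y)"
    by (simp add: mult.commute)
  also have "integrable (leb P) \<dots> \<longleftrightarrow> integrable (leb P) (\<lambda>z. h z * exp (- Ham P y z))"
  proof
    assume "integrable (leb P) (\<lambda>z. (h z * exp (- Ham P y z)) / Z P y)"
    then have "integrable (leb P) (\<lambda>z. Z P y * ((h z * exp (- Ham P y z)) / Z P y))"
      by (rule integrable_mult_right)
    then show "integrable (leb P) (\<lambda>z. h z * exp (- Ham P y z))"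
      using Z_pos[OF assms(1), of y] by simp
  qed (rule integrable_divide_zero)
  finally show "integrable (G P y) h \<longleftrightarrow> integrable (leb P) (\<lambda>z. h z * exp (- Ham P y z))" .
qed

lemma prob_space_gibbs: assumes "finite P" shows "prob_space (G P y)"
proof
  have "emeasure (G P y) (space (G P y)) = (\<integral>\<^sup>+z. ennreal (exp (- Ham P y z) / Z P y) * indicator (configs P) z \<partial>leb P)"
    unfolding space_gibbs unfolding gibbs_def
    by (subst emeasure_density)
       (auto intro!: borel_measurable_divide measurable_exp_hamiltonian
           measurable_compose[OF _ measurable_ennreal] simp: sets.top[of "leb P", simplified])
  also have "\<dots> = (\<integral>\<^sup>+z. ennreal (exp (- Ham P y z) / Z P y) \<partial>leb P)"
    by (intro nn_integral_cong) auto
  also have "\<dots> = ennreal (\<integral>z. exp (- Ham P y z) / Z P y \<partial>leb P)"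
    using Z_pos[OF assms, of y] integrable_exp_hamiltonian0[OF assms, of y]
    by (intro nn_integral_eq_integral) (auto simp: less_imp_le)
  also have "(\<integral>z. exp (- Ham P y z) / Z P y \<partial>leb P) = 1"
    using Z_pos[OF assms, of y] by (simp add: partition_function_def)
  finally show "emeasure (G P y) (space (G P y)) = 1" by simp
qed

lemma integrable_gibbs_growth:
  fixes h :: "_ \<Rightarrow> real"
  assumes "finite P" and h: "h \<in> meas P"
    and bd: "\<And>z. z \<in> configs P \<Longrightarrow> \<bar>h z\<bar> \<le> C * exp (K * (l1 P z))"
  shows "integrable (G P y) h"
  unfolding integrable_gibbs[OF assms(1,2)]
proof (rule Bochner_Integration.integrable_bound)
  show "integrable (leb P) (\<lambda>z. C * (exp (K * (l1 P z)) * exp (- Ham P y z)))"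
    by (intro integrable_mult_right integrable_exp_hamiltonian assms)
  show "(\<lambda>z. h z * exp (- Ham P y z)) \<in> meas P"
    by (intro borel_measurable_times h measurable_exp_hamiltonian)
  show "AE z in leb P. norm (h z * exp (- Ham P y z)) \<le>
      norm (C * (exp (K * (l1 P z)) * exp (- Ham P y z)))" (is "AE z in _. ?P z")
  proof (rule AE_I2)
    fix z assume "z \<in> space (leb P)"
    then have "\<bar>h z\<bar> \<le> \<bar>C * exp (K * (l1 P z))\<bar>" using bd[of z] by simp
    then have "\<bar>h z\<bar> * exp (- Ham P y z) \<le> \<bar>C * exp (K * (l1 P z))\<bar> * exp (- Ham P y z)"
      by (rule mult_right_mono) simp
    then show "?P z"
      by (simp add: abs_mult mult.assoc)
  qed
qed

section \<open>Gibbs measures in nested volumes\<close>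

lemma gibbs_cong: "(\<And>i. i \<notin> P \<Longrightarrow> y i = y' i) \<Longrightarrow> G P y = G P y'"
proof -
  assume "\<And>i. i \<notin> P \<Longrightarrow> y i = y' i"
  then have "field P y = field P y'" unfolding field_def by (intro ext infsum_cong) auto
  then have "Ham P y = Ham P y'" by (simp add: hamiltonian_eq fun_eq_iff)
  then show ?thesis by (simp add: gibbs_def partition_function_def)
qed

lemma infsum_split_complement:
  fixes f :: "'i \<Rightarrow> real"
  assumes "finite Q" "P \<subseteq> Q" "f summable_on (- Q)"
  shows "(\<Sum>\<^sub>\<infinity>j\<in>- P. f j) = (\<Sum>j\<in>Q - P. f j) + (\<Sum>\<^sub>\<infinity>j\<in>- Q. f j)"
proof -
  have "- P = (Q - P) \<union> - Q" using assms by auto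
  moreover have "infsum f ((Q - P) \<union> - Q) = infsum f (Q - P) + infsum f (- Q)"
    by (rule infsum_Un_disjoint) (use assms in \<open>auto intro: summable_on_finite\<close>)
  ultimately show ?thesis using assms by simp
qed

lemma well_tempered_summable: "well_tempered M Q y \<Longrightarrow> i \<in> Q \<Longrightarrow> (\<lambda>j. M i j * y j) summable_on (- Q)"
  unfolding well_tempered_def by (auto intro: abs_summable_summable simp: abs_mult)

lemma field_override:
  assumes "finite Q" "P \<subseteq> Q" "well_tempered M Q y" "i \<in> P"
  shows "field P (override Q w y) i = (\<Sum>j\<in>Q - P. M i j * w j) + field Q y i"
proof -
  have s: "(\<lambda>j. M i j * y j) summable_on (- Q)"
    using assms by (auto intro: well_tempered_summable)
  then have "(\<lambda>j. M i j * override Q w y j) summable_on (- Q)"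
    by (subst summable_on_cong[where g = "\<lambda>j. M i j * y j"]) (auto simp: override_def)
  then have "field P (override Q w y) i = (\<Sum>j\<in>Q - P. M i j * override Q w y j) + (\<Sum>\<^sub>\<infinity>j\<in>- Q. M i j * override Q w y j)"
    unfolding field_def by (rule infsum_split_complement[OF assms(1,2)])
  also have "(\<Sum>\<^sub>\<infinity>j\<in>- Q. M i j * override Q w y j) = field Q y i"
    unfolding field_def by (intro infsum_cong) (auto simp: override_def)
  also have "(\<Sum>j\<in>Q - P. M i j * override Q w y j) = (\<Sum>j\<in>Q - P. M i j * w j)"
    by (intro sum.cong) (auto simp: override_def)
  finally show ?thesis .
qed

lemma well_tempered_override:
  assumes "finite Q" "P \<subseteq> Q" "well_tempered M Q y"
  shows "well_tempered M P (override Q w y)"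
  unfolding well_tempered_def
proof
  fix i assume "i \<in> P"
  then have "(\<lambda>j. \<bar>M i j\<bar> * \<bar>y j\<bar>) summable_on (- Q)" using assms by (auto simp: well_tempered_def)
  then have "(\<lambda>j. \<bar>M i j\<bar> * \<bar>override Q w y j\<bar>) summable_on (- Q)"
    by (subst summable_on_cong[where g = "\<lambda>j. \<bar>M i j\<bar> * \<bar>y j\<bar>"]) (auto simp: override_def)
  moreover have "(\<lambda>j. \<bar>M i j\<bar> * \<bar>override Q w y j\<bar>) summable_on (Q - P)"
    using assms by (intro summable_on_finite) auto
  ultimately have "(\<lambda>j. \<bar>M i j\<bar> * \<bar>override Q w y j\<bar>) summable_on (- Q \<union> (Q - P))"
    by (rule summable_on_union)
  moreover have "- Q \<union> (Q - P) = - P" using assms by auto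
  ultimately show "(\<lambda>j. \<bar>M i j\<bar> * \<bar>override Q w y j\<bar>) summable_on (- P)" by simp
qed

text \<open>The energy of the spins in \<open>Q - P\<close> under the outer boundary condition. It
  is the part of the total energy that is constant in the spins of \<open>P\<close>, so it cancels
  from conditional densities.\<close>

definition rest :: "'i set \<Rightarrow> 'i set \<Rightarrow> ('i \<Rightarrow> real) \<Rightarrow> ('i \<Rightarrow> real) \<Rightarrow> real"
  where "rest P Q y w = (\<Sum>i\<in>Q - P. \<psi> i (w i) + (s i + 2 * field Q y i) * w i)
    + (\<Sum>i\<in>Q - P. \<Sum>j\<in>Q - P. M i j * w i * w j)"

text \<open>The DLR consistency of the energies. The terms between \<open>P\<close> and
  \<open>Q - P\<close> occur twice in the quadratic form, by symmetry of \<open>M\<close>; this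
  matches the factor 2 with which \<open>Q - P\<close> acts on \<open>P\<close> as a boundary
  condition.\<close>

lemma hamiltonian_override:
  assumes fin: "finite Q" and PQ: "P \<subseteq> Q" and wt: "well_tempered M Q y"
  shows "Ham Q y (override P z w) = Ham P (override Q w y) z + rest P Q y w"
proof -
  have Q: "Q = P \<union> (Q - P)" using PQ by auto
  have finP: "finite P" using fin PQ by (rule finite_subset[rotated])
  have split: "(\<Sum>i\<in>Q. g i) = (\<Sum>i\<in>P. g i) + (\<Sum>i\<in>Q - P. g i)" for g :: "'i \<Rightarrow> real"
    using sum.subset_diff[OF PQ fin, of g] by simp
  let ?y = "override P z w"
  have yP: "?y i = z i" if "i \<in> P" for i using that by (simp add: override_def)
  have yT: "?y i = w i" if "i \<in> Q - P" for i using that by (simp add: override_def)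
  have 1: "(\<Sum>i\<in>Q. \<psi> i (?y i) + (s i + 2 * field Q y i) * ?y i) =
     (\<Sum>i\<in>P. \<psi> i (z i) + (s i + 2 * field Q y i) * z i) + (\<Sum>i\<in>Q - P. \<psi> i (w i) + (s i + 2 * field Q y i) * w i)"
    unfolding split using yP yT by (intro arg_cong2[of _ _ _ _ "(+)"] sum.cong) auto
  have cross: "(\<Sum>i\<in>Q - P. \<Sum>j\<in>P. M i j * w i * z j) = (\<Sum>i\<in>P. \<Sum>j\<in>Q - P. M i j * z i * w j)"
    by (subst sum.swap) (auto intro!: sum.cong simp: M_sym[of _ "_::'i"] mult.commute mult.left_commute intro: M_sym)
  have "(\<Sum>i\<in>Q. \<Sum>j\<in>Q. M i j * ?y i * ?y j) =
     (\<Sum>i\<in>P. (\<Sum>j\<in>P. M i j * z i * z j) + (\<Sum>j\<in>Q - P. M i j * z i * w j)) +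
     (\<Sum>i\<in>Q - P. (\<Sum>j\<in>P. M i j * w i * z j) + (\<Sum>j\<in>Q - P. M i j * w i * w j))"
    unfolding split using yP yT by (intro arg_cong2[of _ _ _ _ "(+)"] sum.cong) auto
  also have "\<dots> = (\<Sum>i\<in>P. \<Sum>j\<in>P. M i j * z i * z j) + 2 * (\<Sum>i\<in>P. \<Sum>j\<in>Q - P. M i j * z i * w j)
      + (\<Sum>i\<in>Q - P. \<Sum>j\<in>Q - P. M i j * w i * w j)"
    using cross by (simp add: sum.distrib)
  finally have 2: "(\<Sum>i\<in>Q. \<Sum>j\<in>Q. M i j * ?y i * ?y j) = \<dots>" .
  have "(\<Sum>i\<in>P. \<psi> i (z i) + (s i + 2 * field P (override Q w y) i) * z i) =
      (\<Sum>i\<in>P. (\<psi> i (z i) + (s i + 2 * field Q y i) * z i) + 2 * (\<Sum>j\<in>Q - P. M i j * z i * w j))"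
    by (intro sum.cong refl)
      (simp add: field_override[OF fin PQ wt] algebra_simps sum_distrib_left)
  then have 3: "(\<Sum>i\<in>P. \<psi> i (z i) + (s i + 2 * field P (override Q w y) i) * z i) =
     (\<Sum>i\<in>P. \<psi> i (z i) + (s i + 2 * field Q y i) * z i) + 2 * (\<Sum>i\<in>P. \<Sum>j\<in>Q - P. M i j * z i * w j)"
    by (simp add: sum.distrib sum_distrib_left)
  show ?thesis unfolding hamiltonian_eq rest_def 1 2 3 by simp
qed

text \<open>The factor \<open>exp (- rest P Q y w)\<close> cancels from the quotient. In this form
  the spins \<open>w\<close> enter through one jointly measurable weight rather than through a
  measure that varies with \<open>w\<close>.\<close>

lemma integral_gibbs_override:
  assumes fin: "finite Q" and PQ: "P \<subseteq> Q" and wt: "well_tempered M Q y"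
    and k: "k \<in> meas P"
  shows "(\<integral>z. k z \<partial>G P (override Q w y)) =
    (\<integral>z. k z * exp (- Ham Q y (override P z w)) \<partial>leb P) /
    (\<integral>z. exp (- Ham Q y (override P z w)) \<partial>leb P)"
proof -
  have finP: "finite P" using fin PQ by (rule finite_subset[rotated])
  have "exp (- Ham Q y (override P z w)) = exp (- rest P Q y w) * exp (- Ham P (override Q w y) z)" for z
    by (simp add: hamiltonian_override[OF fin PQ wt] mult_exp_exp)
  then show ?thesis
    unfolding integral_gibbs[OF finP k] partition_function_def
    by (simp add: mult.left_commute[of _ "exp (- rest P Q y w)"])
qed

text \<open>Access to the Poincare inequality for the functions built in the proof: these have
  bounded classical partial derivatives and at most linear growth, which the exponential moments
  make square integrable.\<close>

lemma H1_of_classical: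
  assumes fin: "finite P"
    and um: "u \<in> meas P"
    and u'm: "\<And>j. j \<in> P \<Longrightarrow> u' j \<in> meas P"
    and der: "\<And>j x. j \<in> P \<Longrightarrow> x \<in> configs P \<Longrightarrow> ((\<lambda>t. u (x(j := t))) has_real_derivative u' j x) (at (x j))"
    and ub: "\<And>x. x \<in> configs P \<Longrightarrow> \<bar>u x\<bar> \<le> C * (1 + (l1 P x))"
    and u'b: "\<And>j x. j \<in> P \<Longrightarrow> x \<in> configs P \<Longrightarrow> \<bar>u' j x\<bar> \<le> C"
  shows "H1_with_gradient P (G P y) u u'"
proof -
  interpret prob_space "G P y" by (rule prob_space_gibbs[OF fin])
  have "integrable (G P y) (\<lambda>x. (u x)\<^sup>2)"
  proof (rule integrable_gibbs_growth[OF fin, where C = "C\<^sup>2" and K = 2])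
    fix x assume x: "x \<in> configs P"
    define S where "S = (l1 P x)"
    have S: "S \<ge> 0" unfolding S_def by (simp add: sum_nonneg)
    have "0 \<le> C * (1 + S)" using order_trans[OF abs_ge_zero ub[OF x]] by (simp add: S_def)
    then have C: "C \<ge> 0" using S by (simp add: zero_le_mult_iff)
    have "\<bar>u x\<bar> \<le> C * (1 + S)" using ub[OF x] by (simp add: S_def)
    also have "\<dots> \<le> C * exp S" using exp_ge_add_one_self[of S] C by (intro mult_left_mono) auto
    finally have "\<bar>u x\<bar>\<^sup>2 \<le> (C * exp S)\<^sup>2" by (intro power_mono) auto
    also have "\<dots> = C\<^sup>2 * exp (2 * S)" by (simp add: power_mult_distrib exp_double)
    finally show "\<bar>(u x)\<^sup>2\<bar> \<le> C\<^sup>2 * exp (2 * (l1 P x))" by (simp add: S_def)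
  qed (intro borel_measurable_power um)
  then have "L2 (G P y) u" using um by (simp add: L2_def)
  moreover have "L2 (G P y) (u' j)" if j: "j \<in> P" for j
    unfolding L2_def
  proof
    show "integrable (G P y) (\<lambda>x. (u' j x)\<^sup>2)"
    proof (rule integrable_const_bound[where B = "C\<^sup>2"])
      show "AE x in G P y. norm ((u' j x)\<^sup>2) \<le> C\<^sup>2" (is "AE x in _. ?P x")
      proof (rule AE_I2)
        fix x assume "x \<in> space (G P y)"
        then have "\<bar>u' j x\<bar>\<^sup>2 \<le> C\<^sup>2" using u'b[OF j, of x] by (intro power_mono) auto
        then show "?P x" by simp
      qed
    qed (use u'm[OF j] in \<open>simp add: borel_measurable_power\<close>)
  qed (use u'm[OF j] in simp)
  moreover have "has_weak_partial_deriv P j u (u' j)" if "j \<in> P" for j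
    using weak_partial_deriv_of_classical[OF fin that um u'm[OF that] der[OF that] ub u'b[OF that]] .
  ultimately show ?thesis unfolding H1_with_gradient_def by blast
qed

lemma linear_upd:
  fixes a :: "'i \<Rightarrow> real"
  assumes "finite P" "j \<in> P"
  shows "(\<Sum>i\<in>P. a i * (x(j := t)) i) = (\<Sum>i\<in>P. a i * x i) + a j * (t - x j)"
proof -
  have "(\<Sum>i\<in>P. a i * (x(j := t)) i) = (\<Sum>i\<in>P. a i * x i + (if i = j then a j * (t - x j) else 0))"
    by (intro sum.cong) (auto simp: algebra_simps)
  then show ?thesis using assms by (simp add: sum.distrib)
qed

lemma measurable_linear: "(\<lambda>z. \<Sum>i\<in>P. a i * z i) \<in> meas P"
  by (intro borel_measurable_sum borel_measurable_times measurable_leb_component borel_measurable_const)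

lemma linear_bound:
  assumes "finite P"
  shows "\<bar>\<Sum>i\<in>P. a i * z i\<bar> \<le> (l1 P a) * (\<Sum>i\<in>P. \<bar>z i :: real\<bar>)"
proof -
  have "\<bar>\<Sum>i\<in>P. a i * z i\<bar> \<le> (\<Sum>i\<in>P. \<bar>a i\<bar> * \<bar>z i\<bar>)"
    by (rule order_trans[OF sum_abs]) (simp add: abs_mult)
  also have "\<dots> \<le> (\<Sum>i\<in>P. \<bar>a i\<bar> * (l1 P z))"
    using assms by (intro sum_mono mult_left_mono member_le_sum) auto
  finally show ?thesis by (simp add: sum_distrib_right)
qed

lemma H1_linear:
  assumes fin: "finite P"
  shows "H1_with_gradient P (G P y) (\<lambda>z. \<Sum>i\<in>P. a i * z i) (\<lambda>i z. a i)"
proof (rule H1_of_classical[OF fin measurable_linear, where C = "\<Sum>i\<in>P. \<bar>a i\<bar>"])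
  fix j x assume j: "j \<in> P"
  show "((\<lambda>t. \<Sum>i\<in>P. a i * (x(j := t)) i) has_real_derivative a j) (at (x j))"
    unfolding linear_upd[OF fin j] by (auto intro!: derivative_eq_intros)
  show "\<bar>a j\<bar> \<le> (l1 P a)" using fin j by (intro member_le_sum) auto
next
  fix x :: "'i \<Rightarrow> real"
  have "0 \<le> (l1 P a)" by (simp add: sum_nonneg)
  then show "\<bar>\<Sum>i\<in>P. a i * x i\<bar> \<le> (l1 P a) * (1 + (l1 P x))"
    using linear_bound[OF fin, of a x] unfolding distrib_left mult_1_right by linarith
qed auto

lemma poincare_linear:
  assumes fin: "finite P" and wt: "well_tempered M P y"
  shows "var (G P y) (\<lambda>z. \<Sum>i\<in>P. a i * z i) \<le> 1 / \<rho> * (\<Sum>i\<in>P. (a i)\<^sup>2)"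
proof -
  interpret prob_space "G P y" by (rule prob_space_gibbs[OF fin])
  show ?thesis using poincare[OF fin wt H1_linear[OF fin]] prob_space by simp
qed

text \<open>Changing one boundary spin tilts the Gibbs measure by the exponential of a linear function.\<close>

lemma has_derivative_boundary:
  fixes f :: "_ \<Rightarrow> real"
  assumes fin: "finite P" and j: "j \<notin> P" and wt: "well_tempered M P y"
    and f: "f \<in> meas P"
    and bd: "\<And>z. z \<in> configs P \<Longrightarrow> \<bar>f z\<bar> \<le> C * exp (K * (l1 P z))"
  shows "((\<lambda>t. \<integral>z. f z \<partial>G P (y(j := t))) has_real_derivative
    - 2 * ((\<integral>z. f z * (\<Sum>i\<in>P. M i j * z i) \<partial>G P y) - (\<integral>z. f z \<partial>G P y) * (\<integral>z. (\<Sum>i\<in>P. M i j * z i) \<partial>G P y))) (at (y j))"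
proof -
  interpret prob_space "G P y" by (rule prob_space_gibbs[OF fin])
  \<comment> \<open>Replacing \<open>y j\<close> by \<open>t\<close> shifts the field at
    \<open>i\<close> by \<open>M i j * (t - y j)\<close>, and the field enters the energy with
    factor 2. The weight is therefore multiplied by \<open>exp ((t - y j) * l z)\<close>.\<close>
  define l where "l z = - 2 * (\<Sum>i\<in>P. M i j * z i)" for z :: "'i \<Rightarrow> real"
  have lm: "l \<in> meas P"
    unfolding l_def by (intro borel_measurable_times measurable_linear borel_measurable_const)
  have C0: "C \<ge> 0"
  proof -
    have "restrict (\<lambda>_. 0) P \<in> configs P" by (auto simp: configs_def)
    from order_trans[OF abs_ge_zero bd[OF this]] show ?thesis by (simp add: zero_le_mult_iff)
  qed
  define a where "a = 4 * (\<Sum>i\<in>P. \<bar>M i j\<bar>)"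
  have la: "2 * \<bar>l z\<bar> \<le> a * (l1 P z)" for z
    using linear_bound[OF fin, of "\<lambda>i. M i j" z] by (simp add: l_def a_def abs_mult)
  have em: "(\<lambda>z. exp (2 * \<bar>l z\<bar>)) \<in> meas P"
    using lm by (intro measurable_compose[OF _ borel_measurable_exp] borel_measurable_times borel_measurable_abs) auto
  have i1: "integrable (G P y) (\<lambda>z. exp (2 * \<bar>l z\<bar>))"
    by (rule integrable_gibbs_growth[OF fin em, where C = 1 and K = a]) (use la in simp)
  have i2: "integrable (G P y) (\<lambda>z. f z * exp (2 * \<bar>l z\<bar>))"
  proof (rule integrable_gibbs_growth[OF fin borel_measurable_times[OF f em], where C = C and K = "K + a"])
    fix z assume z: "z \<in> configs P"
    have "\<bar>f z * exp (2 * \<bar>l z\<bar>)\<bar> \<le> (C * exp (K * (l1 P z))) * exp (a * (l1 P z))"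
      unfolding abs_mult using bd[OF z] la[of z] C0 by (intro mult_mono) auto
    also have "\<dots> = C * exp ((K + a) * (l1 P z))" by (simp add: mult_exp_exp distrib_right)
    finally show "\<bar>f z * exp (2 * \<bar>l z\<bar>)\<bar> \<le> C * exp ((K + a) * (l1 P z))" .
  qed
  have tilt: "(\<integral>z. f z \<partial>G P (y(j := t))) =
     (\<integral>z. f z * exp ((t - y j) * l z) \<partial>G P y) / (\<integral>z. exp ((t - y j) * l z) \<partial>G P y)" for t
  proof -
    have fld: "field P (y(j := t)) i = field P y i + M i j * (t - y j)" if i: "i \<in> P" for i
    proof -
      have "(\<lambda>k. M i k * y k) summable_on (- P)" by (rule well_tempered_summable[OF wt i])
      moreover have "(\<lambda>k. if k = j then M i j * (t - y j) else 0) summable_on (- P)"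
        by (rule summable_on_cong_neutral[where T = "{j}" and g = "\<lambda>k. M i j * (t - y j)", THEN iffD2]) (use j in auto)
      moreover have "field P (y(j := t)) i = (\<Sum>\<^sub>\<infinity>k\<in>-P. M i k * y k + (if k = j then M i j * (t - y j) else 0))"
        unfolding field_def by (intro infsum_cong) (auto simp: algebra_simps)
      moreover have "(\<Sum>\<^sub>\<infinity>k\<in>-P. (if k = j then M i j * (t - y j) else 0)) = M i j * (t - y j)"
      proof -
        have "(\<Sum>\<^sub>\<infinity>k\<in>-P. (if k = j then M i j * (t - y j) else 0)) = (\<Sum>\<^sub>\<infinity>k\<in>{j}. M i j * (t - y j))"
          by (rule infsum_cong_neutral) (use j in auto)
        then show ?thesis by simp
      qed
      ultimately show ?thesis unfolding field_def by (simp add: infsum_add)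
    qed
    have "Ham P (y(j := t)) z = Ham P y z - (t - y j) * l z" for z
    proof -
      have "(\<Sum>i\<in>P. \<psi> i (z i) + (s i + 2 * field P (y(j := t)) i) * z i) =
         (\<Sum>i\<in>P. \<psi> i (z i) + (s i + 2 * field P y i) * z i + (t - y j) * 2 * (M i j * z i))"
        by (intro sum.cong refl) (simp add: fld algebra_simps)
      also have "\<dots> = (\<Sum>i\<in>P. \<psi> i (z i) + (s i + 2 * field P y i) * z i) - (t - y j) * l z"
        by (simp add: sum.distrib l_def flip: sum_distrib_left)
      finally show ?thesis unfolding hamiltonian_eq by simp
    qed
    then have e: "exp (- Ham P (y(j := t)) z) = exp ((t - y j) * l z) * exp (- Ham P y z)" for z
      by (simp add: mult_exp_exp)
    have etm: "(\<lambda>z. exp ((t - y j) * l z)) \<in> meas P"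
      using lm by (intro measurable_compose[OF _ borel_measurable_exp] borel_measurable_times) auto
    show ?thesis
      unfolding integral_gibbs[OF fin f] integral_gibbs[OF fin etm] integral_gibbs[OF fin borel_measurable_times[OF f etm]]
      using Z_pos[OF fin, of y]
      by (simp add: partition_function_def[of _ _ _ _ "y(j := t)"] e mult.assoc)
  qed
  have D: "((\<lambda>t. (\<integral>z. f z * exp (t * l z) \<partial>G P y) / (\<integral>z. exp (t * l z) \<partial>G P y)) has_real_derivative
    expectation (\<lambda>z. f z * l z) - expectation f * expectation l) (at (y j - y j))"
    using has_derivative_exp_tilt_expectation[OF _ _ i2 i1] f lm by simp
  have "((\<lambda>t. t - y j) has_real_derivative 1) (at (y j))" by (auto intro!: derivative_eq_intros)
  from DERIV_chain2[where g = "\<lambda>t. t - y j" and x = "y j" and s = UNIV, OF D this]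
  have "((\<lambda>t. \<integral>z. f z \<partial>G P (y(j := t))) has_real_derivative
    expectation (\<lambda>z. f z * l z) - expectation f * expectation l) (at (y j))"
    by (simp only: tilt mult_1_right)
  also have "(\<lambda>z. f z * l z) = (\<lambda>z. - 2 * (f z * (\<Sum>i\<in>P. M i j * z i)))"
    by (auto simp: l_def)
  also have "expectation \<dots> - expectation f * expectation l = - 2 * ((\<integral>z. f z * (\<Sum>i\<in>P. M i j * z i) \<partial>G P y) - (\<integral>z. f z \<partial>G P y) * (\<integral>z. (\<Sum>i\<in>P. M i j * z i) \<partial>G P y))"
    unfolding l_def integral_mult_right_zero by (simp add: algebra_simps)
  finally show ?thesis .
qed

end

section \<open>Conditional expectations in a finite volume\<close>

text \<open>Observables are functions of a total configuration, which is both the configuration inside and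
  the boundary condition outside of a volume.\<close>

locale finite_volume = spin_system +
  fixes V :: "'a set" and \<omega> :: "'a \<Rightarrow> real"
  assumes fin: "finite V" and wt: "well_tempered M V \<omega>"
begin

text \<open>The configurations seen by the Gibbs measure with boundary condition
  \<open>\<omega>\<close>. The set is closed under \<open>override P\<close> for
  \<open>P \<subseteq> V\<close>, so estimates that hold on it may be used under every conditional
  expectation.\<close>

definition reach :: "('a \<Rightarrow> real) set"
  where "reach = {y. \<forall>i. i \<notin> V \<longrightarrow> y i = \<omega> i}"

definition obs :: "(('a \<Rightarrow> real) \<Rightarrow> real) \<Rightarrow> bool"
  where "obs h \<longleftrightarrow> (\<lambda>w. h (override V w \<omega>)) \<in> meas V"

text \<open>Linear functions of the spins are unbounded, so a class larger than \<open>bdd\<close>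
  is used for products with them; it is closed under products, and exponential moments make its
  members integrable under all conditional measures. Conditional expectations are shown to preserve
  \<open>bdd\<close>; for \<open>tame\<close> functions \<open>E_tower\<close> asks for this as a
  hypothesis.\<close>

definition tame :: "(('a \<Rightarrow> real) \<Rightarrow> real) \<Rightarrow> bool"
  where "tame h \<longleftrightarrow> obs h \<and> (\<exists>C K. 0 \<le> C \<and> 0 \<le> K \<and> (\<forall>y\<in>reach. \<bar>h y\<bar> \<le> C * exp (K * (l1 V y))))"

definition bdd :: "(('a \<Rightarrow> real) \<Rightarrow> real) \<Rightarrow> bool"
  where "bdd h \<longleftrightarrow> obs h \<and> (\<exists>B. \<forall>y\<in>reach. \<bar>h y\<bar> \<le> B)"

text \<open>The Gibbs specification: the conditional expectation given the spins off \<open>P\<close>.\<close>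

definition E :: "'a set \<Rightarrow> (('a \<Rightarrow> real) \<Rightarrow> real) \<Rightarrow> ('a \<Rightarrow> real) \<Rightarrow> real"
  where "E P h y = (\<integral>z. h (override P z y) \<partial>G P y)"

text \<open>The counterpart of measurability with respect to the spins off \<open>P\<close>. As it
  is a pointwise condition, the rules for pulling such a factor out of \<open>E P\<close> are
  identities at every configuration and not merely almost everywhere.\<close>

definition free_of :: "'a set \<Rightarrow> (('a \<Rightarrow> real) \<Rightarrow> real) \<Rightarrow> bool"
  where "free_of P h \<longleftrightarrow> (\<forall>z y. h (override P z y) = h y)"

lemma finP: "P \<subseteq> V \<Longrightarrow> finite P"
  using fin finite_subset by blast

lemma reach_override: "P \<subseteq> V \<Longrightarrow> y \<in> reach \<Longrightarrow> override P z y \<in> reach"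
  by (auto simp: reach_def override_def)

lemma omega_reach: "\<omega> \<in> reach"
  by (simp add: reach_def)

lemma reach_eq: "y \<in> reach \<Longrightarrow> y = override V (restrict y V) \<omega>"
  by (auto simp: reach_def override_def fun_eq_iff)

lemma restrict_configs: "restrict y V \<in> configs V"
  by (auto simp: configs_def)

lemma reach_wt: "y \<in> reach \<Longrightarrow> P \<subseteq> V \<Longrightarrow> well_tempered M P y"
  using well_tempered_override[OF fin _ wt, of P "restrict y V"] reach_eq by metis

lemma obs_section:
  assumes "obs h" "P \<subseteq> V" "y \<in> reach"
  shows "(\<lambda>z. h (override P z y)) \<in> meas P"
proof -
  have "(\<lambda>z. h (override V (override P z (restrict y V)) \<omega>)) \<in> meas P"
    using measurable_compose[OF measurable_override1[OF assms(2) restrict_configs] assms(1)[unfolded obs_def]] .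
  then show ?thesis using override_override[OF assms(2)] reach_eq[OF assms(3)] by simp
qed

lemma obs_arith:
  "obs (\<lambda>_. c)"
  "obs h \<Longrightarrow> obs k \<Longrightarrow> obs (\<lambda>y. h y + k y)"
  "obs h \<Longrightarrow> obs k \<Longrightarrow> obs (\<lambda>y. h y - k y)"
  "obs h \<Longrightarrow> obs k \<Longrightarrow> obs (\<lambda>y. h y * k y)"
  unfolding obs_def by auto

text \<open>With the energy of the whole volume as weight, \<open>E P h\<close> is a quotient of two
  parameter integrals over \<open>leb P\<close>, and these are measurable in the parameter by
  Fubini.\<close>

lemma obs_E:
  assumes h: "obs h" and P: "P \<subseteq> V"
  shows "obs (E P h)"
proof -
  interpret sigma_finite_measure "leb P"
    by (rule sigma_finite_leb[OF finP[OF P]])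
  let ?N = "leb V \<Otimes>\<^sub>M leb P"
  have m1: "(\<lambda>p. h (override V (override P (snd p) (fst p)) \<omega>)) \<in> borel_measurable ?N"
    using measurable_compose[OF measurable_override[OF P] h[unfolded obs_def]] by (simp add: case_prod_beta)
  have m2: "(\<lambda>p. exp (- Ham V \<omega> (override P (snd p) (fst p)))) \<in> borel_measurable ?N"
    using measurable_compose[OF measurable_override[OF P] measurable_exp_hamiltonian] by (simp add: case_prod_beta)
  have a: "(\<lambda>w. \<integral>z. h (override V (override P z w) \<omega>) * exp (- Ham V \<omega> (override P z w)) \<partial>leb P)
      \<in> meas V"
    by (rule borel_measurable_lebesgue_integral) (use borel_measurable_times[OF m1 m2] in \<open>simp add: case_prod_beta\<close>)
  have b: "(\<lambda>w. \<integral>z. exp (- Ham V \<omega> (override P z w)) \<partial>leb P)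
      \<in> meas V"
    by (rule borel_measurable_lebesgue_integral) (use m2 in \<open>simp add: case_prod_beta\<close>)
  have "E P h (override V w \<omega>) =
      (\<integral>z. h (override V (override P z w) \<omega>) * exp (- Ham V \<omega> (override P z w)) \<partial>leb P) /
      (\<integral>z. exp (- Ham V \<omega> (override P z w)) \<partial>leb P)" for w
    unfolding E_def override_override[OF P]
    by (rule integral_gibbs_override[OF fin P wt])
      (rule obs_section[OF h P reach_override[OF subset_refl omega_reach]])
  then show ?thesis unfolding obs_def using borel_measurable_divide[OF a b] by simp
qed

section \<open>Closure properties of the classes of observables\<close>

lemma tame_obs: "tame h \<Longrightarrow> obs h" by (simp add: tame_def)
lemma bdd_obs: "bdd h \<Longrightarrow> obs h" by (simp add: bdd_def)

lemma bdd_tame: assumes "bdd h" shows "tame h"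
proof -
  obtain B where B: "\<And>y. y \<in> reach \<Longrightarrow> \<bar>h y\<bar> \<le> B" using assms by (auto simp: bdd_def)
  have "B \<ge> 0" using order_trans[OF abs_ge_zero B[OF omega_reach]] .
  then show ?thesis unfolding tame_def using bdd_obs[OF assms] B
    by (intro conjI exI[of _ B] exI[of _ 0]) auto
qed

lemma bdd_arith:
  "bdd (\<lambda>_. c)"
  "bdd h \<Longrightarrow> bdd k \<Longrightarrow> bdd (\<lambda>y. h y + k y)"
  "bdd h \<Longrightarrow> bdd k \<Longrightarrow> bdd (\<lambda>y. h y - k y)"
  "bdd h \<Longrightarrow> bdd k \<Longrightarrow> bdd (\<lambda>y. h y * k y)"
proof -
  show "bdd (\<lambda>_. c)" unfolding bdd_def using obs_arith(1) by blast
next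
  assume h: "bdd h" and k: "bdd k"
  then obtain B D where B: "\<And>y. y \<in> reach \<Longrightarrow> \<bar>h y\<bar> \<le> B" and D: "\<And>y. y \<in> reach \<Longrightarrow> \<bar>k y\<bar> \<le> D"
    unfolding bdd_def by blast
  note o = obs_arith(2-4)[OF bdd_obs[OF h] bdd_obs[OF k]]
  have "\<bar>h y + k y\<bar> \<le> B + D" "\<bar>h y - k y\<bar> \<le> B + D" if "y \<in> reach" for y
    using B[OF that] D[OF that] by linarith+
  then show "bdd (\<lambda>y. h y + k y)" "bdd (\<lambda>y. h y - k y)"
    unfolding bdd_def using o by blast+
  have "\<bar>h y * k y\<bar> \<le> B * D" if "y \<in> reach" for y
    unfolding abs_mult using B[OF that] D[OF that] order_trans[OF abs_ge_zero B[OF that]] by (intro mult_mono) auto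
  then show "bdd (\<lambda>y. h y * k y)" unfolding bdd_def using o by blast
qed

lemma bdd_power2: "bdd h \<Longrightarrow> bdd (\<lambda>y. (h y)\<^sup>2)"
  unfolding power2_eq_square by (rule bdd_arith)

lemma bdd_sum: "(\<And>j. j \<in> T \<Longrightarrow> bdd (h j)) \<Longrightarrow> bdd (\<lambda>y. \<Sum>j\<in>T. h j y)"
  by (induction T rule: infinite_finite_induct) (auto intro: bdd_arith)

lemma tame_mult:
  assumes h: "tame h" and k: "tame k"
  shows "tame (\<lambda>y. h y * k y)"
proof -
  let ?S = "\<lambda>y::'a\<Rightarrow>real. \<Sum>i\<in>V. \<bar>y i\<bar>"
  obtain C K where C: "0 \<le> C" "0 \<le> K" "\<And>y. y \<in> reach \<Longrightarrow> \<bar>h y\<bar> \<le> C * exp (K * ?S y)"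
    using h unfolding tame_def by blast
  obtain C' K' where C': "0 \<le> C'" "0 \<le> K'" "\<And>y. y \<in> reach \<Longrightarrow> \<bar>k y\<bar> \<le> C' * exp (K' * ?S y)"
    using k unfolding tame_def by blast
  have "\<bar>h y * k y\<bar> \<le> (C * C') * exp ((K + K') * ?S y)" if "y \<in> reach" for y
  proof -
    have "\<bar>h y * k y\<bar> \<le> (C * exp (K * ?S y)) * (C' * exp (K' * ?S y))"
      unfolding abs_mult using C(1) by (intro mult_mono C(3) C'(3) that) auto
    then show ?thesis by (simp add: exp_add distrib_right mult.assoc mult.left_commute)
  qed
  moreover have "0 \<le> C * C'" "0 \<le> K + K'" using C(1,2) C'(1,2) by auto
  ultimately show ?thesis unfolding tame_def using obs_arith(4)[OF h[THEN tame_obs] k[THEN tame_obs]] by blast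
qed

lemma tame_add:
  assumes h: "tame h" and k: "tame k"
  shows "tame (\<lambda>y. h y + k y)"
proof -
  let ?S = "\<lambda>y::'a\<Rightarrow>real. \<Sum>i\<in>V. \<bar>y i\<bar>"
  obtain C K where C: "0 \<le> C" "0 \<le> K" "\<And>y. y \<in> reach \<Longrightarrow> \<bar>h y\<bar> \<le> C * exp (K * ?S y)"
    using h unfolding tame_def by blast
  obtain C' K' where C': "0 \<le> C'" "0 \<le> K'" "\<And>y. y \<in> reach \<Longrightarrow> \<bar>k y\<bar> \<le> C' * exp (K' * ?S y)"
    using k unfolding tame_def by blast
  have "\<bar>h y + k y\<bar> \<le> (C + C') * exp ((K + K') * ?S y)" if "y \<in> reach" for y
  proof -
    have S: "?S y \<ge> 0" by (simp add: sum_nonneg)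
    have "C * exp (K * ?S y) \<le> C * exp ((K + K') * ?S y)"
      using C C' S by (intro mult_left_mono) (auto intro!: mult_right_mono)
    moreover have "C' * exp (K' * ?S y) \<le> C' * exp ((K + K') * ?S y)"
      using C C' S by (intro mult_left_mono) (auto intro!: mult_right_mono)
    ultimately show ?thesis using C(3)[OF that] C'(3)[OF that] unfolding distrib_right by linarith
  qed
  moreover have "0 \<le> C + C'" "0 \<le> K + K'" using C(1,2) C'(1,2) by auto
  ultimately show ?thesis unfolding tame_def using obs_arith(2)[OF h[THEN tame_obs] k[THEN tame_obs]] by blast
qed

lemma tame_const: "tame (\<lambda>_. c)" by (intro bdd_tame bdd_arith)

lemma tame_cmult: "tame h \<Longrightarrow> tame (\<lambda>y. c * h y)" by (intro tame_mult tame_const)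

lemma tame_diff: "tame h \<Longrightarrow> tame k \<Longrightarrow> tame (\<lambda>y. h y - k y)"
  using tame_add[OF _ tame_cmult[of k "-1"], of h] by simp

lemma tame_power2: "tame h \<Longrightarrow> tame (\<lambda>y. (h y)\<^sup>2)"
  unfolding power2_eq_square by (rule tame_mult)

lemma tame_sum: "(\<And>j. j \<in> T \<Longrightarrow> tame (h j)) \<Longrightarrow> tame (\<lambda>y. \<Sum>j\<in>T. h j y)"
  by (induction T rule: infinite_finite_induct) (auto intro: tame_const tame_add)

lemma tame_coordinate: assumes i: "i \<in> V" shows "tame (\<lambda>y. y i)"
proof -
  have "obs (\<lambda>y. y i)" unfolding obs_def override_def using i measurable_leb_component by auto
  moreover have "\<bar>y i\<bar> \<le> 1 * exp (1 * (l1 V y))" for y :: "'a \<Rightarrow> real"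
  proof -
    have "\<bar>y i\<bar> \<le> (l1 V y)" using fin i by (intro member_le_sum) auto
    also have "\<dots> \<le> exp (l1 V y)" using exp_ge_add_one_self[of "\<Sum>i\<in>V. \<bar>y i\<bar>"] by linarith
    finally show ?thesis by simp
  qed
  ultimately show ?thesis unfolding tame_def by (intro conjI exI[of _ 1]) auto
qed

lemma tame_linear: "P \<subseteq> V \<Longrightarrow> tame (\<lambda>y. \<Sum>i\<in>P. a i * y i)"
  by (intro tame_sum tame_cmult tame_coordinate) auto

lemma tame_section_bound:
  assumes h: "tame h" and P: "P \<subseteq> V" and y: "y \<in> reach"
  shows "\<exists>C K. \<forall>z. \<bar>h (override P z y)\<bar> \<le> C * exp (K * (l1 P z))"
proof -
  obtain C K where C: "0 \<le> C" "0 \<le> K" "\<And>y. y \<in> reach \<Longrightarrow> \<bar>h y\<bar> \<le> C * exp (K * (l1 V y))"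
    using h unfolding tame_def by blast
  have "\<bar>h (override P z y)\<bar> \<le> (C * exp (K * (\<Sum>i\<in>V-P. \<bar>y i\<bar>))) * exp (K * (l1 P z))" for z
  proof -
    have "(\<Sum>i\<in>V. \<bar>override P z y i\<bar>) = (\<Sum>i\<in>V-P. \<bar>y i\<bar>) + (l1 P z)"
      unfolding sum.subset_diff[OF P fin]
      by (intro arg_cong2[of _ _ _ _ "(+)"] sum.cong) (auto simp: override_def)
    with C(3)[OF reach_override[OF P y, of z]] show ?thesis
      by (simp add: distrib_left exp_add mult.assoc)
  qed
  then show ?thesis by blast
qed

lemma tame_integrable:
  assumes h: "tame h" and P: "P \<subseteq> V" and y: "y \<in> reach"
  shows "integrable (G P y) (\<lambda>z. h (override P z y))"
proof -
  obtain C K where "\<And>z. \<bar>h (override P z y)\<bar> \<le> C * exp (K * (l1 P z))"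
    using tame_section_bound[OF assms] by blast
  then show ?thesis by (intro integrable_gibbs_growth[OF finP[OF P] obs_section[OF tame_obs[OF h] P y]])
qed

section \<open>Calculus of conditional expectations\<close>

lemma E_const: assumes "P \<subseteq> V" shows "E P (\<lambda>_. c) y = c"
proof -
  interpret prob_space "G P y" by (rule prob_space_gibbs[OF finP[OF assms]])
  show ?thesis unfolding E_def by (simp add: prob_space[unfolded space_gibbs])
qed

lemma
  assumes P: "P \<subseteq> V" and y: "y \<in> reach" and h: "tame h" and k: "tame k"
  shows E_add: "E P (\<lambda>u. h u + k u) y = E P h y + E P k y"
    and E_diff: "E P (\<lambda>u. h u - k u) y = E P h y - E P k y"
  unfolding E_def using tame_integrable[OF h P y] tame_integrable[OF k P y] by auto

lemma E_cmult: "E P (\<lambda>u. c * h u) y = c * E P h y"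
  unfolding E_def by (rule integral_mult_right_zero)

lemma E_sum:
  assumes P: "P \<subseteq> V" and y: "y \<in> reach" and h: "\<And>j. j \<in> T \<Longrightarrow> tame (h j)"
  shows "E P (\<lambda>u. \<Sum>j\<in>T. h j u) y = (\<Sum>j\<in>T. E P (h j) y)"
  unfolding E_def using tame_integrable[OF h P y] by (intro Bochner_Integration.integral_sum)

lemma E_mono:
  assumes P: "P \<subseteq> V" and y: "y \<in> reach" and h: "tame h" and k: "tame k"
    and le: "\<And>u. u \<in> reach \<Longrightarrow> h u \<le> k u"
  shows "E P h y \<le> E P k y"
  unfolding E_def
  by (intro integral_mono tame_integrable P y h k le reach_override)

lemma E_cong:
  assumes P: "P \<subseteq> V" and y: "y \<in> reach" and eq: "\<And>u. u \<in> reach \<Longrightarrow> h u = k u"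
  shows "E P h y = E P k y"
  unfolding E_def by (intro Bochner_Integration.integral_cong refl eq reach_override P y)

lemma E_pull:
  assumes "free_of P k" shows "E P (\<lambda>u. k u * h u) y = k y * E P h y"
  using assms unfolding E_def free_of_def by simp

lemma E_free: assumes "P \<subseteq> V" "free_of P k" shows "E P k y = k y"
  using E_pull[OF assms(2), of "\<lambda>_. 1" y] E_const[OF assms(1), of 1] by simp

lemma free_E: "free_of P (E P h)"
proof -
  have "G P (override P z y) = G P y" for z y by (rule gibbs_cong) (simp add: override_def)
  then show ?thesis unfolding free_of_def E_def by (simp add: override_absorb)
qed

lemma bdd_E: assumes h: "bdd h" and P: "P \<subseteq> V" shows "bdd (E P h)"
proof -
  obtain B where B: "\<And>y. y \<in> reach \<Longrightarrow> \<bar>h y\<bar> \<le> B" using h by (auto simp: bdd_def)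
  have "\<bar>E P h y\<bar> \<le> B" if y: "y \<in> reach" for y
  proof -
    have "E P h y \<le> E P (\<lambda>_. B) y"
      using B by (intro E_mono P y bdd_tame h tame_const) (auto simp: abs_le_iff)
    moreover have "E P (\<lambda>_. - B) y \<le> E P h y"
      using B by (intro E_mono P y bdd_tame h tame_const) (auto simp: abs_le_iff minus_le_iff)
    ultimately show ?thesis using E_const[OF P] by (simp add: abs_le_iff minus_le_iff)
  qed
  then show ?thesis unfolding bdd_def using obs_E[OF bdd_obs[OF h] P] by blast
qed

text \<open>Fix the spins \<open>u\<close> in \<open>Q - P\<close>. Then \<open>E P h\<close> is
  constant in the inner variable, and its value is the quotient of two inner integrals with the
  weight of \<open>Q\<close>; multiplied by the integral of that weight it returns the inner
  integral of \<open>h\<close>. Fubini over \<open>Q - P\<close> finishes the argument.\<close>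

lemma E_tower:
  assumes PQ: "P \<subseteq> Q" and Q: "Q \<subseteq> V" and y: "y \<in> reach" and h: "tame h" and Eh: "tame (E P h)"
  shows "E Q (E P h) y = E Q h y"
proof -
  have P: "P \<subseteq> V" using PQ Q by auto
  note finQ = finP[OF Q] and wtQ = reach_wt[OF y Q]
  let ?e = "\<lambda>w. exp (- Ham Q y w)"
  have hm: "(\<lambda>w. k (override Q w y)) \<in> meas Q" if "tame k" for k
    by (rule obs_section[OF tame_obs[OF that] Q y])
  have int: "integrable (leb Q) (\<lambda>w. k (override Q w y) * ?e w)" if "tame k" for k
    using tame_integrable[OF that Q y] unfolding integrable_gibbs[OF finQ hm[OF that]] .
  have inner: "(\<integral>z. E P h (override Q (override P z u) y) * ?e (override P z u) \<partial>leb P) =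
      (\<integral>z. h (override Q (override P z u) y) * ?e (override P z u) \<partial>leb P)" for u
  proof -
    let ?u = "override Q u y"
    have u: "?u \<in> reach" by (rule reach_override[OF Q y])
    have "E P h (override Q (override P z u) y) = E P h ?u" for z
      using free_E[of P h] unfolding override_override[OF PQ] free_of_def by simp
    then have "(\<integral>z. E P h (override Q (override P z u) y) * ?e (override P z u) \<partial>leb P) =
       E P h ?u * (\<integral>z. ?e (override P z u) \<partial>leb P)" by simp
    also have "E P h ?u = (\<integral>z. h (override P z ?u) * ?e (override P z u) \<partial>leb P) /
       (\<integral>z. ?e (override P z u) \<partial>leb P)"
      unfolding E_def
      by (rule integral_gibbs_override[OF finQ PQ wtQ obs_section[OF tame_obs[OF h] P u]])
    finally have *: "(\<integral>z. E P h (override Q (override P z u) y) * ?e (override P z u) \<partial>leb P) =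
      (\<integral>z. h (override P z ?u) * ?e (override P z u) \<partial>leb P) /
       (\<integral>z. ?e (override P z u) \<partial>leb P) * (\<integral>z. ?e (override P z u) \<partial>leb P)" .
    have "(\<integral>z. ?e (override P z u) \<partial>leb P) = exp (- rest P Q y u) * Z P ?u"
    proof -
      have "?e (override P z u) = exp (- rest P Q y u) * exp (- Ham P ?u z)" for z
        by (simp add: hamiltonian_override[OF finQ PQ wtQ] mult_exp_exp)
      then show ?thesis unfolding partition_function_def by simp
    qed
    then have "(\<integral>z. ?e (override P z u) \<partial>leb P) \<noteq> 0"
      using Z_pos[OF finP[OF P], of ?u] by simp
    with * show ?thesis by (simp add: override_override[OF PQ])
  qed
  have "(\<integral>w. E P h (override Q w y) * ?e w \<partial>leb Q) = (\<integral>w. h (override Q w y) * ?e w \<partial>leb Q)"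
    unfolding integral_leb_fold[OF finQ PQ int[OF Eh]]
      integral_leb_fold[OF finQ PQ int[OF h]] inner ..
  then show ?thesis unfolding E_def[of Q] integral_gibbs[OF finQ hm[OF Eh]] integral_gibbs[OF finQ hm[OF h]] by simp
qed

lemma E_Cauchy_Schwarz:
  assumes P: "P \<subseteq> V" and y: "y \<in> reach" and h: "tame h" and k: "tame k"
  shows "(E P (\<lambda>u. h u * k u) y)\<^sup>2 \<le> E P (\<lambda>u. (h u)\<^sup>2) y * E P (\<lambda>u. (k u)\<^sup>2) y"
proof -
  interpret prob_space "G P y" by (rule prob_space_gibbs[OF finP[OF P]])
  show ?thesis unfolding E_def
    using obs_section[OF tame_obs P y] h k tame_integrable[OF tame_power2 P y]
    by (intro Cauchy_Schwarz_expectation) auto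
qed

lemma E_Jensen:
  assumes P: "P \<subseteq> V" and y: "y \<in> reach" and h: "tame h"
  shows "(E P h y)\<^sup>2 \<le> E P (\<lambda>u. (h u)\<^sup>2) y"
  using E_Cauchy_Schwarz[OF P y h tame_const[of 1]] E_const[OF P, of 1] by simp

lemma E_nonneg:
  assumes P: "P \<subseteq> V" and y: "y \<in> reach" and "\<And>u. u \<in> reach \<Longrightarrow> 0 \<le> h u"
  shows "0 \<le> E P h y"
  unfolding E_def by (intro integral_nonneg_AE AE_I2 assms reach_override)

end

section \<open>Hole filling\<close>

text \<open>\<open>support\<close> tests \<open>f\<close> on \<open>configs \<Lambda>\<close> only,
  whereas observables are evaluated at total configurations; the condition here is imposed on all of
  these.\<close>

definition depends_on :: "'i set \<Rightarrow> (('i \<Rightarrow> real) \<Rightarrow> real) \<Rightarrow> bool"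
  where "depends_on A f \<longleftrightarrow> (\<forall>x y. (\<forall>i\<in>A. x i = y i) \<longrightarrow> f x = f y)"

lemma depends_on_mono: "depends_on A f \<Longrightarrow> A \<subseteq> B \<Longrightarrow> depends_on B f"
  unfolding depends_on_def by blast

context finite_volume
begin

definition lin :: "'a set \<Rightarrow> 'a \<Rightarrow> ('a \<Rightarrow> real) \<Rightarrow> real"
  where "lin P j y = (\<Sum>i\<in>P. M i j * y i)"

text \<open>The conditional covariance of \<open>f\<close> with \<open>lin P j\<close>. Centring one
  of the two factors suffices. Up to a factor 2, \<open>lin P j\<close> is the response of the
  energy in \<open>P\<close> to the spin at \<open>j\<close>.\<close>

abbreviation clin :: "'a set \<Rightarrow> (('a \<Rightarrow> real) \<Rightarrow> real) \<Rightarrow> 'a \<Rightarrow> ('a \<Rightarrow> real) \<Rightarrow> real"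
  where "clin P f j \<equiv> E P (\<lambda>u. (f u - E P f u) * lin P j u)"

lemma tame_lin: "P \<subseteq> V \<Longrightarrow> tame (lin P j)"
  unfolding lin_def[abs_def] by (rule tame_linear)

lemma depends_on_free:
  assumes "depends_on A g" "A \<inter> P = {}" shows "free_of P g"
  unfolding free_of_def
proof (intro allI)
  fix z y
  have "\<forall>i\<in>A. override P z y i = y i" using assms(2) by (auto simp: override_def)
  with assms(1) show "g (override P z y) = g y" unfolding depends_on_def by blast
qed

lemma free_lin: "free_of P (lin (Q - P) j)"
  unfolding free_of_def lin_def override_def by (auto intro!: sum.cong)

lemma E_centered:
  assumes P: "P \<subseteq> V" and y: "y \<in> reach" and h: "bdd h"
  shows "E P (\<lambda>u. h u - E P h u) y = 0"
  using E_diff[OF P y bdd_tame[OF h] bdd_tame[OF bdd_E[OF h P]]] E_free[OF P free_E] by simp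

text \<open>By duality, the Poincare inequality enters here only through linear functions.\<close>

lemma sum_covariance_linear:
  assumes P: "P \<subseteq> V" and y: "y \<in> reach" and h: "bdd h" and m: "m \<ge> 0"
    and op: "\<And>v. (\<Sum>i\<in>P. (\<Sum>j\<in>T. M i j * v j)\<^sup>2) \<le> m * (\<Sum>j\<in>T. (v j)\<^sup>2)"
  shows "(\<Sum>j\<in>T. (clin P h j y)\<^sup>2) \<le> m / \<rho> * E P (\<lambda>u. (h u - E P h u)\<^sup>2) y"
proof -
  define D where "D u = h u - E P h u" for u
  have D: "bdd D" unfolding D_def[abs_def] by (intro bdd_arith h bdd_E P)
  have ED: "E P D y = 0" unfolding D_def[abs_def] by (rule E_centered[OF P y h])
  define c where "c j = E P (\<lambda>u. D u * lin P j u) y" for j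
  \<comment> \<open>The covariances \<open>c j\<close> serve as their own test vector: the linear
    function \<open>L\<close> with coefficients \<open>a\<close> is
    \<open>\<Sum>j\<in>T. c j * lin P j\<close>, and its covariance with \<open>D\<close> is the sum
    \<open>X\<close> of squares to be bounded. Poincare and \<open>op\<close> bound the variance of
    \<open>L\<close> by \<open>m / \<rho> * X\<close>, and one factor \<open>X\<close>
    cancels.\<close>
  define a where "a i = (\<Sum>j\<in>T. M i j * c j)" for i
  define L where "L u = (\<Sum>i\<in>P. a i * u i)" for u :: "'a \<Rightarrow> real"
  have L: "tame L" unfolding L_def[abs_def] by (rule tame_linear[OF P])
  have L_eq: "L u = (\<Sum>j\<in>T. c j * lin P j u)" for u
    unfolding L_def a_def lin_def sum_distrib_right sum_distrib_left
    by (subst sum.swap) (simp add: mult_ac)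
  define X where "X = (\<Sum>j\<in>T. (c j)\<^sup>2)"
  define W where "W = E P (\<lambda>u. (D u)\<^sup>2) y"
  have W0: "W \<ge> 0" unfolding W_def by (intro E_nonneg[OF P y]) auto
  have X0: "X \<ge> 0" unfolding X_def by (simp add: sum_nonneg)
  have "E P (\<lambda>u. D u * L u) y = E P (\<lambda>u. \<Sum>j\<in>T. c j * (D u * lin P j u)) y"
    by (simp add: L_eq sum_distrib_left mult.left_commute)
  also have "\<dots> = X"
    by (subst E_sum[OF P y]) (auto intro!: tame_cmult tame_mult bdd_tame[OF D] tame_lin[OF P]
        simp: E_cmult X_def power2_eq_square c_def[symmetric])
  finally have X_eq: "E P (\<lambda>u. D u * L u) y = X" .
  define l0 where "l0 = E P L y"
  have tL: "tame (\<lambda>u. L u - l0)" by (intro tame_diff L tame_const)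
  \<comment> \<open>As \<open>D\<close> has conditional mean zero, \<open>L\<close> may be centred,
    which replaces its second moment by its variance.\<close>
  have "E P (\<lambda>u. D u * (L u - l0)) y = E P (\<lambda>u. D u * L u - l0 * D u) y"
    by (simp only: right_diff_distrib mult.commute[of _ l0])
  also have "\<dots> = X"
    by (subst E_diff[OF P y]) (auto intro!: tame_mult tame_cmult bdd_tame[OF D] L simp: E_cmult ED X_eq)
  finally have "X\<^sup>2 \<le> W * E P (\<lambda>u. (L u - l0)\<^sup>2) y"
    using E_Cauchy_Schwarz[OF P y bdd_tame[OF D] tL] by (simp add: W_def)
  also have "E P (\<lambda>u. (L u - l0)\<^sup>2) y = var (G P y) (\<lambda>z. \<Sum>i\<in>P. a i * z i)"
  proof -
    have "L (override P z y) = (\<Sum>i\<in>P. a i * z i)" for z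
      unfolding L_def by (intro sum.cong) (auto simp: override_def)
    then show ?thesis unfolding E_def var_def l0_def by simp
  qed
  also have "\<dots> \<le> 1 / \<rho> * (\<Sum>i\<in>P. (a i)\<^sup>2)"
    by (rule poincare_linear[OF finP[OF P] reach_wt[OF y P]])
  also have "(\<Sum>i\<in>P. (a i)\<^sup>2) \<le> m * X"
    unfolding a_def X_def by (rule op)
  finally have "X\<^sup>2 \<le> W * (1 / \<rho> * (m * X))"
    using W0 \<rho>_pos by (simp add: mult_left_mono divide_right_mono)
  then have "X * X \<le> (m / \<rho> * W) * X" by (simp add: power2_eq_square mult_ac)
  moreover have "0 \<le> m / \<rho> * W" using m \<rho>_pos W0 by simp
  ultimately have "X \<le> m / \<rho> * W"
    using X0 mult_right_le_imp_le[of X X "m / \<rho> * W"] by (cases "X > 0") auto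
  then show ?thesis by (simp add: X_def W_def c_def D_def)
qed

text \<open>\<open>lin P j\<close> is unbounded, but the duality bound for the single column
  \<open>T = {j}\<close>, with \<open>m\<close> the sum of its squared entries, controls this
  covariance by the conditional variance of the bounded function \<open>h\<close>.\<close>

lemma bdd_covariance_linear:
  assumes P: "P \<subseteq> V" and h: "bdd h"
  shows "bdd (clin P h j)"
proof -
  have D: "bdd (\<lambda>u. h u - E P h u)" by (intro bdd_arith h bdd_E P)
  define m where "m = (\<Sum>i\<in>P. (M i j)\<^sup>2)"
  have m: "m \<ge> 0" unfolding m_def by (simp add: sum_nonneg)
  obtain B where B: "\<And>y. y \<in> reach \<Longrightarrow> \<bar>E P (\<lambda>u. (h u - E P h u)\<^sup>2) y\<bar> \<le> B"
    using bdd_E[OF bdd_power2[OF D] P] unfolding bdd_def by blast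
  have "\<bar>clin P h j y\<bar> \<le> sqrt (m / \<rho> * B)" if y: "y \<in> reach" for y
  proof (rule real_le_rsqrt)
    have "(clin P h j y)\<^sup>2 \<le> m / \<rho> * E P (\<lambda>u. (h u - E P h u)\<^sup>2) y"
      using sum_covariance_linear[OF P y h m, of "{j}"]
      by (simp add: m_def power_mult_distrib sum_distrib_right)
    also have "\<dots> \<le> m / \<rho> * B"
      using B[OF y] m \<rho>_pos by (intro mult_left_mono) auto
    finally show "\<bar>clin P h j y\<bar>\<^sup>2 \<le> m / \<rho> * B" by simp
  qed
  moreover have "obs (clin P h j)"
    by (intro obs_E tame_obs tame_mult bdd_tame[OF D] tame_lin P)
  ultimately show ?thesis unfolding bdd_def by blast
qed

text \<open>Since \<open>f\<close> depends on the spins in \<open>Q\<close> only, the spin at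
  \<open>j\<close> acts on \<open>E Q f\<close> solely as a boundary spin of the Gibbs measure on
  \<open>Q\<close>.\<close>

lemma has_derivative_E:
  assumes Q: "Q \<subseteq> V" and y: "y \<in> reach" and f: "bdd f" and dep: "depends_on Q f" and j: "j \<notin> Q"
  shows "((\<lambda>t. E Q f (y(j := t))) has_real_derivative
    - 2 * clin Q f j y) (at (y j))"
proof -
  note tf = bdd_tame[OF f] and tE = bdd_tame[OF bdd_E[OF f Q]]
  obtain C K where CK: "\<And>z. \<bar>f (override Q z y)\<bar> \<le> C * exp (K * (l1 Q z))"
    using tame_section_bound[OF tf Q y] by blast
  have "f (override Q z (y(j := t))) = f (override Q z y)" for z t
    using dep unfolding depends_on_def override_def by simp
  then have eq: "E Q f (y(j := t)) = (\<integral>z. f (override Q z y) \<partial>G Q (y(j := t)))" for t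
    unfolding E_def by simp
  have lin: "lin Q j (override Q z y) = (\<Sum>i\<in>Q. M i j * z i)" for z
    unfolding lin_def by (intro sum.cong) (auto simp: override_def)
  have "clin Q f j y = E Q (\<lambda>u. f u * lin Q j u - E Q f u * lin Q j u) y"
    by (simp add: left_diff_distrib)
  also have "\<dots> = E Q (\<lambda>u. f u * lin Q j u) y - E Q f y * E Q (lin Q j) y"
    by (simp add: E_diff[OF Q y tame_mult[OF tf tame_lin[OF Q]] tame_mult[OF tE tame_lin[OF Q]]] E_pull[OF free_E])
  also have "\<dots> = (\<integral>z. f (override Q z y) * (\<Sum>i\<in>Q. M i j * z i) \<partial>G Q y)
      - (\<integral>z. f (override Q z y) \<partial>G Q y) * (\<integral>z. (\<Sum>i\<in>Q. M i j * z i) \<partial>G Q y)"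
    unfolding E_def lin ..
  finally show ?thesis unfolding eq
    using has_derivative_boundary[OF finP[OF Q] j reach_wt[OF y Q] obs_section[OF tame_obs[OF tf] Q y] CK] by simp
qed

text \<open>\<open>E Q f\<close> is constant in the spins of \<open>Q\<close> and has derivative
  \<open>- 2 * clin Q f j\<close> at the other sites. These derivatives are bounded, so the Poincare
  inequality of the whole volume applies; the 4 is the square of the factor
  \<open>- 2\<close>.\<close>

lemma poincare_E:
  assumes Q: "Q \<subseteq> V" and f: "bdd f" and dep: "depends_on Q f"
  shows "E V (\<lambda>u. (E Q f u - E V (E Q f) \<omega>)\<^sup>2) \<omega> \<le>
    4 / \<rho> * E V (\<lambda>y. \<Sum>j\<in>V - Q. (clin Q f j y)\<^sup>2) \<omega>"
proof -
  define c where "c j = clin Q f j" for j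
  have c: "bdd (c j)" for j unfolding c_def by (rule bdd_covariance_linear[OF Q f])
  have F: "bdd (E Q f)" by (rule bdd_E[OF f Q])
  let ?u = "\<lambda>w. E Q f (override V w \<omega>)"
  let ?u' = "\<lambda>j w. if j \<in> Q then 0 else - 2 * c j (override V w \<omega>)"
  have r: "override V w \<omega> \<in> reach" for w by (rule reach_override[OF subset_refl omega_reach])
  have "\<exists>B\<ge>0. \<forall>j\<in>V. \<forall>y\<in>reach. \<bar>c j y\<bar> \<le> B"
  proof -
    obtain B where B: "\<And>j y. y \<in> reach \<Longrightarrow> \<bar>c j y\<bar> \<le> B j" using c unfolding bdd_def by metis
    have B0: "B j \<ge> 0" for j using order_trans[OF abs_ge_zero B[OF omega_reach]] .
    have "\<bar>c j y\<bar> \<le> (\<Sum>j\<in>V. B j)" if "j \<in> V" "y \<in> reach" for j y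
      by (rule order_trans[OF B[OF that(2), of j] member_le_sum[where f = B, OF that(1) B0 fin]])
    moreover have "(\<Sum>j\<in>V. B j) \<ge> 0" using B0 by (simp add: sum_nonneg)
    ultimately show ?thesis by blast
  qed
  then obtain B where B: "B \<ge> 0" "\<And>j y. j \<in> V \<Longrightarrow> y \<in> reach \<Longrightarrow> \<bar>c j y\<bar> \<le> B" by blast
  obtain B' where B': "\<And>y. y \<in> reach \<Longrightarrow> \<bar>E Q f y\<bar> \<le> B'" using F unfolding bdd_def by blast
  have B'0: "B' \<ge> 0" using order_trans[OF abs_ge_zero B'[OF omega_reach]] .
  have "H1_with_gradient V (G V \<omega>) ?u ?u'"
  proof (rule H1_of_classical[OF fin, where C = "2 * B + B'"])
    show "?u \<in> meas V" using bdd_obs[OF F] by (simp add: obs_def)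
    show "?u' j \<in> meas V" for j using bdd_obs[OF c[of j]] by (simp add: obs_def)
    fix x :: "'a \<Rightarrow> real"
    have "\<bar>?u x\<bar> \<le> 2 * B + B'" using B'[OF r, of x] B(1) by linarith
    also have "\<dots> \<le> (2 * B + B') * (1 + (l1 V x))"
      using B(1) B'0 by (intro mult_le_cancel_left1[THEN iffD2]) (auto simp: sum_nonneg)
    finally show "\<bar>?u x\<bar> \<le> (2 * B + B') * (1 + (l1 V x))" .
    fix j assume j: "j \<in> V"
    show "\<bar>?u' j x\<bar> \<le> 2 * B + B'" using B(2)[OF j r, of x] B(1) B'0 by auto
    have o: "override V (x(j := t)) \<omega> = (override V x \<omega>)(j := t)" for t
      using j by (auto simp: override_def)
    show "((\<lambda>t. ?u (x(j := t))) has_real_derivative ?u' j x) (at (x j))"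
    proof (cases "j \<in> Q")
      case True
      have "?u (x(j := t)) = ?u x" for t
      proof -
        have "(override V x \<omega>)(j := t) = override Q ((override V x \<omega>)(j := t)) (override V x \<omega>)"
          using True by (auto simp: override_def)
        then have "E Q f ((override V x \<omega>)(j := t)) = E Q f (override Q ((override V x \<omega>)(j := t)) (override V x \<omega>))"
          by (rule arg_cong)
        then show ?thesis using free_E[of Q f] by (simp only: o free_of_def)
      qed
      then show ?thesis using True by simp
    next
      case False
      have "override V x \<omega> j = x j" using j by (simp add: override_def)
      with has_derivative_E[OF Q r f dep False, of x] False show ?thesis
        unfolding o c_def by simp
    qed
  qed
  from poincare[OF fin wt this]
  have "E V (\<lambda>u. (E Q f u - E V (E Q f) \<omega>)\<^sup>2) \<omega> \<le> 1 / \<rho> * (\<integral>x. (\<Sum>j\<in>V. (?u' j x)\<^sup>2) \<partial>G V \<omega>)"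
    unfolding var_def E_def[of V] by simp
  also have "(\<lambda>x. \<Sum>j\<in>V. (?u' j x)\<^sup>2) = (\<lambda>x. 4 * (\<Sum>j\<in>V - Q. (c j (override V x \<omega>))\<^sup>2))"
  proof
    fix x
    have "(\<Sum>j\<in>V. (?u' j x)\<^sup>2) = (\<Sum>j\<in>V - Q. (?u' j x)\<^sup>2)"
      by (rule sum.mono_neutral_right[OF fin]) auto
    then show "(\<Sum>j\<in>V. (?u' j x)\<^sup>2) = 4 * (\<Sum>j\<in>V - Q. (c j (override V x \<omega>))\<^sup>2)"
      by (simp add: sum_distrib_left power_mult_distrib)
  qed
  also have "1 / \<rho> * (\<integral>x. 4 * (\<Sum>j\<in>V - Q. (c j (override V x \<omega>))\<^sup>2) \<partial>G V \<omega>) =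
      4 / \<rho> * E V (\<lambda>y. \<Sum>j\<in>V - Q. (c j y)\<^sup>2) \<omega>"
    unfolding E_def[of V] by simp
  finally show ?thesis unfolding c_def .
qed

text \<open>Pythagoras for the projection \<open>E P\<close>: pulling the factor
  \<open>E P h\<close> out of \<open>E P\<close> turns the mixed term into the second moment of
  \<open>E P h\<close>.\<close>

lemma E_residual:
  assumes PQ: "P \<subseteq> Q" and Q: "Q \<subseteq> V" and y: "y \<in> reach" and h: "bdd h"
  shows "E Q (\<lambda>u. (h u - E P h u)\<^sup>2) y = E Q (\<lambda>u. (h u)\<^sup>2) y - E Q (\<lambda>u. (E P h u)\<^sup>2) y"
proof -
  have P: "P \<subseteq> V" using PQ Q by auto
  have Eh: "bdd (E P h)" by (rule bdd_E[OF h P])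
  note tame = bdd_tame[OF bdd_power2[OF h]] bdd_tame[OF bdd_power2[OF Eh]] bdd_tame[OF bdd_arith(4)[OF Eh h]]
  have "E Q (E P (\<lambda>u. E P h u * h u)) y = E Q (\<lambda>u. E P h u * h u) y"
    by (intro E_tower[OF PQ Q y tame(3)] bdd_tame[OF bdd_E[OF bdd_arith(4)[OF Eh h] P]])
  then have cross: "E Q (\<lambda>u. E P h u * h u) y = E Q (\<lambda>u. (E P h u)\<^sup>2) y"
  proof -
    have "E P (\<lambda>u. E P h u * h u) = (\<lambda>u. E P h u * E P h u)"
      by (intro ext E_pull free_E)
    moreover assume "E Q (E P (\<lambda>u. E P h u * h u)) y = E Q (\<lambda>u. E P h u * h u) y"
    ultimately show ?thesis by (simp add: power2_eq_square)
  qed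
  have "E Q (\<lambda>u. (h u - E P h u)\<^sup>2) y = E Q (\<lambda>u. ((h u)\<^sup>2 + (E P h u)\<^sup>2) - 2 * (E P h u * h u)) y"
    by (simp add: power2_diff mult_ac)
  also have "\<dots> = E Q (\<lambda>u. (h u)\<^sup>2) y + E Q (\<lambda>u. (E P h u)\<^sup>2) y - 2 * E Q (\<lambda>u. E P h u * h u) y"
    by (simp only: E_diff[OF Q y tame_add[OF tame(1,2)] tame_cmult[OF tame(3)]] E_add[OF Q y tame(1,2)] E_cmult)
  finally show ?thesis using cross by simp
qed

section \<open>Variance in the whole volume and the hole-filling step\<close>

definition Var :: "(('a \<Rightarrow> real) \<Rightarrow> real) \<Rightarrow> real"
  where "Var h = E V (\<lambda>u. (h u)\<^sup>2) \<omega> - (E V h \<omega>)\<^sup>2"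

lemma Var_eq:
  assumes h: "tame h"
  shows "Var h = E V (\<lambda>u. (h u - E V h \<omega>)\<^sup>2) \<omega>"
proof -
  let ?a = "E V h \<omega>"
  have "E V (\<lambda>u. (h u - ?a)\<^sup>2) \<omega> = E V (\<lambda>u. ((h u)\<^sup>2 + ?a\<^sup>2) - (2 * ?a) * h u) \<omega>"
    by (simp add: power2_diff mult_ac)
  also have "\<dots> = E V (\<lambda>u. (h u)\<^sup>2) \<omega> + ?a\<^sup>2 - (2 * ?a) * ?a"
    by (simp only: E_diff[OF subset_refl omega_reach tame_add[OF tame_power2[OF h] tame_const] tame_cmult[OF h]]
        E_add[OF subset_refl omega_reach tame_power2[OF h] tame_const] E_cmult E_const[OF subset_refl])
  finally show ?thesis unfolding Var_def by (simp add: power2_eq_square)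
qed

lemma Var_nonneg: "tame h \<Longrightarrow> Var h \<ge> 0"
  unfolding Var_eq by (intro E_nonneg[OF subset_refl omega_reach]) auto

lemma E_E: "bdd h \<Longrightarrow> P \<subseteq> V \<Longrightarrow> E V (E P h) \<omega> = E V h \<omega>"
  by (intro E_tower[OF _ subset_refl omega_reach] bdd_tame bdd_E)

text \<open>The law of total variance: averaging over \<open>P\<close> lowers the variance by
  exactly the mean square of what it removes.\<close>

lemma Var_residual:
  assumes "P \<subseteq> V" "bdd h"
  shows "E V (\<lambda>u. (h u - E P h u)\<^sup>2) \<omega> = Var h - Var (E P h)"
  unfolding Var_def using E_residual[OF assms(1) subset_refl omega_reach assms(2)] E_E[OF assms(2,1)] by simp

text \<open>\<open>m\<close> measures the coupling of all of \<open>Q\<close> to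
  \<open>V - Q\<close> and multiplies the variance lost between \<open>P\<close> and
  \<open>Q\<close>; \<open>k\<close> measures the coupling of \<open>P\<close> to
  \<open>V - Q\<close>, across the layer \<open>Q - P\<close>, and multiplies \<open>Var f\<close>.
  The constant is \<open>4 / \<rho>\<close> from \<open>poincare_E\<close>, times 2 from splitting a
  square, times \<open>1 / \<rho>\<close> from the duality bound.\<close>

lemma Var_step:
  assumes PQ: "P \<subseteq> Q" and Q: "Q \<subseteq> V" and f: "bdd f" and dep: "depends_on P f"
    and m: "m \<ge> 0" "k \<ge> 0"
    and opm: "\<And>v. (\<Sum>i\<in>Q. (\<Sum>j\<in>V - Q. M i j * v j)\<^sup>2) \<le> m * (\<Sum>j\<in>V - Q. (v j)\<^sup>2)"
    and opk: "\<And>v. (\<Sum>i\<in>P. (\<Sum>j\<in>V - Q. M i j * v j)\<^sup>2) \<le> k * (\<Sum>j\<in>V - Q. (v j)\<^sup>2)"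
  shows "Var (E Q f) \<le> 8 / \<rho>\<^sup>2 * (m * (Var (E P f) - Var (E Q f)) + k * Var f)"
proof -
  have P: "P \<subseteq> V" using PQ Q by auto
  have FP: "bdd (E P f)" and FQ: "bdd (E Q f)" using bdd_E[OF f] P Q by auto
  define D where "D u = f u - E P f u" for u
  have D: "bdd D" unfolding D_def[abs_def] by (intro bdd_arith f FP)
  define H where "H u = E P f u - E Q (E P f) u" for u
  have H: "bdd H" unfolding H_def[abs_def] by (intro bdd_arith FP bdd_E Q)
  have EQP: "E Q (E P f) y = E Q f y" if "y \<in> reach" for y
    by (rule E_tower[OF PQ Q that bdd_tame[OF f] bdd_tame[OF FP]])
  define a where "a j = E P (\<lambda>u. D u * lin P j u)" for j
  have a: "bdd (a j)" for j unfolding a_def D_def by (rule bdd_covariance_linear[OF P f])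
  \<comment> \<open>Here \<open>f - E Q f = D + H\<close> and
    \<open>lin Q j = lin P j + lin (Q - P) j\<close>. The product of \<open>D\<close> with
    \<open>lin (Q - P) j\<close> has mean zero: the latter is a constant for \<open>E P\<close>,
    under which \<open>D\<close> is centred. So \<open>D\<close> is paired with the spins of
    \<open>P\<close> only.\<close>
  have split: "clin Q f j y = E Q (a j) y + E Q (\<lambda>u. H u * lin Q j u) y"
    if y: "y \<in> reach" for j y
  proof -
    note t = tame_mult[OF bdd_tame[OF D] tame_lin[OF P]] tame_mult[OF tame_lin bdd_tame[OF D]]
      tame_mult[OF bdd_tame[OF H] tame_lin[OF Q]]
    have R: "Q - P \<subseteq> V" using Q by auto
    have lin: "lin Q j u = lin P j u + lin (Q - P) j u" for u
      unfolding lin_def using sum.subset_diff[OF PQ finP[OF Q], of "\<lambda>i. M i j * u i"] by simp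
    have "clin Q f j y =
        E Q (\<lambda>u. (D u * lin P j u + lin (Q - P) j u * D u) + H u * lin Q j u) y"
      by (intro E_cong[OF Q y]) (simp add: lin D_def H_def EQP algebra_simps)
    also have "\<dots> = E Q (\<lambda>u. D u * lin P j u) y + E Q (\<lambda>u. lin (Q - P) j u * D u) y + E Q (\<lambda>u. H u * lin Q j u) y"
      by (simp only: E_add[OF Q y tame_add[OF t(1) t(2)[OF R]] t(3)] E_add[OF Q y t(1) t(2)[OF R]])
    also have "E Q (\<lambda>u. D u * lin P j u) y = E Q (a j) y"
      unfolding a_def by (rule E_tower[OF PQ Q y t(1), symmetric]) (rule bdd_tame[OF a[unfolded a_def]])
    also have "E Q (\<lambda>u. lin (Q - P) j u * D u) y = E Q (E P (\<lambda>u. lin (Q - P) j u * D u)) y"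
    proof (rule E_tower[OF PQ Q y t(2)[OF R], symmetric])
      have "E P (\<lambda>u. lin (Q - P) j u * D u) = (\<lambda>u. lin (Q - P) j u * E P D u)"
        by (intro ext E_pull free_lin)
      then show "tame (E P (\<lambda>u. lin (Q - P) j u * D u))"
        using tame_mult[OF tame_lin[OF R] bdd_tame[OF bdd_E[OF D P]]] by simp
    qed
    also have "\<dots> = E Q (\<lambda>_. 0) y"
      using E_centered[OF P _ f] by (intro E_cong[OF Q y]) (simp add: E_pull[OF free_lin] D_def[abs_def])
    finally show ?thesis by (simp add: E_const[OF Q])
  qed
  have bound: "(\<Sum>j\<in>V - Q. (clin Q f j y)\<^sup>2) \<le>
      2 * (k / \<rho>) * E Q (\<lambda>u. (D u)\<^sup>2) y + 2 * (m / \<rho>) * E Q (\<lambda>u. (H u)\<^sup>2) y" if y: "y \<in> reach" for y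
  proof -
    \<comment> \<open>Jensen moves the square inside \<open>E Q\<close>, so that duality can be used
      in the conditional measures on \<open>P\<close>, where the operator bound is \<open>k\<close>;
      the tower property then leads back to \<open>E Q\<close>.\<close>
    have "(\<Sum>j\<in>V - Q. (E Q (a j) y)\<^sup>2) \<le> (\<Sum>j\<in>V - Q. E Q (\<lambda>u. (a j u)\<^sup>2) y)"
      by (intro sum_mono E_Jensen Q y bdd_tame a)
    also have "\<dots> = E Q (\<lambda>u. \<Sum>j\<in>V - Q. (a j u)\<^sup>2) y"
      by (intro E_sum[symmetric] Q y bdd_tame bdd_power2 a)
    also have "\<dots> \<le> E Q (\<lambda>u. k / \<rho> * E P (\<lambda>u. (D u)\<^sup>2) u) y"
    proof (rule E_mono[OF Q y])
      show "tame (\<lambda>u. \<Sum>j\<in>V - Q. (a j u)\<^sup>2)" by (intro bdd_tame bdd_sum bdd_power2 a)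
      show "tame (\<lambda>u. k / \<rho> * E P (\<lambda>u. (D u)\<^sup>2) u)"
        by (rule tame_cmult[OF bdd_tame[OF bdd_E[OF bdd_power2[OF D] P]]])
      show "(\<Sum>j\<in>V - Q. (a j u)\<^sup>2) \<le> k / \<rho> * E P (\<lambda>u. (D u)\<^sup>2) u" if "u \<in> reach" for u
        unfolding a_def D_def by (rule sum_covariance_linear[OF P that f m(2) opk])
    qed
    also have "\<dots> = k / \<rho> * E Q (\<lambda>u. (D u)\<^sup>2) y"
      unfolding E_cmult
      by (subst E_tower[OF PQ Q y bdd_tame[OF bdd_power2[OF D]] bdd_tame[OF bdd_E[OF bdd_power2[OF D] P]]]) simp
    finally have 1: "(\<Sum>j\<in>V - Q. (E Q (a j) y)\<^sup>2) \<le> k / \<rho> * E Q (\<lambda>u. (D u)\<^sup>2) y" .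
    have 2: "(\<Sum>j\<in>V - Q. (E Q (\<lambda>u. H u * lin Q j u) y)\<^sup>2) \<le> m / \<rho> * E Q (\<lambda>u. (H u)\<^sup>2) y"
      unfolding H_def by (rule sum_covariance_linear[OF Q y FP m(1) opm])
    have "(\<Sum>j\<in>V - Q. (clin Q f j y)\<^sup>2) \<le>
        (\<Sum>j\<in>V - Q. 2 * (E Q (a j) y)\<^sup>2 + 2 * (E Q (\<lambda>u. H u * lin Q j u) y)\<^sup>2)"
    proof (rule sum_mono)
      fix j
      have "(x + y)\<^sup>2 \<le> 2 * x\<^sup>2 + 2 * y\<^sup>2" for x y :: real
        using sum_squares_ge_zero[of "x - y" 0] by (simp add: power2_eq_square algebra_simps)
      then show "(clin Q f j y)\<^sup>2 \<le> 2 * (E Q (a j) y)\<^sup>2 + 2 * (E Q (\<lambda>u. H u * lin Q j u) y)\<^sup>2"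
        unfolding split[OF y] .
    qed
    also have "\<dots> = 2 * (\<Sum>j\<in>V - Q. (E Q (a j) y)\<^sup>2) + 2 * (\<Sum>j\<in>V - Q. (E Q (\<lambda>u. H u * lin Q j u) y)\<^sup>2)"
      by (simp add: sum.distrib sum_distrib_left)
    finally show ?thesis using 1 2 by linarith
  qed
  have tower: "E V (E Q (\<lambda>u. (h u)\<^sup>2)) \<omega> = E V (\<lambda>u. (h u)\<^sup>2) \<omega>" if "bdd h" for h
    by (rule E_E[OF bdd_power2[OF that] Q])
  have "Var (E Q f) \<le> 4 / \<rho> * E V (\<lambda>y. \<Sum>j\<in>V - Q. (clin Q f j y)\<^sup>2) \<omega>"
    unfolding Var_eq[OF bdd_tame[OF FQ]] by (rule poincare_E[OF Q f depends_on_mono[OF dep PQ]])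
  also have "\<dots> \<le> 4 / \<rho> * E V (\<lambda>y. 2 * (k / \<rho>) * E Q (\<lambda>u. (D u)\<^sup>2) y + 2 * (m / \<rho>) * E Q (\<lambda>u. (H u)\<^sup>2) y) \<omega>"
  proof (rule mult_left_mono)
    note b = bdd_E[OF bdd_power2[OF D] Q] bdd_E[OF bdd_power2[OF H] Q]
    show "E V (\<lambda>y. \<Sum>j\<in>V - Q. (clin Q f j y)\<^sup>2) \<omega> \<le>
      E V (\<lambda>y. 2 * (k / \<rho>) * E Q (\<lambda>u. (D u)\<^sup>2) y + 2 * (m / \<rho>) * E Q (\<lambda>u. (H u)\<^sup>2) y) \<omega>"
    proof (rule E_mono[OF subset_refl omega_reach _ _ bound])
      show "tame (\<lambda>y. \<Sum>j\<in>V - Q. (clin Q f j y)\<^sup>2)"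
        by (rule bdd_tame[OF bdd_sum[OF bdd_power2[OF bdd_covariance_linear[OF Q f]]]])
      show "tame (\<lambda>y. 2 * (k / \<rho>) * E Q (\<lambda>u. (D u)\<^sup>2) y + 2 * (m / \<rho>) * E Q (\<lambda>u. (H u)\<^sup>2) y)"
        by (rule tame_add[OF tame_cmult[OF bdd_tame[OF b(1)]] tame_cmult[OF bdd_tame[OF b(2)]]])
    qed
  qed (use \<rho>_pos in simp)
  also have "E V (\<lambda>y. 2 * (k / \<rho>) * E Q (\<lambda>u. (D u)\<^sup>2) y + 2 * (m / \<rho>) * E Q (\<lambda>u. (H u)\<^sup>2) y) \<omega> =
      2 * (k / \<rho>) * E V (\<lambda>u. (D u)\<^sup>2) \<omega> + 2 * (m / \<rho>) * E V (\<lambda>u. (H u)\<^sup>2) \<omega>"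
    by (simp only: E_add[OF subset_refl omega_reach tame_cmult[OF bdd_tame[OF bdd_E[OF bdd_power2[OF D] Q]]]
          tame_cmult[OF bdd_tame[OF bdd_E[OF bdd_power2[OF H] Q]]]] E_cmult tower[OF D] tower[OF H])
  also have "E V (\<lambda>u. (H u)\<^sup>2) \<omega> = Var (E P f) - Var (E Q f)"
  proof -
    have "E V (\<lambda>u. (H u)\<^sup>2) \<omega> = Var (E P f) - Var (E Q (E P f))"
      unfolding H_def by (rule Var_residual[OF Q FP])
    also have "Var (E Q (E P f)) = Var (E Q f)"
    proof -
      have "E V (\<lambda>u. (E Q (E P f) u)\<^sup>2) \<omega> = E V (\<lambda>u. (E Q f u)\<^sup>2) \<omega>"
        by (rule E_cong[OF subset_refl omega_reach]) (simp only: EQP)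
      moreover have "E V (E Q (E P f)) \<omega> = E V (E Q f) \<omega>"
        by (rule E_cong[OF subset_refl omega_reach EQP])
      ultimately show ?thesis unfolding Var_def by (simp only:)
    qed
    finally show ?thesis .
  qed
  also have "E V (\<lambda>u. (D u)\<^sup>2) \<omega> = Var f - Var (E P f)"
    unfolding D_def by (rule Var_residual[OF P f])
  \<comment> \<open>Discarding \<open>Var (E P f)\<close> makes the error a multiple of
    \<open>Var f\<close>, which stays fixed during the iteration.\<close>
  also have "4 / \<rho> * (2 * (k / \<rho>) * (Var f - Var (E P f)) + 2 * (m / \<rho>) * (Var (E P f) - Var (E Q f))) \<le>
      4 / \<rho> * (2 * (k / \<rho>) * Var f + 2 * (m / \<rho>) * (Var (E P f) - Var (E Q f)))"
    using Var_nonneg[OF bdd_tame[OF FP]] \<rho>_pos m by (intro mult_left_mono add_right_mono) auto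
  also have "\<dots> = 8 / \<rho>\<^sup>2 * (m * (Var (E P f) - Var (E Q f)) + k * Var f)"
    using \<rho>_pos by (simp add: power2_eq_square field_simps)
  finally show ?thesis .
qed

lemma covariance_bound_Var:
  assumes P: "P \<subseteq> V" and f: "bdd f" and g: "bdd g" and free: "free_of P g"
  shows "(E V (\<lambda>u. f u * g u) \<omega> - E V f \<omega> * E V g \<omega>)\<^sup>2 \<le> Var (E P f) * Var g"
proof -
  note refl' = subset_refl[of V]
  have F: "bdd (E P f)" by (rule bdd_E[OF f P])
  let ?a = "E V f \<omega>" and ?b = "E V g \<omega>"
  have "E V (\<lambda>u. g u * f u) \<omega> = E V (E P (\<lambda>u. g u * f u)) \<omega>"
    by (rule E_E[OF bdd_arith(4)[OF g f] P, symmetric])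
  also have "E P (\<lambda>u. g u * f u) = (\<lambda>u. g u * E P f u)" by (intro ext E_pull free)
  finally have 1: "E V (\<lambda>u. f u * g u) \<omega> = E V (\<lambda>u. E P f u * g u) \<omega>" by (simp add: mult.commute)
  have "E V (\<lambda>u. (E P f u - ?a) * (g u - ?b)) \<omega> = E V (\<lambda>u. (E P f u * g u - ?b * E P f u) - (?a * g u - ?a * ?b)) \<omega>"
    by (simp add: algebra_simps)
  also have "\<dots> = E V (\<lambda>u. E P f u * g u) \<omega> - ?b * E V (E P f) \<omega> - (?a * ?b - ?a * ?b)"
    by (simp only: E_diff[OF refl' omega_reach] E_cmult E_const[OF refl'] bdd_tame bdd_arith F g)
  also have "\<dots> = E V (\<lambda>u. f u * g u) \<omega> - ?a * ?b" using 1 by (simp add: E_E[OF f P])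
  finally have "(E V (\<lambda>u. f u * g u) \<omega> - ?a * ?b)\<^sup>2 = (E V (\<lambda>u. (E P f u - ?a) * (g u - ?b)) \<omega>)\<^sup>2" by simp
  also have "\<dots> \<le> E V (\<lambda>u. (E P f u - ?a)\<^sup>2) \<omega> * E V (\<lambda>u. (g u - ?b)\<^sup>2) \<omega>"
    by (intro E_Cauchy_Schwarz[OF refl' omega_reach] bdd_tame bdd_arith F g)
  also have "\<dots> = Var (E P f) * Var g"
    using E_E[OF f P] by (simp add: Var_eq bdd_tame F g)
  finally show ?thesis .
qed

text \<open>A step reads \<open>(1 + c) * W \<le> c * V + K * Var f\<close> for consecutive
  variances \<open>V\<close> and \<open>W\<close>, with \<open>K = 8 * k / \<rho>\<^sup>2\<close>.
  Since \<open>c * K + K = (1 + c) * K\<close>, the multiple \<open>K * Var f\<close> is a fixed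
  point of the recursion: errors do not accumulate with the number of layers, while the rest
  contracts by \<open>c / (1 + c)\<close>.\<close>

lemma Var_chain:
  assumes f: "bdd f" and P0: "depends_on (P 0) f"
    and P: "\<And>r. r < n \<Longrightarrow> P r \<subseteq> P (Suc r)" "\<And>r. r \<le> n \<Longrightarrow> P r \<subseteq> V"
    and m: "m \<ge> 0" "k \<ge> 0"
    and opm: "\<And>r v. r < n \<Longrightarrow> (\<Sum>i\<in>P (Suc r). (\<Sum>j\<in>V - P (Suc r). M i j * v j)\<^sup>2) \<le> m * (\<Sum>j\<in>V - P (Suc r). (v j)\<^sup>2)"
    and opk: "\<And>r v. r < n \<Longrightarrow> (\<Sum>i\<in>P r. (\<Sum>j\<in>V - P (Suc r). M i j * v j)\<^sup>2) \<le> k * (\<Sum>j\<in>V - P (Suc r). (v j)\<^sup>2)"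
  defines "c \<equiv> 8 * m / \<rho>\<^sup>2"
  shows "Var (E (P n) f) \<le> ((c / (1 + c)) ^ n + 8 * k / \<rho>\<^sup>2) * Var f"
proof -
  define \<theta> where "\<theta> = c / (1 + c)"
  have c: "c \<ge> 0" unfolding c_def using m by simp
  have \<theta>: "0 \<le> \<theta>" "1 - \<theta> = 1 / (1 + c)" using c by (auto simp: \<theta>_def field_simps)
  define K where "K = 8 * k / \<rho>\<^sup>2"
  have V0: "Var f \<ge> 0" by (rule Var_nonneg[OF bdd_tame[OF f]])
  have dep: "r \<le> n \<Longrightarrow> depends_on (P r) f" for r
  proof (induction r)
    case (Suc r)
    then show ?case using depends_on_mono[of "P r" f "P (Suc r)"] P(1)[of r] by simp
  qed (rule P0)
  have "r \<le> n \<Longrightarrow> Var (E (P r) f) \<le> (\<theta> ^ r + K) * Var f" for r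
  proof (induction r)
    case 0
    have "0 \<le> E V (\<lambda>u. (f u - E (P 0) f u)\<^sup>2) \<omega>"
      by (intro E_nonneg[OF subset_refl omega_reach]) auto
    then have "Var (E (P 0) f) \<le> 1 * Var f" using Var_residual[OF P(2)[of 0] f] by simp
    also have "\<dots> \<le> (\<theta> ^ 0 + K) * Var f"
      using V0 m(2) by (intro mult_right_mono) (auto simp: K_def)
    finally show ?case .
  next
    case (Suc r)
    let ?V = "Var (E (P r) f)" and ?W = "Var (E (P (Suc r)) f)"
    have "?W \<le> 8 / \<rho>\<^sup>2 * (m * (?V - ?W) + k * Var f)"
      by (rule Var_step[OF P(1) P(2) f dep m opm opk]) (use Suc.prems in auto)
    then have "(1 + c) * ?W \<le> c * ?V + K * Var f"
      by (simp add: c_def K_def algebra_simps)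
    also have "c * ?V \<le> c * ((\<theta> ^ r + K) * Var f)"
      using Suc c by (intro mult_left_mono) auto
    also have "c * ((\<theta> ^ r + K) * Var f) + K * Var f = (1 + c) * ((\<theta> ^ Suc r + K) * Var f)"
    proof -
      have "(1 + c) * \<theta> = c" using c by (simp add: \<theta>_def)
      then have "(1 + c) * ((\<theta> ^ Suc r + K) * Var f) = (c * \<theta> ^ r + (1 + c) * K) * Var f"
        by (simp only: power_Suc distrib_left flip: mult.assoc)
      then show ?thesis by (simp add: algebra_simps)
    qed
    finally show ?case using c by simp
  qed
  from this[of n] show ?thesis by (simp add: \<theta>_def K_def)
qed

end

section \<open>Truncation\<close>

text \<open>\<open>support\<close> speaks about changes of one coordinate at a time. As
  \<open>V\<close> is finite, \<open>x\<close> is turned into \<open>y\<close> by changing the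
  coordinates off the support one after another.\<close>

lemma support_eqI:
  assumes fin: "finite V" and x: "x \<in> configs V" and y: "y \<in> configs V"
    and eq: "\<And>i. i \<in> support V f \<Longrightarrow> x i = y i"
  shows "f x = f y"
proof -
  have "S \<subseteq> V - support V f \<Longrightarrow> f (override S y x) = f x" if "finite S" for S
    using that
  proof (induction S rule: finite_induct)
    case (insert i S)
    let ?w = "override S y x"
    have w: "?w \<in> configs V"
      using insert.prems x y by (auto simp: override_def configs_def PiE_def extensional_def)
    have "override (insert i S) y x = ?w(i := y i)" by (auto simp: override_def)
    moreover have "f (?w(i := y i)) = f ?w"
      using insert.prems w unfolding support_def by blast
    ultimately show ?case using insert by (simp only: insert_subset)
  qed (simp add: override_def)
  from this[of "V - support V f"] have "f (override (V - support V f) y x) = f x" using fin by simp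
  moreover have "override (V - support V f) y x = y"
    using x y eq by (fastforce simp: override_def configs_def PiE_def extensional_def)
  ultimately show ?thesis by simp
qed

section \<open>Covariances of square-integrable functions\<close>

lemma (in prob_space) L2_integrable:
  assumes "L2 M f" shows "integrable M f" "integrable M (\<lambda>x. (f x)\<^sup>2)" "f \<in> borel_measurable M"
proof -
  show m: "f \<in> borel_measurable M" and i: "integrable M (\<lambda>x. (f x)\<^sup>2)" using assms by (auto simp: L2_def)
  show "integrable M f" using Cauchy_Schwarz_expectation(1)[OF m, of "\<lambda>_. 1"] i by simp
qed

lemma (in prob_space) covariance_eq:
  assumes "L2 M f" "L2 M g"
  shows "covariance M f g = expectation (\<lambda>x. f x * g x) - expectation f * expectation g"
proof -
  note f = L2_integrable[OF assms(1)] and g = L2_integrable[OF assms(2)]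
  have fg: "integrable M (\<lambda>x. f x * g x)" by (rule Cauchy_Schwarz_expectation(1)[OF f(3) g(3) f(2) g(2)])
  define a b where "a = expectation f" and "b = expectation g"
  have "covariance M f g = expectation (\<lambda>x. f x * g x - b * f x - (a * g x - a * b))"
    unfolding covariance_def a_def[symmetric] b_def[symmetric]
    by (intro Bochner_Integration.integral_cong refl) (simp add: algebra_simps)
  also have "\<dots> = expectation (\<lambda>x. f x * g x) - a * b"
    using f g fg by (simp add: a_def b_def prob_space)
  finally show ?thesis by (simp add: a_def b_def)
qed

lemma var_covariance: "var \<mu> f = covariance \<mu> f f"
  by (simp add: var_def covariance_def power2_eq_square)

lemma var_nonneg: "var \<mu> f \<ge> 0"
  unfolding var_def by (rule integral_nonneg_AE) simp

lemma (in prob_space) L2_const: "L2 M (\<lambda>_. c)"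
  by (simp add: L2_def)

lemma (in prob_space) L2_arith:
  assumes f: "L2 M f" and g: "L2 M g"
  shows "L2 M (\<lambda>x. f x + g x)" "L2 M (\<lambda>x. f x - g x)"
proof -
  note f = L2_integrable[OF f] and g = L2_integrable[OF g]
  have fg: "integrable M (\<lambda>x. f x * g x)" by (rule Cauchy_Schwarz_expectation(1)[OF f(3) g(3) f(2) g(2)])
  have "integrable M (\<lambda>x. (f x)\<^sup>2 + (g x)\<^sup>2 + 2 * (f x * g x))" using f g fg by auto
  then show "L2 M (\<lambda>x. f x + g x)" using f g unfolding L2_def power2_sum mult.assoc by auto
  have "integrable M (\<lambda>x. (f x)\<^sup>2 + (g x)\<^sup>2 - 2 * (f x * g x))" using f g fg by auto
  then show "L2 M (\<lambda>x. f x - g x)" using f g unfolding L2_def power2_diff mult.assoc by auto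
qed

lemma (in prob_space) covariance_Cauchy_Schwarz:
  assumes f: "L2 M f" and g: "L2 M g"
  shows "\<bar>covariance M f g\<bar> \<le> sqrt (var M f) * sqrt (var M g)"
proof -
  note F = L2_integrable[OF L2_arith(2)[OF f L2_const[of "expectation f"]]]
  note G = L2_integrable[OF L2_arith(2)[OF g L2_const[of "expectation g"]]]
  have "(covariance M f g)\<^sup>2 \<le> var M f * var M g"
    unfolding covariance_def var_def by (rule Cauchy_Schwarz_expectation(2)[OF F(3) G(3) F(2) G(2)])
  then have "sqrt ((covariance M f g)\<^sup>2) \<le> sqrt (var M f * var M g)" by (rule real_sqrt_le_mono)
  then show ?thesis by (simp add: real_sqrt_mult)
qed

lemma (in prob_space) covariance_add_right:
  assumes "L2 M f" "L2 M g" "L2 M h"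
  shows "covariance M f (\<lambda>x. g x + h x) = covariance M f g + covariance M f h"
proof -
  note f = L2_integrable[OF assms(1)] and g = L2_integrable[OF assms(2)] and h = L2_integrable[OF assms(3)]
  have "integrable M (\<lambda>x. f x * g x)" "integrable M (\<lambda>x. f x * h x)"
    using Cauchy_Schwarz_expectation(1) f g h by auto
  then show ?thesis
    using f g h by (simp add: covariance_eq assms L2_arith distrib_left)
qed

definition clip :: "nat \<Rightarrow> real \<Rightarrow> real"
  where "clip n t = max (- real n) (min (real n) t)"

lemma clip_bounds: "\<bar>clip n t\<bar> \<le> real n" "\<bar>clip n t\<bar> \<le> \<bar>t\<bar>"
  by (auto simp: clip_def)

lemma clip_tendsto: "(\<lambda>n. clip n t) \<longlonglongrightarrow> t"
proof (rule tendsto_eventually)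
  obtain N :: nat where "\<bar>t\<bar> \<le> real N" using real_arch_simple by blast
  then have "clip n t = t" if "n \<ge> N" for n using that by (auto simp: clip_def max_def min_def)
  then show "\<forall>\<^sub>F n in sequentially. clip n t = t" using eventually_sequentially by blast
qed

lemma measurable_clip: "f \<in> borel_measurable N \<Longrightarrow> (\<lambda>x. clip n (f x)) \<in> borel_measurable N"
  unfolding clip_def by (intro borel_measurable_max borel_measurable_min borel_measurable_const)

lemma (in prob_space) clip_limits:
  assumes f: "L2 M f" and g: "L2 M g"
  shows "(\<lambda>n. expectation (\<lambda>x. clip n (f x))) \<longlonglongrightarrow> expectation f"
    and "(\<lambda>n. expectation (\<lambda>x. clip n (f x) * clip n (g x))) \<longlonglongrightarrow> expectation (\<lambda>x. f x * g x)"
proof -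
  note f = L2_integrable[OF f] and g = L2_integrable[OF g]
  note m = measurable_clip[OF f(3)] measurable_clip[OF g(3)]
  have fg: "integrable M (\<lambda>x. f x * g x)" by (rule Cauchy_Schwarz_expectation(1)[OF f(3) g(3) f(2) g(2)])
  show "(\<lambda>n. expectation (\<lambda>x. clip n (f x))) \<longlonglongrightarrow> expectation f"
    by (rule integral_dominated_convergence[where w = "\<lambda>x. norm (f x)"])
      (use f m clip_bounds(2) in \<open>auto intro: clip_tendsto\<close>)
  show "(\<lambda>n. expectation (\<lambda>x. clip n (f x) * clip n (g x))) \<longlonglongrightarrow> expectation (\<lambda>x. f x * g x)"
  proof (rule integral_dominated_convergence[where w = "\<lambda>x. norm (f x * g x)"])
    show "AE x in M. norm (clip n (f x) * clip n (g x)) \<le> norm (f x * g x)" for n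
      unfolding real_norm_def abs_mult using clip_bounds(2) by (intro AE_I2 mult_mono) auto
  qed (use f g m fg in \<open>auto intro!: tendsto_mult clip_tendsto borel_measurable_times\<close>)
qed

context finite_volume
begin

text \<open>Both sides consist of first and second moments, which converge under clipping by
  dominated convergence, and \<open>K\<close> is the same for all clipping levels.\<close>

lemma covariance_truncation:
  assumes f: "L2 (G V \<omega>) f" and g: "L2 (G V \<omega>) g"
    and mix: "\<And>h k. bdd h \<Longrightarrow> bdd k \<Longrightarrow> depends_on (support V f) h \<Longrightarrow> depends_on (support V g) k \<Longrightarrow>
      (E V (\<lambda>u. h u * k u) \<omega> - E V h \<omega> * E V k \<omega>)\<^sup>2 \<le> K * (Var h * Var k)"
  shows "(cov V \<omega> f g)\<^sup>2 \<le> K * (var (G V \<omega>) f * var (G V \<omega>) g)"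
proof -
  interpret prob_space "G V \<omega>" by (rule prob_space_gibbs[OF fin])
  \<comment> \<open>Only the values of \<open>h\<close> on \<open>configs V\<close> matter. Putting
    0 at the sites of \<open>V\<close> off the support yields a total function that depends on the
    support alone and agrees with \<open>h\<close> on \<open>configs V\<close>, by
    \<open>support_eqI\<close>.\<close>
  define lift where "lift h y = h (\<lambda>i. if i \<in> V then if i \<in> support V h then y i else 0 else undefined)"
    for h :: "('a \<Rightarrow> real) \<Rightarrow> real" and y :: "'a \<Rightarrow> real"
  have lift_eq: "lift h (override V w \<omega>) = h w" if "w \<in> configs V" for h w
    unfolding lift_def
    by (rule support_eqI[OF fin _ that]) (auto simp: configs_def override_def support_def)
  have lift_dep: "depends_on (support V h) (\<lambda>y. clip n (lift h y))" for h n
    unfolding depends_on_def lift_def by (auto intro!: arg_cong[of _ _ h] arg_cong[of _ _ "clip n"])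
  have lift_bdd: "bdd (\<lambda>y. clip n (lift h y))" if "L2 (G V \<omega>) h" for h n
  proof -
    have "(\<lambda>w. clip n (h w)) \<in> meas V"
      using L2_integrable(3)[OF that] by (intro measurable_clip) simp
    then have "(\<lambda>w. clip n (lift h (override V w \<omega>))) \<in> meas V"
      by (rule measurable_cong[THEN iffD1, rotated]) (simp add: lift_eq)
    then show ?thesis unfolding bdd_def obs_def using clip_bounds(1) by blast
  qed
  have E1: "E V (\<lambda>y. F (lift h y) (lift k y)) \<omega> = expectation (\<lambda>w. F (h w) (k w))"
    for F :: "real \<Rightarrow> real \<Rightarrow> real" and h k
    unfolding E_def by (intro Bochner_Integration.integral_cong) (auto simp: lift_eq)
  define c where "c n u v = expectation (\<lambda>w. clip n (u w) * clip n (v w)) - expectation (\<lambda>w. clip n (u w)) * expectation (\<lambda>w. clip n (v w))"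
    for n u v
  have lim: "(\<lambda>n. c n u v) \<longlonglongrightarrow> expectation (\<lambda>w. u w * v w) - expectation u * expectation v"
    if "L2 (G V \<omega>) u" "L2 (G V \<omega>) v" for u v
    unfolding c_def by (intro tendsto_diff tendsto_mult clip_limits[OF that] clip_limits(1)[OF that(2,1)])
  have le: "(c n f g)\<^sup>2 \<le> K * (c n f f * c n g g)" for n
    using mix[OF lift_bdd[OF f] lift_bdd[OF g] lift_dep lift_dep, of n n]
    unfolding Var_def power2_eq_square c_def E1[of "\<lambda>a b. clip n a * clip n b"] E1[of "\<lambda>a b. clip n a"] .
  have "(expectation (\<lambda>w. f w * g w) - expectation f * expectation g)\<^sup>2 \<le>
     K * ((expectation (\<lambda>w. f w * f w) - expectation f * expectation f) * (expectation (\<lambda>w. g w * g w) - expectation g * expectation g))"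
    by (rule LIMSEQ_le[OF tendsto_power[OF lim[OF f g]] tendsto_mult[OF tendsto_const tendsto_mult[OF lim[OF f f] lim[OF g g]]]])
      (use le in blast)
  then show ?thesis
    unfolding var_covariance covariance_eq[OF f g] covariance_eq[OF f f] covariance_eq[OF g g] .
qed

end

section \<open>Sums over the lattice\<close>

lemma abs_component_le_site_norm: "real_of_int \<bar>i $ k\<bar> \<le> site_norm i"
  unfolding site_norm_def of_int_le_iff by (rule Max_ge) auto

lemma site_norm_le_iff: "site_norm i \<le> r \<longleftrightarrow> (\<forall>k. real_of_int \<bar>i $ k\<bar> \<le> r)"
proof
  assume "\<forall>k. real_of_int \<bar>i $ k\<bar> \<le> r"
  moreover have "Max (range (\<lambda>k. \<bar>i $ k\<bar>)) \<in> range (\<lambda>k. \<bar>i $ k\<bar>)" by (rule Max_in) auto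
  then obtain k where "Max (range (\<lambda>k. \<bar>i $ k\<bar>)) = \<bar>i $ k\<bar>" by blast
  ultimately show "site_norm i \<le> r" unfolding site_norm_def by simp
qed (use abs_component_le_site_norm order_trans in blast)

lemma site_norm_nonneg: "site_norm i \<ge> 0"
  by (rule order_trans[OF _ abs_component_le_site_norm]) simp

lemma site_norm_triangle: "site_norm (i - j) \<le> site_norm (i - k) + site_norm (k - j)"
  unfolding site_norm_le_iff
proof
  fix l
  have "\<bar>(i - j) $ l\<bar> \<le> \<bar>(i - k) $ l\<bar> + \<bar>(k - j) $ l\<bar>" by simp
  then have "real_of_int \<bar>(i - j) $ l\<bar> \<le> real_of_int \<bar>(i - k) $ l\<bar> + real_of_int \<bar>(k - j) $ l\<bar>"
    by linarith
  then show "real_of_int \<bar>(i - j) $ l\<bar> \<le> site_norm (i - k) + site_norm (k - j)"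
    using abs_component_le_site_norm[of "i - k" l] abs_component_le_site_norm[of "k - j" l] by linarith
qed

lemma site_norm_minus_commute: "site_norm (i - j) = site_norm (j - i)"
  unfolding site_norm_def by (simp add: abs_minus_commute)

lemma site_norm_zero [simp]: "site_norm 0 = 0"
  unfolding site_norm_def by simp

lemma site_dist_le: "a \<in> A \<Longrightarrow> b \<in> B \<Longrightarrow> site_dist A B \<le> site_norm (a - b)"
  unfolding site_dist_def
  by (rule cINF_lower2[where x = "(a, b)"]) (auto intro!: bdd_belowI2[where m = 0] site_norm_nonneg)

lemma site_dist_greatest:
  "A \<noteq> {} \<Longrightarrow> B \<noteq> {} \<Longrightarrow> (\<And>a b. a \<in> A \<Longrightarrow> b \<in> B \<Longrightarrow> r \<le> site_norm (a - b)) \<Longrightarrow> r \<le> site_dist A B"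
  unfolding site_dist_def by (rule cINF_greatest) auto

lemma site_dist_nonneg: "A \<noteq> {} \<Longrightarrow> B \<noteq> {} \<Longrightarrow> site_dist A B \<ge> 0"
  by (intro site_dist_greatest site_norm_nonneg)

lemma sum_int_powr_bounded:
  assumes "p > (1::real)"
  shows "\<exists>S\<ge>0. \<forall>N. (\<Sum>n\<in>{- int N..int N}. (1 + real_of_int \<bar>n\<bar>) powr (- p)) \<le> S"
proof -
  let ?g = "\<lambda>m::nat. (1 + real m) powr (- p)"
  have "summable (\<lambda>n. real n powr (- p))" using assms by (simp add: summable_real_powr_iff)
  then have "summable (\<lambda>n. real (Suc n) powr (- p))" by (subst summable_Suc_iff)
  then have s: "summable ?g" by (simp add: add.commute)
  have le: "(\<Sum>m\<in>{0..N}. ?g m) \<le> suminf ?g" for N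
    by (rule sum_le_suminf[OF s]) auto
  have "(\<Sum>n\<in>{- int N..int N}. (1 + real_of_int \<bar>n\<bar>) powr (- p)) \<le> 2 * suminf ?g" for N
  proof -
    have "{- int N..int N} \<subseteq> int ` {0..N} \<union> (\<lambda>m. - int m) ` {0..N}"
    proof
      fix n assume n: "n \<in> {- int N..int N}"
      then show "n \<in> int ` {0..N} \<union> (\<lambda>m. - int m) ` {0..N}"
        by (cases "n \<ge> 0") (auto intro: image_eqI[of _ _ "nat n"] image_eqI[of _ _ "nat (- n)"])
    qed
    then have "(\<Sum>n\<in>{- int N..int N}. (1 + real_of_int \<bar>n\<bar>) powr (- p)) \<le>
        (\<Sum>n\<in>int ` {0..N} \<union> (\<lambda>m. - int m) ` {0..N}. (1 + real_of_int \<bar>n\<bar>) powr (- p))"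
      by (intro sum_mono2) auto
    also have "\<dots> \<le> (\<Sum>n\<in>int ` {0..N}. (1 + real_of_int \<bar>n\<bar>) powr (- p)) + (\<Sum>n\<in>(\<lambda>m. - int m) ` {0..N}. (1 + real_of_int \<bar>n\<bar>) powr (- p))"
      by (subst sum_Un) (auto intro!: sum_nonneg)
    also have "\<dots> = (\<Sum>m\<in>{0..N}. ?g m) + (\<Sum>m\<in>{0..N}. ?g m)"
      by (subst (1 2) sum.reindex) (auto simp: inj_on_def)
    finally show ?thesis using le[of N] by linarith
  qed
  moreover have "0 \<le> 2 * suminf ?g" using s by (intro mult_nonneg_nonneg suminf_nonneg) auto
  ultimately show ?thesis by blast
qed

text \<open>The maximum norm dominates every coordinate, so the sum is bounded by a product of
  one-dimensional sums.\<close>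

lemma sum_site_norm_powr_bounded:
  assumes "\<epsilon> > 0"
  shows "\<exists>S>0. \<forall>T :: (int ^ 'd) set. finite T \<longrightarrow>
    (\<Sum>j\<in>T. (1 + site_norm j) powr (- (real CARD('d) + \<epsilon>))) \<le> S"
proof -
  define d where "d = real CARD('d)"
  have d: "d > 0" by (simp add: d_def)
  \<comment> \<open>The exponent is shared equally among the coordinates:
    \<open>d * p = d + \<epsilon>\<close>, and \<open>p > 1\<close> makes each one-dimensional sum
    converge.\<close>
  define p where "p = 1 + \<epsilon> / d"
  have p: "p > 1" using assms d by (simp add: p_def)
  obtain S where S: "S \<ge> 0" "\<And>N. (\<Sum>n\<in>{- int N..int N}. (1 + real_of_int \<bar>n\<bar>) powr (- p)) \<le> S"
    using sum_int_powr_bounded[OF p] by blast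
  \<comment> \<open>The summand 1 makes the constant positive, as \<open>S\<close> is only known to
    be nonnegative.\<close>
  have "(\<Sum>j\<in>T. (1 + site_norm j) powr (- (real CARD('d) + \<epsilon>))) \<le> S ^ CARD('d) + 1"
    if T: "finite T" for T :: "(int ^ 'd) set"
  proof -
    let ?g = "\<lambda>n::int. (1 + real_of_int \<bar>n\<bar>) powr (- p)"
    have "\<exists>N. \<forall>j\<in>T. \<forall>k. \<bar>j $ k\<bar> \<le> int N"
      using T
    proof (induction T rule: finite_induct)
      case (insert j T)
      then obtain N where N: "\<forall>j\<in>T. \<forall>k. \<bar>j $ k\<bar> \<le> int N" by blast
      define N' where "N' = max N (nat (Max (range (\<lambda>k. \<bar>j $ k\<bar>))))"
      have "\<bar>j $ k\<bar> \<le> int N'" for k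
      proof -
        have "\<bar>j $ k\<bar> \<le> Max (range (\<lambda>k. \<bar>j $ k\<bar>))" by (rule Max_ge) auto
        also have "\<dots> \<le> int (nat (Max (range (\<lambda>k. \<bar>j $ k\<bar>))))" by linarith
        also have "\<dots> \<le> int N'" unfolding N'_def of_nat_le_iff by (rule max.cobounded2)
        finally show ?thesis .
      qed
      moreover have "int N \<le> int N'" by (simp add: N'_def)
      with N have "\<forall>j\<in>T. \<forall>k. \<bar>j $ k\<bar> \<le> int N'" by (meson order_trans)
      ultimately show ?case by blast
    qed auto
    then obtain N where N: "\<And>j k. j \<in> T \<Longrightarrow> \<bar>j $ k\<bar> \<le> int N" by blast
    have "(\<Sum>j\<in>T. (1 + site_norm j) powr (- (real CARD('d) + \<epsilon>))) \<le> (\<Sum>j\<in>T. \<Prod>k\<in>UNIV. ?g (j $ k))"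
    proof (rule sum_mono)
      fix j :: "int ^ 'd"
      have pos: "1 + site_norm j > 0" using site_norm_nonneg[of j] by linarith
      have "- (real CARD('d) + \<epsilon>) = real CARD('d) * (- p)" using d by (simp add: p_def d_def field_simps)
      then have "(1 + site_norm j) powr (- (real CARD('d) + \<epsilon>)) = ((1 + site_norm j) powr (- p)) ^ CARD('d)"
        using pos by (simp add: powr_power)
      also have "\<dots> = (\<Prod>k\<in>(UNIV::'d set). (1 + site_norm j) powr (- p))" by simp
      also have "\<dots> \<le> (\<Prod>k\<in>UNIV. ?g (j $ k))"
        using p abs_component_le_site_norm[of j] by (intro prod_mono conjI powr_mono2') auto
      finally show "(1 + site_norm j) powr (- (real CARD('d) + \<epsilon>)) \<le> (\<Prod>k\<in>UNIV. ?g (j $ k))" .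
    qed
    also have "\<dots> = (\<Sum>h\<in>vec_nth ` T. \<Prod>k\<in>UNIV. ?g (h k))"
      by (subst sum.reindex) (auto simp: inj_on_def vec_nth_inject)
    also have "\<dots> \<le> (\<Sum>h\<in>PiE (UNIV :: 'd set) (\<lambda>_. {- int N..int N}). \<Prod>k\<in>UNIV. ?g (h k))"
      using N by (intro sum_mono2) (auto intro!: finite_PiE prod_nonneg simp: abs_le_iff minus_le_iff)
    also have "\<dots> = (\<Prod>k\<in>(UNIV :: 'd set). \<Sum>n\<in>{- int N..int N}. ?g n)"
      by (rule prod_sum_PiE[symmetric]) auto
    also have "\<dots> \<le> S ^ CARD('d)"
      using S(2)[of N] by (simp add: power_mono sum_nonneg)
    finally show ?thesis by simp
  qed
  moreover have "S ^ CARD('d) + 1 > 0" using S(1) by (simp add: add_nonneg_pos)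
  ultimately show ?thesis by blast
qed

text \<open>Writing \<open>\<bar>M i j\<bar>\<close> as the square of its root, Cauchy-Schwarz in
  each row uses the row sums, and exchanging the sums then uses the column sums.\<close>

lemma Schur_test:
  fixes M :: "'i \<Rightarrow> 'j \<Rightarrow> real"
  assumes row: "\<And>i. i \<in> P \<Longrightarrow> (\<Sum>j\<in>T. \<bar>M i j\<bar>) \<le> R" and col: "\<And>j. j \<in> T \<Longrightarrow> (\<Sum>i\<in>P. \<bar>M i j\<bar>) \<le> R"
    and R: "R \<ge> 0"
  shows "(\<Sum>i\<in>P. (\<Sum>j\<in>T. M i j * v j)\<^sup>2) \<le> R\<^sup>2 * (\<Sum>j\<in>T. (v j)\<^sup>2)"
proof -
  have "(\<Sum>i\<in>P. (\<Sum>j\<in>T. M i j * v j)\<^sup>2) \<le> (\<Sum>i\<in>P. R * (\<Sum>j\<in>T. \<bar>M i j\<bar> * (v j)\<^sup>2))"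
  proof (rule sum_mono)
    fix i assume i: "i \<in> P"
    have "\<bar>\<Sum>j\<in>T. M i j * v j\<bar> \<le> (\<Sum>j\<in>T. sqrt \<bar>M i j\<bar> * (sqrt \<bar>M i j\<bar> * \<bar>v j\<bar>))"
      by (rule order_trans[OF sum_abs]) (simp add: abs_mult flip: mult.assoc)
    then have "\<bar>\<Sum>j\<in>T. M i j * v j\<bar>\<^sup>2 \<le> (\<Sum>j\<in>T. sqrt \<bar>M i j\<bar> * (sqrt \<bar>M i j\<bar> * \<bar>v j\<bar>))\<^sup>2"
      by (rule power_mono) simp
    also have "\<dots> \<le> (\<Sum>j\<in>T. (sqrt \<bar>M i j\<bar>)\<^sup>2) * (\<Sum>j\<in>T. (sqrt \<bar>M i j\<bar> * \<bar>v j\<bar>)\<^sup>2)"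
      by (rule Cauchy_Schwarz_ineq_sum)
    also have "\<dots> = (\<Sum>j\<in>T. \<bar>M i j\<bar>) * (\<Sum>j\<in>T. \<bar>M i j\<bar> * (v j)\<^sup>2)"
      by (simp add: power_mult_distrib)
    also have "\<dots> \<le> R * (\<Sum>j\<in>T. \<bar>M i j\<bar> * (v j)\<^sup>2)"
      using row[OF i] by (intro mult_right_mono) (auto intro!: sum_nonneg)
    finally show "(\<Sum>j\<in>T. M i j * v j)\<^sup>2 \<le> R * (\<Sum>j\<in>T. \<bar>M i j\<bar> * (v j)\<^sup>2)" by simp
  qed
  also have "\<dots> = R * (\<Sum>j\<in>T. (\<Sum>i\<in>P. \<bar>M i j\<bar>) * (v j)\<^sup>2)"
    by (subst sum_distrib_left[symmetric], subst sum.swap) (simp add: sum_distrib_right)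
  also have "\<dots> \<le> R * (\<Sum>j\<in>T. R * (v j)\<^sup>2)"
    using R col by (intro mult_left_mono sum_mono mult_right_mono) auto
  also have "\<dots> = R\<^sup>2 * (\<Sum>j\<in>T. (v j)\<^sup>2)" by (simp add: power2_eq_square sum_distrib_left mult.assoc)
  finally show ?thesis .
qed

text \<open>The inequality \<open>ln x \<le> x - 1\<close> at \<open>x = \<kappa> * u / q\<close>;
  the resulting constant is \<open>(q / \<kappa>) powr q\<close>.\<close>

lemma exp_decay_le_powr:
  assumes "\<kappa> > 0" "q > 0"
  shows "\<exists>K>0. \<forall>u>0. exp (- \<kappa> * u) \<le> K * u powr (- q :: real)"
proof (intro exI conjI allI impI)
  fix u :: real assume u: "u > 0"
  have "ln (\<kappa> * u / q) \<le> \<kappa> * u / q - 1" using assms u by (intro ln_le_minus_one) auto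
  then have "q * ln (\<kappa> * u / q) \<le> \<kappa> * u"
    using assms by (simp add: field_simps)
  moreover have "ln u = ln (\<kappa> * u / q) + ln (q / \<kappa>)"
    using assms u by (simp add: ln_div ln_mult)
  ultimately have "q * ln u \<le> \<kappa> * u + q * ln (q / \<kappa>)" by (simp add: distrib_left)
  then have "exp (- \<kappa> * u) \<le> exp (q * ln (q / \<kappa>) + - q * ln u)" by simp
  also have "\<dots> = exp (q * ln (q / \<kappa>)) * u powr (- q)" using u by (simp add: powr_def mult_exp_exp)
  finally show "exp (- \<kappa> * u) \<le> exp (q * ln (q / \<kappa>)) * u powr (- q)" .
qed simp

text \<open>About \<open>D powr y\<close> layers of width about \<open>D powr (1 - y)\<close> fit into a distance \<open>D\<close>; the small
  loss \<open>y\<close> in the width is paid for by the margin between \<open>3 * a / 4\<close> and \<open>a / 2\<close>.\<close>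

lemma layer_choice:
  fixes \<theta> K d a :: real
  assumes \<theta>: "0 \<le> \<theta>" "\<theta> < 1" and K: "K \<ge> 0" and d: "d > 0" and a: "a > 0"
  shows "\<exists>C>0. \<forall>L>0. \<exists>n w. w \<ge> 0 \<and> real n * w < L \<and>
    \<theta> ^ n + K * (1 + w) powr (- 2 * (d + 3 * a / 4)) \<le> C * (1 + L) powr (- 2 * (d + a / 2))"
proof -
  define q p where "q = 2 * (d + 3 * a / 4)" and "p = 2 * (d + a / 2)"
  \<comment> \<open>Determined by \<open>(1 - y) * q = p\<close>: a width of order
    \<open>D powr (1 - y)\<close> uses up exactly the margin \<open>q - p = a / 2\<close>.\<close>
  define y where "y = (a / 4) / (d + 3 * a / 4)"
  have q: "q > 0" and p: "p > 0" using d a by (auto simp: q_def p_def add_pos_pos)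
  have y: "y > 0" using d a by (simp add: y_def add_pos_pos)
  have yq: "(1 - y) * q = p"
  proof -
    have "y * q = a / 2" using d a by (simp add: y_def q_def field_simps add_pos_pos less_imp_neq[THEN not_sym])
    then show ?thesis by (simp add: p_def q_def left_diff_distrib)
  qed
  \<comment> \<open>Raised to at least \<open>1 / 2\<close> so that \<open>- ln \<theta>'\<close> is
    a meaningful rate even if \<open>\<theta> = 0\<close>.\<close>
  define \<theta>' where "\<theta>' = max \<theta> (1 / 2)"
  have \<theta>': "0 < \<theta>'" "\<theta>' < 1" "\<theta> \<le> \<theta>'" using \<theta> by (auto simp: \<theta>'_def)
  define \<kappa> where "\<kappa> = - ln \<theta>'"
  have \<kappa>: "\<kappa> > 0" using \<theta>' by (simp add: \<kappa>_def)
  obtain K2 where K2: "K2 > 0" "\<And>u. u > 0 \<Longrightarrow> exp (- \<kappa> * u) \<le> K2 * u powr (- (p / y))"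
    using exp_decay_le_powr[OF \<kappa>, of "p / y"] p y by auto
  define C where "C = K2 + K * 3 powr q"
  have C: "C > 0" using K2 K by (simp add: C_def add_pos_nonneg)
  have "\<exists>n w. w \<ge> 0 \<and> real n * w < L \<and> \<theta> ^ n + K * (1 + w) powr (- q) \<le> C * (1 + L) powr (- p)"
    if L: "L > 0" for L
  proof -
    define D where "D = 1 + L"
    have D: "D > 1" using L by (simp add: D_def)
    define n where "n = nat \<lceil>D powr y\<rceil>"
    \<comment> \<open>Dividing by \<open>real n + 1\<close> rather than \<open>real n\<close> makes
      \<open>real n * w < L\<close> strict. Moreover \<open>real n + 1 \<le> 3 * D powr y\<close>,
      which is the origin of the factor \<open>3 powr q\<close> in \<open>C\<close>.\<close>
    define w where "w = L / (real n + 1)"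
    have Dy: "D powr y \<ge> 1" using D y by (simp add: ge_one_powr_ge_zero)
    have n1: "D powr y \<le> real n" unfolding n_def by (rule real_nat_ceiling_ge)
    have n2: "real n \<le> D powr y + 1"
    proof -
      have "real n = of_int \<lceil>D powr y\<rceil>" using Dy by (simp add: n_def)
      then show ?thesis using of_int_ceiling_le_add_one[of "D powr y"] by linarith
    qed
    have w: "w \<ge> 0" "real n * w < L" using L by (auto simp: w_def field_simps)
    have "\<theta> ^ n \<le> \<theta>' ^ n" using \<theta> \<theta>' by (intro power_mono) auto
    also have "\<dots> = exp (- \<kappa> * real n)" using \<theta>' by (simp add: \<kappa>_def exp_of_nat2_mult)
    also have "\<dots> \<le> exp (- \<kappa> * D powr y)" using n1 \<kappa> by simp
    also have "\<dots> \<le> K2 * (D powr y) powr (- (p / y))" using D by (intro K2) simp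
    also have "(D powr y) powr (- (p / y)) = D powr (- p)" using y by (simp add: powr_powr)
    finally have 1: "\<theta> ^ n \<le> K2 * D powr (- p)" .
    have "D powr (1 - y) / 3 = D / (3 * D powr y)" using D by (simp add: powr_diff)
    also have "\<dots> \<le> D / (real n + 1)"
      using D n2 Dy by (intro divide_left_mono) auto
    also have "\<dots> \<le> 1 + w"
      using L by (simp add: w_def D_def field_simps)
    finally have "(1 + w) powr (- q) \<le> (D powr (1 - y) / 3) powr (- q)"
      using q D by (intro powr_mono2') auto
    also have "\<dots> = 3 powr q * D powr (- p)"
    proof -
      have "(1 - y) * (- q) = - p" using yq by simp
      then have "(D powr (1 - y)) powr (- q) = D powr (- p)" by (simp only: powr_powr)
      moreover have "(D powr (1 - y) / 3) powr (- q) = (D powr (1 - y)) powr (- q) / 3 powr (- q)"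
        by (rule powr_divide)
      moreover have "inverse (3 powr (- q)) = 3 powr q" by (simp only: powr_minus inverse_inverse_eq)
      ultimately show ?thesis by (simp only: divide_inverse mult.commute)
    qed
    finally have "K * (1 + w) powr (- q) \<le> K * (3 powr q * D powr (- p))"
      using K by (rule mult_left_mono)
    with 1 have "\<theta> ^ n + K * (1 + w) powr (- q) \<le> C * D powr (- p)"
      by (simp add: C_def algebra_simps)
    with w show ?thesis unfolding D_def by blast
  qed
  with C show ?thesis by (auto simp: q_def p_def)
qed

section \<open>Smooth functions\<close>

lemma smooth_partial_deriv:
  assumes "smooth P f" "i \<in> P" "x \<in> configs P"
  shows "((\<lambda>t. f (x(i := t))) has_real_derivative partial_deriv i f x) (at (x i))"
proof -
  have "(\<lambda>t. f (x(i := t))) differentiable at (x i)"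
    using assms(1)[unfolded smooth_def, rule_format, of "[]"] assms(2,3) by simp
  then show ?thesis unfolding partial_deriv_def by (simp add: DERIV_deriv_iff_real_differentiable)
qed

lemma smooth_measurable:
  fixes f :: "('i::countable \<Rightarrow> real) \<Rightarrow> real"
  assumes "smooth P f"
  shows "f \<in> meas P"
    and "i \<in> P \<Longrightarrow> partial_deriv i f \<in> meas P"
  using assms[unfolded smooth_def, rule_format, of "[]"] assms[unfolded smooth_def, rule_format, of "[i]"]
  by (auto intro: borel_measurable_continuous_on_configs)

text \<open>The mean value inequality, one coordinate at a time, on a path from the zero
  configuration to \<open>x\<close>. Adding \<open>\<bar>f o'\<bar>\<close> to the derivative bound
  gives one constant for both claims.\<close>

lemma smooth_bounded_derivs_growth:
  assumes fin: "finite P" and f: "smooth_bounded_derivs P f"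
  shows "\<exists>C. (\<forall>i\<in>P. \<forall>x\<in>configs P. \<bar>partial_deriv i f x\<bar> \<le> C) \<and>
    (\<forall>x\<in>configs P. \<bar>f x\<bar> \<le> C * (1 + (l1 P x)))"
proof -
  have sm: "smooth P f" using f by (simp add: smooth_bounded_derivs_def)
  have "\<forall>i\<in>P. \<exists>b. \<forall>x\<in>configs P. \<bar>partial_deriv i f x\<bar> \<le> b"
    using f unfolding smooth_bounded_derivs_def bounded_iff by auto
  then obtain b where b: "\<And>i x. i \<in> P \<Longrightarrow> x \<in> configs P \<Longrightarrow> \<bar>partial_deriv i f x\<bar> \<le> b i" by metis
  define o' where "o' = restrict (\<lambda>_. 0 :: real) P"
  have o': "o' \<in> configs P" by (auto simp: o'_def configs_def)
  have b0: "b i \<ge> 0" if "i \<in> P" for i using order_trans[OF abs_ge_zero b[OF that o']] .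
  define B where "B = (\<Sum>i\<in>P. b i)"
  have B0: "B \<ge> 0" unfolding B_def using b0 by (simp add: sum_nonneg)
  have B: "\<bar>partial_deriv i f x\<bar> \<le> B" if "i \<in> P" "x \<in> configs P" for i x
    using b[OF that] member_le_sum[where f = b, OF that(1) _ fin] b0 unfolding B_def by fastforce
  have step: "\<bar>f (x(i := t)) - f x\<bar> \<le> B * \<bar>t - x i\<bar>" if i: "i \<in> P" and x: "x \<in> configs P" for i x t
  proof -
    have "norm ((\<lambda>t. f (x(i := t))) t - (\<lambda>t. f (x(i := t))) (x i)) \<le> B * norm (t - x i)"
    proof (rule field_differentiable_bound[OF convex_UNIV])
      fix u :: real
      have xu: "x(i := u) \<in> configs P" by (rule configs_upd[OF x i])
      show "((\<lambda>t. f (x(i := t))) has_field_derivative partial_deriv i f (x(i := u))) (at u within UNIV)"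
        using smooth_partial_deriv[OF sm i xu] by simp
      show "norm (partial_deriv i f (x(i := u))) \<le> B" using B[OF i xu] by simp
    qed auto
    then show ?thesis by simp
  qed
  have "\<bar>f x - f o'\<bar> \<le> B * (l1 P x)" if x: "x \<in> configs P" for x
  proof -
    have "S \<subseteq> P \<Longrightarrow> \<bar>f (override S x o') - f o'\<bar> \<le> B * (l1 S x)" if "finite S" for S
      using that
    proof (induction S rule: finite_induct)
      case (insert i S)
      let ?w = "override S x o'"
      have w: "?w \<in> configs P"
        using insert.prems x o' by (auto simp: override_def configs_def PiE_def extensional_def)
      have e: "override (insert i S) x o' = ?w(i := x i)" by (auto simp: override_def)
      have "?w i = 0" using insert by (auto simp: override_def o'_def)
      then have "\<bar>f (?w(i := x i)) - f ?w\<bar> \<le> B * \<bar>x i\<bar>" using step[of i ?w "x i"] insert.prems w by simp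
      moreover have "\<bar>f ?w - f o'\<bar> \<le> B * (l1 S x)" using insert by simp
      ultimately show ?case unfolding e sum.insert[OF insert.hyps(1,2)] distrib_left by linarith
    qed (simp add: override_def)
    from this[OF fin subset_refl] have "\<bar>f (override P x o') - f o'\<bar> \<le> B * (l1 P x)" .
    moreover have "override P x o' = x"
      using x by (auto simp: override_def o'_def configs_def PiE_def extensional_def)
    ultimately show ?thesis by simp
  qed
  note growth = this
  have "\<bar>f x\<bar> \<le> (B + \<bar>f o'\<bar>) * (1 + (l1 P x))" if x: "x \<in> configs P" for x
  proof -
    have S: "(l1 P x) \<ge> 0" by (simp add: sum_nonneg)
    have "0 \<le> \<bar>f o'\<bar> * (l1 P x)" using S by simp
    then show ?thesis using growth[OF x] B0 unfolding distrib_left distrib_right mult_1_right by linarith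
  qed
  moreover have "\<bar>partial_deriv i f x\<bar> \<le> B + \<bar>f o'\<bar>" if "i \<in> P" "x \<in> configs P" for i x
    using B[OF that] by simp
  ultimately show ?thesis by blast
qed

context spin_system
begin

lemma H1_smooth:
  assumes fin: "finite P" and f: "smooth_bounded_derivs P f"
  shows "H1_with_gradient P (G P y) f (\<lambda>i. partial_deriv i f)"
proof -
  have sm: "smooth P f" using f by (simp add: smooth_bounded_derivs_def)
  obtain C where "\<And>i x. i \<in> P \<Longrightarrow> x \<in> configs P \<Longrightarrow> \<bar>partial_deriv i f x\<bar> \<le> C"
    "\<And>x. x \<in> configs P \<Longrightarrow> \<bar>f x\<bar> \<le> C * (1 + (l1 P x))"
    using smooth_bounded_derivs_growth[OF assms] by blast
  then show ?thesis
    by (intro H1_of_classical[OF fin] smooth_measurable[OF sm] smooth_partial_deriv[OF sm])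
qed

lemma poincare_smooth:
  assumes fin: "finite P" and wt: "well_tempered M P y" and f: "smooth_bounded_derivs P f"
  shows "sqrt (var (G P y) f) \<le> grad_sup P f / sqrt \<rho>" and "grad_sup P f \<ge> 0"
proof -
  interpret prob_space "G P y" by (rule prob_space_gibbs[OF fin])
  obtain C where C: "\<And>i x. i \<in> P \<Longrightarrow> x \<in> configs P \<Longrightarrow> \<bar>partial_deriv i f x\<bar> \<le> C"
    using smooth_bounded_derivs_growth[OF fin f] by blast
  have le: "(\<Sum>i\<in>P. (partial_deriv i f x)\<^sup>2) \<le> (\<Sum>i\<in>P. C\<^sup>2)" if "x \<in> configs P" for x
    by (rule sum_mono) (metis C that abs_ge_zero power2_abs power_mono)
  have up: "sqrt (\<Sum>i\<in>P. (partial_deriv i f x)\<^sup>2) \<le> grad_sup P f" if "x \<in> configs P" for x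
    unfolding grad_sup_def
    by (rule cSUP_upper[OF that]) (use le in \<open>auto intro!: bdd_aboveI2[where M = "sqrt (\<Sum>i\<in>P. C\<^sup>2)"]\<close>)
  have "restrict (\<lambda>_. 0) P \<in> configs P" by (auto simp: configs_def)
  from up[OF this] show gs: "grad_sup P f \<ge> 0"
    by (rule order_trans[rotated]) (simp add: sum_nonneg)
  have "var (G P y) f \<le> 1 / \<rho> * (\<integral>x. (\<Sum>i\<in>P. (partial_deriv i f x)\<^sup>2) \<partial>G P y)"
    by (rule poincare[OF fin wt H1_smooth[OF fin f]])
  also have "(\<integral>x. (\<Sum>i\<in>P. (partial_deriv i f x)\<^sup>2) \<partial>G P y) \<le> (\<integral>x. (grad_sup P f)\<^sup>2 \<partial>G P y)"
  proof (rule integral_mono)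
    have H: "H1_with_gradient P (G P y) f (\<lambda>i. partial_deriv i f)" by (rule H1_smooth[OF fin f])
    show "integrable (G P y) (\<lambda>x. \<Sum>i\<in>P. (partial_deriv i f x)\<^sup>2)"
      using H unfolding H1_with_gradient_def L2_def by (intro Bochner_Integration.integrable_sum) auto
    show "(\<Sum>i\<in>P. (partial_deriv i f x)\<^sup>2) \<le> (grad_sup P f)\<^sup>2" if "x \<in> space (G P y)" for x
      using up[of x] that by (simp add: sqrt_le_D)
  qed simp
  also have "(\<integral>x. (grad_sup P f)\<^sup>2 \<partial>G P y) = (grad_sup P f)\<^sup>2" using prob_space by simp
  finally have "var (G P y) f \<le> (grad_sup P f)\<^sup>2 / \<rho>" using \<rho>_pos by (simp add: divide_right_mono)
  then have "sqrt (var (G P y) f) \<le> sqrt ((grad_sup P f)\<^sup>2 / \<rho>)" by (rule real_sqrt_le_mono)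
  then show "sqrt (var (G P y) f) \<le> grad_sup P f / sqrt \<rho>" using gs by (simp add: real_sqrt_divide)
qed

lemma integral_support_empty:
  assumes fin: "finite P" and f: "support P f = {}"
  shows "\<exists>c. (\<forall>x\<in>configs P. f x = c) \<and> (\<forall>y. (\<integral>x. f x \<partial>G P y) = c)"
proof -
  have o: "restrict (\<lambda>_. 0) P \<in> configs P" by (auto simp: configs_def)
  define c where "c = f (restrict (\<lambda>_. 0) P)"
  have c: "f x = c" if "x \<in> configs P" for x
    unfolding c_def by (rule support_eqI[OF fin that o]) (use f in auto)
  have "(\<integral>x. f x \<partial>G P y) = c" for y
  proof -
    interpret prob_space "G P y" by (rule prob_space_gibbs[OF fin])
    have "(\<integral>x. f x \<partial>G P y) = (\<integral>x. c \<partial>G P y)" using c by (intro Bochner_Integration.integral_cong) auto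
    then show ?thesis using prob_space by simp
  qed
  with c show ?thesis by blast
qed

lemma covariance_support_empty:
  assumes fin: "finite P" and "support P f = {} \<or> support P g = {}"
  shows "covariance (G P y) f g = 0"
proof -
  have "(f x - (\<integral>y. f y \<partial>G P y)) * (g x - (\<integral>y. g y \<partial>G P y)) = 0" if "x \<in> configs P" for x
    using assms(2) integral_support_empty[OF fin] that by fastforce
  then have "covariance (G P y) f g = (\<integral>x. 0 \<partial>G P y)"
    unfolding covariance_def by (intro Bochner_Integration.integral_cong) auto
  then show ?thesis by simp
qed

end

section \<open>Mixing on the lattice\<close>

locale lattice_system = spin_system M \<psi> s \<delta> \<rho>
  for M :: "int ^ 'd \<Rightarrow> int ^ 'd \<Rightarrow> real" and \<psi> s \<delta> \<rho> +
  fixes CM \<alpha> :: real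
  assumes CM_pos: "CM > 0" and \<alpha>_pos: "\<alpha> > 0"
    and decay: "\<bar>M i j\<bar> \<le> CM * (1 + site_norm (i - j)) powr (- (2 * real CARD('d) + \<alpha>))"
begin

text \<open>\<open>p\<close> is the rate to be proved for covariances and \<open>q\<close> the rate
  of the row sums of \<open>M\<close>. Of the exponent \<open>2 * d + \<alpha>\<close> the part
  \<open>d + \<alpha> / 4\<close> is reserved for summability and \<open>q\<close> is what remains;
  \<open>q - p = \<alpha> / 4\<close> pays for the layers.\<close>

definition p :: real where "p = real CARD('d) + \<alpha> / 2"
definition q :: real where "q = real CARD('d) + 3 * \<alpha> / 4"

lemma pq: "0 < p" "p \<le> q"
  using \<alpha>_pos unfolding p_def q_def by (auto intro: add_pos_pos)

text \<open>Stated with standard deviations, so that gradients and cardinalities can be brought in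
  later for each application. Supports are nonempty because \<open>site_dist\<close> is unspecified
  otherwise.\<close>

definition mixing_constant :: "real \<Rightarrow> bool"
  where "mixing_constant C \<longleftrightarrow> (\<forall>V \<omega> f g. finite V \<longrightarrow> well_tempered M V \<omega> \<longrightarrow>
    L2 (G V \<omega>) f \<longrightarrow> L2 (G V \<omega>) g \<longrightarrow> support V f \<noteq> {} \<longrightarrow> support V g \<noteq> {} \<longrightarrow>
    \<bar>cov V \<omega> f g\<bar> \<le> C * (1 + site_dist (support V f) (support V g)) powr (- p)
      * (sd V \<omega> f * sd V \<omega> g))"

definition row_constant :: "real \<Rightarrow> bool"
  where "row_constant S \<longleftrightarrow> (\<forall>i T r. finite T \<longrightarrow> r \<ge> 0 \<longrightarrow> (\<forall>j\<in>T. r \<le> site_norm (i - j)) \<longrightarrow>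
    (\<Sum>j\<in>T. \<bar>M i j\<bar>) \<le> S * (1 + r) powr (- q))"

text \<open>Of the decay of \<open>M\<close>, the power \<open>q\<close> is evaluated at the minimal
  distance \<open>r\<close>; the remaining power \<open>d + \<alpha> / 4\<close> is summable over
  the lattice, uniformly in \<open>T\<close> and \<open>i\<close>.\<close>

lemma row_sum_decay:
  "\<exists>S>0. row_constant S"
proof -
  obtain S where S: "S > 0" "\<And>T :: (int ^ 'd) set. finite T \<Longrightarrow>
      (\<Sum>j\<in>T. (1 + site_norm j) powr (- (real CARD('d) + \<alpha> / 4))) \<le> S"
    using sum_site_norm_powr_bounded[of "\<alpha> / 4", where 'd = 'd] \<alpha>_pos by auto
  have "(\<Sum>j\<in>T. \<bar>M i j\<bar>) \<le> (CM * S) * (1 + r) powr (- q)"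
    if T: "finite T" and r: "r \<ge> 0" "\<And>j. j \<in> T \<Longrightarrow> r \<le> site_norm (i - j)" for i T r
  proof -
    have "(\<Sum>j\<in>T. \<bar>M i j\<bar>) \<le> (\<Sum>j\<in>T. CM * ((1 + r) powr (- q) * (1 + site_norm (i - j)) powr (- (real CARD('d) + \<alpha> / 4))))"
    proof (rule sum_mono)
      fix j assume j: "j \<in> T"
      have "- (2 * real CARD('d) + \<alpha>) = - q + - (real CARD('d) + \<alpha> / 4)" by (simp add: q_def)
      then have "(1 + site_norm (i - j)) powr (- (2 * real CARD('d) + \<alpha>)) =
          (1 + site_norm (i - j)) powr (- q) * (1 + site_norm (i - j)) powr (- (real CARD('d) + \<alpha> / 4))"
        by (simp only: powr_add)
      also have "\<dots> \<le> (1 + r) powr (- q) * (1 + site_norm (i - j)) powr (- (real CARD('d) + \<alpha> / 4))"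
        using r(1) r(2)[OF j] pq by (intro mult_right_mono powr_mono2') auto
      finally show "\<bar>M i j\<bar> \<le> CM * ((1 + r) powr (- q) * (1 + site_norm (i - j)) powr (- (real CARD('d) + \<alpha> / 4)))"
        using decay[of i j] CM_pos by (meson less_imp_le mult_left_mono order_trans)
    qed
    also have "\<dots> = CM * (1 + r) powr (- q) * (\<Sum>j\<in>T. (1 + site_norm (i - j)) powr (- (real CARD('d) + \<alpha> / 4)))"
      by (simp add: sum_distrib_left mult.assoc)
    also have "(\<Sum>j\<in>T. (1 + site_norm (i - j)) powr (- (real CARD('d) + \<alpha> / 4))) =
        (\<Sum>j\<in>(\<lambda>j. i - j) ` T. (1 + site_norm j) powr (- (real CARD('d) + \<alpha> / 4)))"
      by (subst sum.reindex) (auto simp: inj_on_def)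
    also have "CM * (1 + r) powr (- q) * \<dots> \<le> CM * (1 + r) powr (- q) * S"
      using S(2)[of "(\<lambda>j. i - j) ` T"] T CM_pos by (intro mult_left_mono) auto
    finally show ?thesis by (simp add: mult_ac)
  qed
  moreover have "CM * S > 0" using CM_pos S(1) by simp
  ultimately show ?thesis unfolding row_constant_def by blast
qed

text \<open>The chain consists of the neighbourhoods of \<open>support V f\<close> of radius
  \<open>real r * w\<close>; as \<open>real n * w < L\<close>, the last one misses
  \<open>support V g\<close>. \<open>Var_chain\<close> is used with \<open>m = S\<^sup>2\<close> and
  \<open>k = R\<^sup>2\<close>. It bounds the squared covariance, hence the doubled
  exponents.\<close>

lemma mixing: "\<exists>C>0. mixing_constant C"
proof -
  obtain S where S: "S > 0" and row0: "row_constant S"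
    using row_sum_decay by blast
  have row: "(\<Sum>j\<in>T. \<bar>M i j\<bar>) \<le> S * (1 + r) powr (- q)"
    if "finite T" "r \<ge> 0" "\<And>j. j \<in> T \<Longrightarrow> r \<le> site_norm (i - j)" for i T r
    using row0 that unfolding row_constant_def by blast
  define c where "c = 8 * S\<^sup>2 / \<rho>\<^sup>2"
  have c: "c \<ge> 0" by (simp add: c_def)
  define \<theta> where "\<theta> = c / (1 + c)"
  have \<theta>: "0 \<le> \<theta>" "\<theta> < 1" using c by (auto simp: \<theta>_def)
  have "0 < real CARD('d)" by simp
  \<comment> \<open>\<open>c\<close> also serves as the coefficient of the polynomial term: the
    error of a layer is \<open>8 * R\<^sup>2 / \<rho>\<^sup>2\<close> with
    \<open>R = S * (1 + w) powr (- q)\<close>.\<close>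
  from layer_choice[OF \<theta> c this \<alpha>_pos, folded p_def q_def]
  obtain C where C: "C > 0" and layer: "\<forall>L>0. \<exists>n w. w \<ge> 0 \<and> real n * w < L \<and>
      \<theta> ^ n + c * (1 + w) powr (- 2 * q) \<le> C * (1 + L) powr (- 2 * p)"
    by blast
  \<comment> \<open>The 1 is for supports at distance 0, where no layer fits and the Cauchy-Schwarz
    inequality is the whole bound.\<close>
  have "\<bar>cov V \<omega> f g\<bar> \<le> max 1 (sqrt C) * (1 + L) powr (- p)
      * (sd V \<omega> f * sd V \<omega> g)"
    if fin: "finite V" and wt: "well_tempered M V \<omega>" and f: "L2 (G V \<omega>) f" and g: "L2 (G V \<omega>) g"
      and A: "support V f \<noteq> {}" and B: "support V g \<noteq> {}"
      and L: "L = site_dist (support V f) (support V g)" for V \<omega> f g L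
  proof (cases "L > 0")
    case True
    interpret finite_volume M \<psi> s \<delta> \<rho> V \<omega> by unfold_locales (use fin wt in auto)
    obtain n w where w: "w \<ge> 0" "real n * w < L"
      and bound: "\<theta> ^ n + c * (1 + w) powr (- 2 * q) \<le> C * (1 + L) powr (- 2 * p)"
      using layer True by blast
    define P where "P r = {i\<in>V. \<exists>a\<in>support V f. site_norm (i - a) \<le> real r * w}" for r :: nat
    have PV: "P r \<subseteq> V" for r by (auto simp: P_def)
    have Pmono: "P r \<subseteq> P (Suc r)" for r
    proof
      fix i assume "i \<in> P r"
      then obtain a where a: "i \<in> V" "a \<in> support V f" "site_norm (i - a) \<le> real r * w"
        by (auto simp: P_def)
      have "real r * w \<le> real (Suc r) * w" using w(1) by (intro mult_right_mono) auto
      with a show "i \<in> P (Suc r)" unfolding P_def by (blast intro: order_trans)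
    qed
    have AP: "support V f \<subseteq> P 0" by (auto simp: P_def support_def intro!: bexI)
    have BP: "support V g \<inter> P n = {}"
    proof (rule ccontr)
      assume "support V g \<inter> P n \<noteq> {}"
      then obtain b a where ab: "b \<in> support V g" "a \<in> support V f" "site_norm (b - a) \<le> real n * w"
        by (auto simp: P_def)
      have "L \<le> site_norm (b - a)"
        unfolding L using site_dist_le[OF ab(2,1)] by (simp add: site_norm_minus_commute)
      with ab(3) w(2) show False by linarith
    qed
    \<comment> \<open>One layer lies between \<open>i\<close> and \<open>j\<close>: \<open>i\<close>
      is within \<open>real r * w\<close> of the support of \<open>f\<close>, and \<open>j\<close>
      is not within \<open>real (Suc r) * w\<close>.\<close>
    have far: "w \<le> site_norm (i - j)" if i: "i \<in> P r" and j: "j \<in> V - P (Suc r)" for i j r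
    proof -
      obtain a where a: "a \<in> support V f" "site_norm (i - a) \<le> real r * w" using i by (auto simp: P_def)
      have "site_norm (j - a) > real (Suc r) * w" using j a(1) by (force simp: P_def)
      moreover have "site_norm (j - a) \<le> site_norm (j - i) + site_norm (i - a)" by (rule site_norm_triangle)
      ultimately have "w \<le> site_norm (j - i)" using a(2) by (simp add: distrib_right)
      then show ?thesis by (simp add: site_norm_minus_commute)
    qed
    define R where "R = S * (1 + w) powr (- q)"
    have R: "R \<ge> 0" using S by (simp add: R_def)
    have opS: "(\<Sum>i\<in>P'. (\<Sum>j\<in>T. M i j * v j)\<^sup>2) \<le> S\<^sup>2 * (\<Sum>j\<in>T. (v j)\<^sup>2)"
      if "finite P'" "finite T" for P' T and v :: "int ^ 'd \<Rightarrow> real"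
    proof (rule Schur_test)
      show "(\<Sum>j\<in>T. \<bar>M i j\<bar>) \<le> S" for i using row[OF that(2) order_refl site_norm_nonneg, of i] by simp
      show "(\<Sum>i\<in>P'. \<bar>M i j\<bar>) \<le> S" for j
        using row[OF that(1) order_refl site_norm_nonneg, of j] by (simp add: M_sym[of _ j])
    qed (use S in simp)
    have opR: "(\<Sum>i\<in>P r. (\<Sum>j\<in>V - P (Suc r). M i j * v j)\<^sup>2) \<le> R\<^sup>2 * (\<Sum>j\<in>V - P (Suc r). (v j)\<^sup>2)" for r v
    proof (rule Schur_test[OF _ _ R])
      show "(\<Sum>j\<in>V - P (Suc r). \<bar>M i j\<bar>) \<le> R" if "i \<in> P r" for i
        unfolding R_def using fin w(1) far[OF that] by (intro row) auto
      have "(\<Sum>i\<in>P r. \<bar>M j i\<bar>) \<le> R" if "j \<in> V - P (Suc r)" for j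
        unfolding R_def using finite_subset[OF PV fin] w(1) far[OF _ that]
        by (intro row) (auto simp: site_norm_minus_commute[of j])
      then show "(\<Sum>i\<in>P r. \<bar>M i j\<bar>) \<le> R" if "j \<in> V - P (Suc r)" for j
        using that by (simp add: M_sym[of _ j])
    qed
    have kR: "8 * R\<^sup>2 / \<rho>\<^sup>2 = c * (1 + w) powr (- 2 * q)"
    proof -
      have "((1 + w) powr (- q))\<^sup>2 = (1 + w) powr (2 * (- q))"
        using w(1) by (subst powr_power) auto
      then show ?thesis by (simp add: R_def c_def power_mult_distrib)
    qed
    define K where "K = C * (1 + L) powr (- 2 * p)"
    have "(cov V \<omega> f g)\<^sup>2 \<le> K * (var (G V \<omega>) f * var (G V \<omega>) g)"
    proof (rule covariance_truncation[OF f g])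
      fix h k assume h: "bdd h" "depends_on (support V f) h" and k: "bdd k" "depends_on (support V g) k"
      have "(E V (\<lambda>u. h u * k u) \<omega> - E V h \<omega> * E V k \<omega>)\<^sup>2 \<le> Var (E (P n) h) * Var k"
        by (rule covariance_bound_Var[OF PV h(1) k(1) depends_on_free[OF k(2) BP]])
      also have "Var (E (P n) h) \<le> ((8 * S\<^sup>2 / \<rho>\<^sup>2 / (1 + 8 * S\<^sup>2 / \<rho>\<^sup>2)) ^ n + 8 * R\<^sup>2 / \<rho>\<^sup>2) * Var h"
        by (rule Var_chain[OF h(1) depends_on_mono[OF h(2) AP] Pmono PV _ _ opS opR])
          (use fin finite_subset[OF PV fin] in auto)
      also have "8 * S\<^sup>2 / \<rho>\<^sup>2 / (1 + 8 * S\<^sup>2 / \<rho>\<^sup>2) = \<theta>" by (simp only: \<theta>_def c_def)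
      also have "(\<theta> ^ n + 8 * R\<^sup>2 / \<rho>\<^sup>2) * Var h \<le> K * Var h"
        using bound Var_nonneg[OF bdd_tame[OF h(1)]] unfolding kR K_def by (intro mult_right_mono)
      finally show "(E V (\<lambda>u. h u * k u) \<omega> - E V h \<omega> * E V k \<omega>)\<^sup>2 \<le> K * (Var h * Var k)"
        using Var_nonneg[OF bdd_tame[OF k(1)]] by (simp add: mult_right_mono mult.assoc)
    qed
    then have "sqrt ((cov V \<omega> f g)\<^sup>2) \<le> sqrt (K * (var (G V \<omega>) f * var (G V \<omega>) g))"
      by (rule real_sqrt_le_mono)
    also have "\<dots> = sqrt C * sqrt ((1 + L) powr (- 2 * p)) * (sd V \<omega> f * sd V \<omega> g)"
      by (simp add: K_def real_sqrt_mult)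
    also have "sqrt ((1 + L) powr (- 2 * p)) = (1 + L) powr (- p)"
    proof -
      have "- 2 * p = - p + - p" by simp
      then show ?thesis by (simp only: powr_add real_sqrt_abs2 abs_of_nonneg powr_ge_zero)
    qed
    also have "sqrt C * (1 + L) powr (- p) * (sd V \<omega> f * sd V \<omega> g) \<le>
        max 1 (sqrt C) * (1 + L) powr (- p) * (sd V \<omega> f * sd V \<omega> g)"
      by (intro mult_right_mono) (auto simp: var_nonneg)
    finally show ?thesis by simp
  next
    case False
    interpret prob_space "G V \<omega>" by (rule prob_space_gibbs[OF fin])
    have L0: "L = 0" using False site_dist_nonneg[OF A B] L by simp
    have "\<bar>cov V \<omega> f g\<bar> \<le> 1 * (sd V \<omega> f * sd V \<omega> g)"
      using covariance_Cauchy_Schwarz[OF f g] by simp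
    also have "\<dots> \<le> max 1 (sqrt C) * (sd V \<omega> f * sd V \<omega> g)"
      by (intro mult_right_mono) (auto simp: var_nonneg)
    finally show ?thesis by (simp add: L0)
  qed
  then have "mixing_constant (max 1 (sqrt C))" unfolding mixing_constant_def by blast
  moreover have "max 1 (sqrt C) > 0" by (rule less_le_trans[OF zero_less_one max.cobounded1])
  ultimately show ?thesis by blast
qed

section \<open>From standard deviations to gradients\<close>

lemma support_weight:
  assumes "finite V" "support V f \<noteq> {}" shows "1 \<le> real (card (support V f))"
proof -
  have "finite (support V f)" by (rule finite_subset[OF _ assms(1)]) (auto simp: support_def)
  then have "card (support V f) > 0" using assms(2) by (simp add: card_gt_0_iff)
  then show ?thesis by simp
qed

text \<open>Nonempty supports have cardinality at least 1, so inserting the weights \<open>a\<close>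
  and \<open>b\<close> enlarges the right-hand side.\<close>

lemma weighted_bound:
  fixes c D p q X Y a b :: real
  assumes "1 \<le> a" "1 \<le> b" "0 \<le> c" "0 \<le> X" "0 \<le> Y"
  shows "c * D powr (- p) * (X * Y) \<le> c * (a * b) / D powr p * X * Y"
proof -
  have "1 * 1 \<le> a * b" using assms by (intro mult_mono) auto
  then have "c * D powr (- p) * (X * Y) * 1 \<le> c * D powr (- p) * (X * Y) * (a * b)"
    using assms by (intro mult_left_mono) auto
  then show ?thesis by (simp add: powr_minus divide_inverse mult_ac)
qed

text \<open>Common source of the Sobolev bound and of (DC): \<open>X\<close> and \<open>Y\<close>
  stand for gradient norms in the space of square-integrable functions or for suprema of gradients,
  and both dominate standard deviations by the Poincare inequality.\<close>

definition weighted_constant :: "real \<Rightarrow> bool"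
  where "weighted_constant C \<longleftrightarrow> (\<forall>V \<omega> f g X Y. finite V \<longrightarrow> well_tempered M V \<omega> \<longrightarrow> L2 (G V \<omega>) f \<longrightarrow> L2 (G V \<omega>) g \<longrightarrow>
    sd V \<omega> f \<le> X / sqrt \<rho> \<longrightarrow> sd V \<omega> g \<le> Y / sqrt \<rho> \<longrightarrow>
    \<bar>cov V \<omega> f g\<bar> \<le>
      C * (sqrt (real (card (support V f))) * sqrt (real (card (support V g))))
        / (1 + site_dist (support V f) (support V g)) powr p * X * Y)"

lemma covariance_weighted: "\<exists>C>0. weighted_constant C"
proof -
  obtain C where C: "C > 0" "mixing_constant C" using mixing by blast
  show ?thesis unfolding weighted_constant_def
  proof (intro exI[of _ "C / \<rho>"] conjI allI impI)
    show "C / \<rho> > 0" using C \<rho>_pos by simp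
    fix V \<omega> f g X Y
    assume fin: "finite V" and wt: "well_tempered M V \<omega>" and f: "L2 (G V \<omega>) f" and g: "L2 (G V \<omega>) g"
      and X: "sd V \<omega> f \<le> X / sqrt \<rho>" and Y: "sd V \<omega> g \<le> Y / sqrt \<rho>"
    let ?D = "1 + site_dist (support V f) (support V g)"
    have "0 \<le> X / sqrt \<rho>" "0 \<le> Y / sqrt \<rho>"
      by (rule order_trans[OF _ X] order_trans[OF _ Y], simp add: var_nonneg)+
    then have XY: "0 \<le> X" "0 \<le> Y" using \<rho>_pos by (simp_all add: zero_le_divide_iff)
    show "\<bar>cov V \<omega> f g\<bar> \<le>
      C / \<rho> * (sqrt (real (card (support V f))) * sqrt (real (card (support V g)))) / ?D powr p * X * Y"
    proof (cases "support V f = {} \<or> support V g = {}")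
      case True
      then show ?thesis using covariance_support_empty[OF fin True] by auto
    next
      case False
      then have "\<bar>cov V \<omega> f g\<bar> \<le> C * ?D powr (- p) * (sd V \<omega> f * sd V \<omega> g)"
        using C(2) fin wt f g unfolding mixing_constant_def by blast
      also have "\<dots> \<le> C * ?D powr (- p) * (X / sqrt \<rho> * (Y / sqrt \<rho>))"
        using C \<rho>_pos XY by (intro mult_left_mono mult_mono X Y) (auto simp: var_nonneg)
      also have "\<dots> = C / \<rho> * ?D powr (- p) * (X * Y)"
        using \<rho>_pos by simp
      also have "\<dots> \<le> C / \<rho> * (sqrt (real (card (support V f))) * sqrt (real (card (support V g)))) / ?D powr p * X * Y"
        using C \<rho>_pos XY support_weight[OF fin] False by (intro weighted_bound) auto
      finally show ?thesis .
    qed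
  qed
qed

theorem covariance_H1:
  "\<exists>C>0. \<forall>V \<omega> f F g H. finite V \<longrightarrow> well_tempered M V \<omega> \<longrightarrow>
    H1_with_gradient V (G V \<omega>) f F \<longrightarrow> H1_with_gradient V (G V \<omega>) g H \<longrightarrow>
    \<bar>cov V \<omega> f g\<bar> \<le>
      C * (sqrt (real (card (support V f))) * sqrt (real (card (support V g))))
        / (1 + site_dist (support V f) (support V g)) powr (real CARD('d) + \<alpha> / 2)
        * sqrt (\<integral>x. (\<Sum>i\<in>V. (F i x)\<^sup>2) \<partial>G V \<omega>) * sqrt (\<integral>x. (\<Sum>i\<in>V. (H i x)\<^sup>2) \<partial>G V \<omega>)"
proof -
  obtain C where C: "C > 0" and cov: "weighted_constant C"
    using covariance_weighted by blast
  have "L2 (G V \<omega>) h \<and> sd V \<omega> h \<le> sqrt (\<integral>x. (\<Sum>i\<in>V. (K i x)\<^sup>2) \<partial>G V \<omega>) / sqrt \<rho>"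
    if "finite V" "well_tempered M V \<omega>" "H1_with_gradient V (G V \<omega>) h K" for V \<omega> h K
    using that(3) real_sqrt_le_mono[OF poincare[OF that]] by (simp add: H1_with_gradient_def real_sqrt_divide)
  with C cov show ?thesis unfolding weighted_constant_def p_def[symmetric] by (intro exI[of _ C] conjI allI impI) (assumption, metis)
qed

theorem decay_of_correlations: "decay_of_correlations M \<psi> s"
proof -
  obtain C where C: "C > 0" and cov: "weighted_constant C"
    using covariance_weighted by blast
  show ?thesis unfolding decay_of_correlations_def
  proof (rule exI[of _ C], rule exI[of _ "\<alpha> / 2"], rule exI[of _ "1 / 2"], intro conjI allI impI)
    fix V \<omega> f g
    assume fin: "finite V" and wt: "well_tempered M V \<omega>"
      and f: "smooth_bounded_derivs V f" and g: "smooth_bounded_derivs V g"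
    have "L2 (G V \<omega>) f" "L2 (G V \<omega>) g"
      using H1_smooth[OF fin f] H1_smooth[OF fin g] unfolding H1_with_gradient_def by blast+
    with cov[unfolded weighted_constant_def] fin wt poincare_smooth(1)[OF fin wt f] poincare_smooth(1)[OF fin wt g]
    have "\<bar>cov V \<omega> f g\<bar> \<le>
      C * (sqrt (real (card (support V f))) * sqrt (real (card (support V g))))
        / (1 + site_dist (support V f) (support V g)) powr p * grad_sup V f * grad_sup V g"
      by blast
    then show "\<bar>cov V \<omega> f g\<bar> \<le>
      C * (real (card (support V f)) powr (1 / 2) * real (card (support V g)) powr (1 / 2))
        / (1 + site_dist (support V f) (support V g)) powr (real CARD('d) + \<alpha> / 2) * grad_sup V f * grad_sup V g"
      by (simp add: powr_half_sqrt p_def)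
  qed (use C \<alpha>_pos in auto)
qed

text \<open>The interaction of a boundary site with the sites far from it is small in norm, and the spins
  near it are far from the support of \<open>f\<close>.\<close>

lemma covariance_boundary_field:
  "\<exists>K>0. \<forall>V \<omega> f i. finite V \<longrightarrow> well_tempered M V \<omega> \<longrightarrow> L2 (G V \<omega>) f \<longrightarrow> support V f \<noteq> {} \<longrightarrow>
    \<bar>cov V \<omega> f (\<lambda>z. \<Sum>k\<in>V. M k i * z k)\<bar> \<le>
      K * (1 + site_dist (support V f) {i}) powr (- p) * sd V \<omega> f"
proof -
  obtain C where C: "C > 0" "mixing_constant C" using mixing by blast
  obtain S where S: "S > 0" and row0: "row_constant S"
    using row_sum_decay by blast
  have row: "(\<Sum>j\<in>T. \<bar>M j i\<bar>) \<le> S * (1 + r) powr (- p)"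
    if "finite T" "r \<ge> 0" "\<And>j. j \<in> T \<Longrightarrow> r \<le> site_norm (i - j)" for i T r
  proof -
    have "(\<Sum>j\<in>T. \<bar>M j i\<bar>) \<le> S * (1 + r) powr (- q)"
      using row0 that unfolding row_constant_def M_sym[of _ i] by blast
    also have "\<dots> \<le> S * (1 + r) powr (- p)"
      using S that(2) pq by (intro mult_left_mono powr_mono) auto
    finally show ?thesis .
  qed
  \<comment> \<open>\<open>S / sqrt \<rho>\<close> stems from the Poincare inequality for linear
    functions, the summands 1 and \<open>C\<close> belong to the far and the near part, and
    \<open>2 powr p\<close> is the price of halving the distance.\<close>
  define K where "K = S / sqrt \<rho> * (1 + C) * 2 powr p"
  have K: "K > 0" using S C \<rho>_pos by (simp add: K_def)
  have "\<bar>cov V \<omega> f (\<lambda>z. \<Sum>k\<in>V. M k i * z k)\<bar> \<le> K * (1 + L) powr (- p) * sd V \<omega> f"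
    if fin: "finite V" and wt: "well_tempered M V \<omega>" and f: "L2 (G V \<omega>) f" and ne: "support V f \<noteq> {}"
      and L: "L = site_dist (support V f) {i}" for V \<omega> f i L
  proof -
    interpret prob_space "G V \<omega>" by (rule prob_space_gibbs[OF fin])
    have L0: "L \<ge> 0" unfolding L by (rule site_dist_nonneg[OF ne]) simp
    \<comment> \<open>Half the distance suits both parts: sites of \<open>V\<close> off
      \<open>N\<close> are at least \<open>L / 2\<close> away from \<open>i\<close>, and sites in
      \<open>N\<close> are at least \<open>L / 2\<close> away from the support of \<open>f\<close>
      by the triangle inequality.\<close>
    define N where "N = {k\<in>V. site_norm (i - k) < L / 2}"
    define a where "a k = (if k \<in> N then 0 else M k i)" for k
    define b where "b k = (if k \<in> N then M k i else 0)" for k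
    let ?v = "\<lambda>c z. \<Sum>k\<in>V. c k * z k :: real"
    have L2: "L2 (G V \<omega>) (?v c)" for c using H1_linear[OF fin, of \<omega> c] by (simp add: H1_with_gradient_def)
    have sqrt_var: "sd V \<omega> (?v c) \<le> (\<Sum>k\<in>V. \<bar>c k\<bar>) / sqrt \<rho>" for c
    proof -
      \<comment> \<open>Poincare yields the Euclidean norm of the coefficients; it is passed to the
        larger sum of absolute values, for which the row bound is available.\<close>
      have "sd V \<omega> (?v c) \<le> sqrt (1 / \<rho> * (\<Sum>k\<in>V. (c k)\<^sup>2))"
        by (rule real_sqrt_le_mono[OF poincare_linear[OF fin wt]])
      also have "\<dots> = L2_set c V / sqrt \<rho>" by (simp add: L2_set_def real_sqrt_divide)
      also have "\<dots> \<le> (\<Sum>k\<in>V. \<bar>c k\<bar>) / sqrt \<rho>"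
        using \<rho>_pos by (intro divide_right_mono L2_set_le_sum_abs) auto
      finally show ?thesis .
    qed
    have half: "(1 + L / 2) powr (- p) \<le> 2 powr p * (1 + L) powr (- p)"
    proof -
      have "(1 + L / 2) powr (- p) \<le> ((1 + L) / 2) powr (- p)"
        using L0 pq by (intro powr_mono2') auto
      also have "\<dots> = (1 + L) powr (- p) / 2 powr (- p)" using L0 by (intro powr_divide)
      also have "\<dots> = 2 powr p * (1 + L) powr (- p)"
        by (simp only: powr_minus divide_inverse inverse_inverse_eq mult.commute)
      finally show ?thesis .
    qed
    have A: "\<bar>cov V \<omega> f (?v a)\<bar> \<le> sd V \<omega> f * (S * (1 + L / 2) powr (- p) / sqrt \<rho>)"
    proof -
      have "(\<Sum>k\<in>V. \<bar>a k\<bar>) = (\<Sum>k\<in>V - N. \<bar>M k i\<bar>)"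
        using fin by (intro sum.mono_neutral_cong_right) (auto simp: a_def)
      also have "\<dots> \<le> S * (1 + L / 2) powr (- p)"
        using fin L0 by (intro row) (auto simp: N_def)
      finally have "(\<Sum>k\<in>V. \<bar>a k\<bar>) / sqrt \<rho> \<le> S * (1 + L / 2) powr (- p) / sqrt \<rho>"
        using \<rho>_pos by (intro divide_right_mono) auto
      with sqrt_var[of a] have "sd V \<omega> (?v a) \<le> S * (1 + L / 2) powr (- p) / sqrt \<rho>" by linarith
      then have "sd V \<omega> f * sd V \<omega> (?v a) \<le> sd V \<omega> f * (S * (1 + L / 2) powr (- p) / sqrt \<rho>)"
        by (intro mult_left_mono) (auto simp: var_nonneg)
      with covariance_Cauchy_Schwarz[OF f L2[of a]] show ?thesis by linarith
    qed
    have B: "\<bar>cov V \<omega> f (?v b)\<bar> \<le> C * (1 + L / 2) powr (- p) * (sd V \<omega> f * (S / sqrt \<rho>))"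
    proof (cases "support V (?v b) = {}")
      case True
      then show ?thesis using covariance_support_empty[OF fin, of f "?v b" \<omega>] C S \<rho>_pos by (simp add: var_nonneg)
    next
      case False
      have supp: "support V (?v b) \<subseteq> N"
      proof
        fix k assume k: "k \<in> support V (?v b)"
        show "k \<in> N"
        proof (rule ccontr)
          assume "k \<notin> N"
          then have "b k = 0" by (simp add: b_def)
          moreover have "k \<in> V" using k by (simp add: support_def)
          ultimately have "?v b (x(k := t)) = ?v b x" for x t
            using linear_upd[OF fin, of k b x t] by simp
          with k show False unfolding support_def by blast
        qed
      qed
      have "L / 2 \<le> site_dist (support V f) (support V (?v b))"
      proof (rule site_dist_greatest[OF ne False])
        fix x y assume x: "x \<in> support V f" and y: "y \<in> support V (?v b)"
        have "L \<le> site_norm (x - i)" unfolding L using site_dist_le[OF x, of i "{i}"] by simp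
        also have "\<dots> \<le> site_norm (x - y) + site_norm (y - i)" by (rule site_norm_triangle)
        also have "site_norm (y - i) < L / 2" using y supp by (auto simp: N_def site_norm_minus_commute)
        finally show "L / 2 \<le> site_norm (x - y)" by simp
      qed
      then have D: "(1 + site_dist (support V f) (support V (?v b))) powr (- p) \<le> (1 + L / 2) powr (- p)"
        using L0 pq by (intro powr_mono2') auto
      have "(\<Sum>k\<in>V. \<bar>b k\<bar>) \<le> (\<Sum>k\<in>V. \<bar>M k i\<bar>)" by (intro sum_mono) (auto simp: b_def)
      also have "\<dots> \<le> S" using row[OF fin order_refl site_norm_nonneg, of i] by simp
      finally have "(\<Sum>k\<in>V. \<bar>b k\<bar>) / sqrt \<rho> \<le> S / sqrt \<rho>"
        using \<rho>_pos by (intro divide_right_mono) auto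
      with sqrt_var[of b] have v: "sd V \<omega> (?v b) \<le> S / sqrt \<rho>" by linarith
      have "\<bar>cov V \<omega> f (?v b)\<bar> \<le> C * (1 + site_dist (support V f) (support V (?v b))) powr (- p)
          * (sd V \<omega> f * sd V \<omega> (?v b))"
        using C(2) fin wt f L2 ne False unfolding mixing_constant_def by blast
      also have "\<dots> \<le> C * (1 + L / 2) powr (- p) * (sd V \<omega> f * (S / sqrt \<rho>))"
        using C S \<rho>_pos by (intro mult_mono mult_left_mono D v) (auto simp: var_nonneg)
      finally show ?thesis .
    qed
    have "(\<lambda>z. \<Sum>k\<in>V. M k i * z k) = (\<lambda>z. ?v a z + ?v b z)"
      unfolding sum.distrib[symmetric] by (intro ext sum.cong) (auto simp: a_def b_def)
    then have "\<bar>cov V \<omega> f (\<lambda>z. \<Sum>k\<in>V. M k i * z k)\<bar> \<le>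
        sd V \<omega> f * (S * (1 + L / 2) powr (- p) / sqrt \<rho>) + C * (1 + L / 2) powr (- p) * (sd V \<omega> f * (S / sqrt \<rho>))"
      using A B by (simp only: covariance_add_right[OF f L2 L2])
    also have "\<dots> = S / sqrt \<rho> * (1 + C) * sd V \<omega> f * (1 + L / 2) powr (- p)"
      by (simp add: algebra_simps add_divide_distrib)
    also have "\<dots> \<le> S / sqrt \<rho> * (1 + C) * sd V \<omega> f * (2 powr p * (1 + L) powr (- p))"
      using S C \<rho>_pos by (intro mult_left_mono half) (auto simp: var_nonneg)
    also have "\<dots> = K * (1 + L) powr (- p) * sd V \<omega> f" by (simp add: K_def mult_ac)
    finally show ?thesis .
  qed
  with K show ?thesis by blast
qed

text \<open>The two expectations are values of one function \<open>h\<close> of the boundary spin at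
  \<open>i\<close>. Its derivative is \<open>- 2\<close> times the covariance of \<open>f\<close>
  with the linear function through which \<open>i\<close> acts on the volume. This covariance is
  bounded uniformly in all intermediate boundary conditions, so the mean value inequality
  applies.\<close>

theorem dobrushin_shlosman: "dobrushin_shlosman M \<psi> s"
proof -
  obtain K where K: "K > 0" and cov: "\<forall>V y f i. finite V \<longrightarrow> well_tempered M V y \<longrightarrow> L2 (G V y) f \<longrightarrow> support V f \<noteq> {} \<longrightarrow>
    \<bar>covariance (G V y) f (\<lambda>z. \<Sum>k\<in>V. M k i * z k)\<bar> \<le>
      K * (1 + site_dist (support V f) {i}) powr (- p) * sqrt (var (G V y) f)"
    using covariance_boundary_field by (elim exE conjE)
  show ?thesis unfolding dobrushin_shlosman_def
  proof (rule exI[of _ "2 * K / sqrt \<rho>"], rule exI[of _ "\<alpha> / 2"], rule exI[of _ "1 / 2"], intro conjI allI impI)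
    show "2 * K / sqrt \<rho> > 0" "\<alpha> / 2 > 0" "(1 / 2 :: real) > 0" using K \<rho>_pos \<alpha>_pos by auto
    fix V f and i :: "int ^ 'd" and y y' :: "int ^ 'd \<Rightarrow> real"
    assume fin: "finite V" and f: "smooth_bounded_derivs V f" and i: "i \<notin> V"
      and wt: "well_tempered M V y" and "well_tempered M V y'"
      and eq: "\<forall>k. k \<notin> V \<longrightarrow> k \<noteq> i \<longrightarrow> y' k = y k"
    let ?D = "1 + site_dist (support V f) {i}"
    have "\<bar>(\<integral>x. f x \<partial>G V y) - (\<integral>x. f x \<partial>G V y')\<bar> \<le>
      2 * K / sqrt \<rho> * real (card (support V f)) powr (1 / 2) / ?D powr p * \<bar>y' i - y i\<bar> * grad_sup V f"
    proof (cases "support V f = {}")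
      case True
      then obtain c where "\<And>y. (\<integral>x. f x \<partial>G V y) = c" using integral_support_empty[OF fin True] by blast
      then show ?thesis using True by simp
    next
      case False
      define h where "h t = (\<integral>x. f x \<partial>G V (y(i := t)))" for t
      have h: "(\<integral>x. f x \<partial>G V y) = h (y i)" "(\<integral>x. f x \<partial>G V y') = h (y' i)"
        unfolding h_def using gibbs_cong[of V y' "y(i := y' i)"] eq by auto
      \<comment> \<open>The intermediate boundary conditions are well-tempered because altering one
        term preserves summability.\<close>
      have wt': "well_tempered M V (y(i := t))" for t
        unfolding well_tempered_def
      proof
        fix k assume "k \<in> V"
        then have "(\<lambda>j. \<bar>M k j\<bar> * \<bar>y j\<bar>) summable_on (- V)" using wt by (simp add: well_tempered_def)
        then have "(\<lambda>j. \<bar>M k j\<bar> * \<bar>y j\<bar>) summable_on (- V - {i})"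
          by (rule summable_on_cofin_subset) simp
        then have "(\<lambda>j. \<bar>M k j\<bar> * \<bar>(y(i := t)) j\<bar>) summable_on (- V - {i})"
          by (rule summable_on_cong[THEN iffD1, rotated]) simp
        then have "(\<lambda>j. \<bar>M k j\<bar> * \<bar>(y(i := t)) j\<bar>) summable_on ((- V - {i}) \<union> {i})"
          by (rule summable_on_union) simp
        moreover have "(- V - {i}) \<union> {i} = - V" using i by auto
        ultimately show "(\<lambda>j. \<bar>M k j\<bar> * \<bar>(y(i := t)) j\<bar>) summable_on (- V)" by simp
      qed
      have sm: "smooth V f" using f by (simp add: smooth_bounded_derivs_def)
      obtain C where C: "\<And>x. x \<in> configs V \<Longrightarrow> \<bar>f x\<bar> \<le> C * (1 + (l1 V x))"
        using smooth_bounded_derivs_growth[OF fin f] by blast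
      have growth: "\<bar>f x\<bar> \<le> \<bar>C\<bar> * exp (1 * (l1 V x))" if "x \<in> configs V" for x
      proof -
        have "C * (1 + (l1 V x)) \<le> \<bar>C\<bar> * exp (l1 V x)"
          using exp_ge_add_one_self[of "\<Sum>i\<in>V. \<bar>x i\<bar>"] by (intro mult_mono) (auto simp: sum_nonneg add_nonneg_nonneg)
        with C[OF that] show ?thesis by simp
      qed
      define B where "B = 2 * (K * ?D powr (- p) * (grad_sup V f / sqrt \<rho>))"
      let ?l = "\<lambda>z. \<Sum>k\<in>V. M k i * z k"
      have der: "(h has_real_derivative - 2 * covariance (G V (y(i := t))) f ?l) (at t)" for t
      proof -
        interpret prob_space "G V (y(i := t))" by (rule prob_space_gibbs[OF fin])
        have "L2 (G V (y(i := t))) f" "L2 (G V (y(i := t))) ?l"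
          using H1_smooth[OF fin f] H1_linear[OF fin, of _ "\<lambda>k. M k i"] unfolding H1_with_gradient_def by blast+
        from has_derivative_boundary[OF fin i wt'[of t] smooth_measurable(1)[OF sm] growth] covariance_eq[OF this]
        show ?thesis by (simp add: h_def[abs_def])
      qed
      have bd: "norm (- 2 * covariance (G V (y(i := t))) f ?l) \<le> B" for t
      proof -
        have "L2 (G V (y(i := t))) f" using H1_smooth[OF fin f] unfolding H1_with_gradient_def by blast
        then have "\<bar>covariance (G V (y(i := t))) f ?l\<bar> \<le> K * ?D powr (- p) * sqrt (var (G V (y(i := t))) f)"
          using cov fin wt' False by blast
        also have "\<dots> \<le> K * ?D powr (- p) * (grad_sup V f / sqrt \<rho>)"
          using K by (intro mult_left_mono poincare_smooth(1) fin wt' f) auto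
        finally show ?thesis by (simp add: B_def abs_mult)
      qed
      have gs: "grad_sup V f \<ge> 0" by (rule poincare_smooth(2)[OF fin wt f])
      have "norm (h (y i) - h (y' i)) \<le> B * norm (y i - y' i)"
        by (rule field_differentiable_bound[OF convex_UNIV]) (use der bd in auto)
      also have "\<dots> = 2 * K / sqrt \<rho> * ?D powr (- p) * (\<bar>y' i - y i\<bar> * grad_sup V f)"
        by (simp add: B_def abs_minus_commute mult_ac)
      also have "\<dots> \<le> 2 * K / sqrt \<rho> * (real (card (support V f)) powr (1 / 2) * 1) / ?D powr p * \<bar>y' i - y i\<bar> * grad_sup V f"
        using K \<rho>_pos support_weight[OF fin False] gs by (intro weighted_bound) (auto simp: powr_half_sqrt)
      finally show ?thesis by (simp add: h)
    qed
    then show "\<bar>(\<integral>x. f x \<partial>G V y) - (\<integral>x. f x \<partial>G V y')\<bar> \<le>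
      2 * K / sqrt \<rho> * real (card (support V f)) powr (1 / 2) / ?D powr (real CARD('d) + \<alpha> / 2) * \<bar>y' i - y i\<bar> * grad_sup V f"
      unfolding p_def .
  qed
qed

end

section \<open>Verification of coercivity and confinement\<close>

theorem theorem2p4:
  fixes M :: "int ^ 'd \<Rightarrow> int ^ 'd \<Rightarrow> real"
    and \<psi> \<psi>b \<psi>c :: "int ^ 'd \<Rightarrow> real \<Rightarrow> real"
    and s :: "int ^ 'd \<Rightarrow> real"
    and \<delta> C\<psi> CM \<alpha>M \<rho> :: real
  assumes symmetric: "\<And>i j. M i j = M j i"
    and \<delta>_pos: "\<delta> > 0"
    and row_summable: "\<And>i. (\<lambda>j. \<bar>M i j\<bar>) summable_on (- {i})"
    and diagonal_dominance: "\<And>i. \<delta> + (\<Sum>\<^sub>\<infinity>j\<in>- {i}. \<bar>M i j\<bar>) \<le> M i i"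
    and decomposition: "\<And>i r. \<psi> i r = \<psi>b i r + \<psi>c i r"
    and \<psi>c_diff: "\<And>i r. \<psi>c i differentiable at r"
    and \<psi>c_twice_diff: "\<And>i r. deriv (\<psi>c i) differentiable at r"
    and \<psi>c_convex: "\<And>i r. deriv (deriv (\<psi>c i)) r \<ge> 0"
    and \<psi>b_diff: "\<And>i r. \<psi>b i differentiable at r"
    and \<psi>b_bounded: "\<And>i r. \<bar>\<psi>b i r\<bar> + \<bar>deriv (\<psi>b i) r\<bar> \<le> C\<psi>"
    and CM_pos: "CM > 0"
    and \<alpha>M_pos: "\<alpha>M > 0"
    and interaction_decay:
      "\<And>i j. \<bar>M i j\<bar> \<le> CM * (1 + site_norm (i - j)) powr (- (2 * real CARD('d) + \<alpha>M))"
    and \<rho>_pos: "\<rho> > 0"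
    and poincare:
      "\<And>\<Lambda> \<omega> f F. finite \<Lambda> \<Longrightarrow> well_tempered M \<Lambda> \<omega> \<Longrightarrow>
        H1_with_gradient \<Lambda> (gibbs M \<psi> s \<Lambda> \<omega>) f F \<Longrightarrow>
        var (gibbs M \<psi> s \<Lambda> \<omega>) f \<le>
          1 / \<rho> * (\<integral>x. (\<Sum>i\<in>\<Lambda>. (F i x)\<^sup>2) \<partial>gibbs M \<psi> s \<Lambda> \<omega>)"
  shows "(\<exists>C>0. \<forall>\<Lambda> \<omega> f F g G. finite \<Lambda> \<longrightarrow> well_tempered M \<Lambda> \<omega> \<longrightarrow>
        H1_with_gradient \<Lambda> (gibbs M \<psi> s \<Lambda> \<omega>) f F \<longrightarrow>
        H1_with_gradient \<Lambda> (gibbs M \<psi> s \<Lambda> \<omega>) g G \<longrightarrow>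
        \<bar>covariance (gibbs M \<psi> s \<Lambda> \<omega>) f g\<bar> \<le>
          C * (sqrt (real (card (support \<Lambda> f))) * sqrt (real (card (support \<Lambda> g))))
            / (1 + site_dist (support \<Lambda> f) (support \<Lambda> g)) powr (real CARD('d) + \<alpha>M / 2)
            * sqrt (\<integral>x. (\<Sum>i\<in>\<Lambda>. (F i x)\<^sup>2) \<partial>gibbs M \<psi> s \<Lambda> \<omega>)
            * sqrt (\<integral>x. (\<Sum>i\<in>\<Lambda>. (G i x)\<^sup>2) \<partial>gibbs M \<psi> s \<Lambda> \<omega>))
      \<and> decay_of_correlations M \<psi> s
      \<and> dobrushin_shlosman M \<psi> s"
proof -
  have row_le: "(\<Sum>j\<in>\<Lambda> - {i}. \<bar>M i j\<bar>) \<le> M i i - \<delta>" if "finite \<Lambda>" for \<Lambda> i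
  proof -
    have "(\<Sum>j\<in>\<Lambda> - {i}. \<bar>M i j\<bar>) \<le> (\<Sum>\<^sub>\<infinity>j\<in>- {i}. \<bar>M i j\<bar>)"
      using that by (intro finite_sum_le_infsum row_summable) auto
    then show ?thesis using diagonal_dominance[of i] by linarith
  qed
  have coercive: "\<delta> * (\<Sum>i\<in>\<Lambda>. (x i)\<^sup>2) \<le> (\<Sum>i\<in>\<Lambda>. \<Sum>j\<in>\<Lambda>. M i j * x i * x j)"
    if fin: "finite \<Lambda>" for \<Lambda> and x :: "int ^ 'd \<Rightarrow> real"
  proof -
    \<comment> \<open>By \<open>2 * \<bar>x i * x j\<bar> \<le> (x i)\<^sup>2 + (x
      j)\<^sup>2\<close> the off-diagonal form is at least minus the mean of two sums, which both
      equal \<open>a\<close> by symmetry of \<open>M\<close>. Diagonal dominance lets the diagonal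
      pay for \<open>a\<close> and keep \<open>\<delta>\<close>.\<close>
    define a where "a = (\<Sum>i\<in>\<Lambda>. \<Sum>j\<in>\<Lambda> - {i}. \<bar>M i j\<bar> * (x i)\<^sup>2)"
    have swap: "(\<Sum>i\<in>\<Lambda>. \<Sum>j\<in>\<Lambda> - {i}. \<bar>M i j\<bar> * (x j)\<^sup>2) = a"
    proof -
      have "(\<Sum>i\<in>\<Lambda>. \<Sum>j\<in>\<Lambda> - {i}. \<bar>M i j\<bar> * (x j)\<^sup>2) = (\<Sum>i\<in>\<Lambda>. \<Sum>j\<in>\<Lambda>. if i = j then 0 else \<bar>M i j\<bar> * (x j)\<^sup>2)"
        using fin by (intro sum.cong refl sum.mono_neutral_cong_left) auto
      also have "\<dots> = (\<Sum>j\<in>\<Lambda>. \<Sum>i\<in>\<Lambda>. if i = j then 0 else \<bar>M i j\<bar> * (x j)\<^sup>2)" by (rule sum.swap)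
      also have "\<dots> = (\<Sum>j\<in>\<Lambda>. \<Sum>i\<in>\<Lambda> - {j}. \<bar>M j i\<bar> * (x j)\<^sup>2)"
        using fin symmetric by (intro sum.cong refl sum.mono_neutral_cong_right) auto
      finally show ?thesis by (simp add: a_def)
    qed
    have off: "- (\<bar>M i j\<bar> * (x i)\<^sup>2 + \<bar>M i j\<bar> * (x j)\<^sup>2) / 2 \<le> M i j * x i * x j" for i j
    proof -
      have "0 \<le> (\<bar>x i\<bar> - \<bar>x j\<bar>)\<^sup>2" by simp
      then have "\<bar>x i\<bar> * \<bar>x j\<bar> \<le> ((x i)\<^sup>2 + (x j)\<^sup>2) / 2" by (simp add: power2_diff)
      then have "\<bar>M i j\<bar> * (\<bar>x i\<bar> * \<bar>x j\<bar>) \<le> \<bar>M i j\<bar> * (((x i)\<^sup>2 + (x j)\<^sup>2) / 2)" by (rule mult_left_mono) simp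
      then have "\<bar>M i j * x i * x j\<bar> \<le> (\<bar>M i j\<bar> * (x i)\<^sup>2 + \<bar>M i j\<bar> * (x j)\<^sup>2) / 2"
        by (simp add: abs_mult distrib_left mult.assoc)
      then show ?thesis by linarith
    qed
    have "(\<Sum>i\<in>\<Lambda>. \<delta> * (x i)\<^sup>2) \<le> (\<Sum>i\<in>\<Lambda>. M i i * (x i)\<^sup>2 - (\<Sum>j\<in>\<Lambda> - {i}. \<bar>M i j\<bar> * (x i)\<^sup>2))"
    proof (rule sum_mono)
      fix i
      have "\<delta> * (x i)\<^sup>2 \<le> (M i i - (\<Sum>j\<in>\<Lambda> - {i}. \<bar>M i j\<bar>)) * (x i)\<^sup>2"
        using row_le[OF fin, of i] by (intro mult_right_mono) auto
      then show "\<delta> * (x i)\<^sup>2 \<le> M i i * (x i)\<^sup>2 - (\<Sum>j\<in>\<Lambda> - {i}. \<bar>M i j\<bar> * (x i)\<^sup>2)"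
        by (simp add: left_diff_distrib sum_distrib_right)
    qed
    then have "\<delta> * (\<Sum>i\<in>\<Lambda>. (x i)\<^sup>2) \<le> (\<Sum>i\<in>\<Lambda>. M i i * (x i)\<^sup>2) - a"
      by (simp add: sum_distrib_left sum_subtractf a_def)
    also have "\<dots> \<le> (\<Sum>i\<in>\<Lambda>. M i i * (x i)\<^sup>2) + (\<Sum>i\<in>\<Lambda>. \<Sum>j\<in>\<Lambda> - {i}. M i j * x i * x j)"
    proof -
      have "(\<Sum>i\<in>\<Lambda>. \<Sum>j\<in>\<Lambda> - {i}. - (\<bar>M i j\<bar> * (x i)\<^sup>2 + \<bar>M i j\<bar> * (x j)\<^sup>2) / 2) \<le> (\<Sum>i\<in>\<Lambda>. \<Sum>j\<in>\<Lambda> - {i}. M i j * x i * x j)"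
        by (intro sum_mono off)
      moreover have "(\<Sum>i\<in>\<Lambda>. \<Sum>j\<in>\<Lambda> - {i}. - (\<bar>M i j\<bar> * (x i)\<^sup>2 + \<bar>M i j\<bar> * (x j)\<^sup>2) / 2) =
          - ((\<Sum>i\<in>\<Lambda>. \<Sum>j\<in>\<Lambda> - {i}. \<bar>M i j\<bar> * (x i)\<^sup>2) + (\<Sum>i\<in>\<Lambda>. \<Sum>j\<in>\<Lambda> - {i}. \<bar>M i j\<bar> * (x j)\<^sup>2)) / 2"
        by (simp only: sum.distrib[symmetric] sum_negf[symmetric] sum_divide_distrib)
      ultimately have "- (a + a) / 2 \<le> (\<Sum>i\<in>\<Lambda>. \<Sum>j\<in>\<Lambda> - {i}. M i j * x i * x j)"
        unfolding swap a_def[symmetric] by (simp only:)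
      moreover have "- (a + a) / 2 = - a" by simp
      ultimately have "- a \<le> (\<Sum>i\<in>\<Lambda>. \<Sum>j\<in>\<Lambda> - {i}. M i j * x i * x j)" by (simp only:)
      from add_left_mono[OF this] show ?thesis by (simp only: diff_conv_add_uminus)
    qed
    also have "\<dots> = (\<Sum>i\<in>\<Lambda>. \<Sum>j\<in>\<Lambda>. M i j * x i * x j)"
      unfolding sum.distrib[symmetric]
      using fin by (intro sum.cong refl) (simp add: sum.remove power2_eq_square mult.assoc)
    finally show ?thesis .
  qed
  \<comment> \<open>A convex function lies above its tangent at 0. With bounded
    \<open>\<psi>b\<close> this gives the lower bound on \<open>\<psi>\<close> that is affine in
    \<open>\<bar>r\<bar>\<close>; the quadratic confinement is supplied by
    \<open>coercive\<close>.\<close>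
  have tangent: "\<psi>c i 0 + deriv (\<psi>c i) 0 * r \<le> \<psi>c i r" for i r
  proof -
    have d1: "(\<psi>c i has_real_derivative deriv (\<psi>c i) t) (at t)" for t
      using \<psi>c_diff by (simp add: DERIV_deriv_iff_real_differentiable)
    have d2: "(deriv (\<psi>c i) has_real_derivative deriv (deriv (\<psi>c i)) t) (at t)" for t
      using \<psi>c_twice_diff by (simp add: DERIV_deriv_iff_real_differentiable)
    have "\<psi>c i r - \<psi>c i 0 \<ge> deriv (\<psi>c i) 0 * (r - 0)"
      by (rule f''_imp_f'[where C = UNIV and f'' = "deriv (deriv (\<psi>c i))"])
        (use d1 d2 \<psi>c_convex in auto)
    then show ?thesis by simp
  qed
  have cont: "continuous_on UNIV (\<psi> i)" for i
  proof -
    have "isCont (\<psi>b i) r" "isCont (\<psi>c i) r" for r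
      using \<psi>b_diff \<psi>c_diff by (auto intro: differentiable_imp_continuous_within)
    then have "continuous_on UNIV (\<lambda>r. \<psi>b i r + \<psi>c i r)"
      by (intro continuous_at_imp_continuous_on ballI continuous_intros)
    moreover have "\<psi> i = (\<lambda>r. \<psi>b i r + \<psi>c i r)" by (rule ext) (rule decomposition)
    ultimately show ?thesis by (simp only:)
  qed
  have lower: "\<exists>a b. \<forall>r. a - b * \<bar>r\<bar> \<le> \<psi> i r" for i
  proof (intro exI allI)
    fix r
    have "- C\<psi> \<le> \<psi>b i r" using \<psi>b_bounded[of i r] by linarith
    moreover have "- (\<bar>deriv (\<psi>c i) 0\<bar> * \<bar>r\<bar>) \<le> deriv (\<psi>c i) 0 * r"
      using abs_ge_minus_self[of "deriv (\<psi>c i) 0 * r"] unfolding abs_mult by linarith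
    ultimately show "\<psi>c i 0 - C\<psi> - \<bar>deriv (\<psi>c i) 0\<bar> * \<bar>r\<bar> \<le> \<psi> i r"
      using tangent[of i r] decomposition[of i r] by linarith
  qed
  interpret lattice_system M \<psi> s \<delta> \<rho> CM \<alpha>M
    by unfold_locales
      (rule symmetric \<delta>_pos coercive cont lower \<rho>_pos poincare CM_pos \<alpha>M_pos interaction_decay | assumption)+
  show ?thesis
    using covariance_H1 decay_of_correlations dobrushin_shlosman by (intro conjI)
qed

end
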